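(* Let $\nu$ be a finite real signed measure on $\mathbb T_\pi$, singular with respect to $m_\pi$, with $\nu(\mathbb T_\pi)=1$. For $z\in\mathbb D$ define $$\mathcal F_\nu(z):=\int_{\mathbb T_\pi} i\,\frac{1-e^{-2i\alpha}z}{1+e^{-2i\alpha}z}\,\nu(\mathrm d\alpha),$$ and let $\mathcal F_\nu^*$ be its nontangential boundary value on the unit circle, which is finite and real almost everywhere. Let $S(\alpha)=\alpha+\pi/2$ modulo $\pi$. Then, as $x\to\infty$, weak-* as finite measures on $\mathbb T_\pi$, $$\pi x\,\mathbf 1_{\{\phi:\,|\mathcal F_\nu^*(e^{2i\phi})|>x\}}\,m_\pi\longrightarrow 2\,S_\#|\nu|.$$ In particular, $$\lim_{x\to\infty}x\,m_\pi\{\phi:|\mathcal F_\nu^*(e^{2i\phi})|>x\}=\frac2\pi\|\nu\|_{\mathrm{TV}}.$$ Consequently, for $\Phi\sim m_\pi$, $$\mathcal F_\nu^*(e^{2i\Phi})\sim\mathrm{Cauchy}(0,1)\quad\Longleftrightarrow\quad \nu\text{ is a positive probability measure}.$$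
   Context: $\mathbb T_\pi=\mathbb R/(\pi\mathbb Z)$, $m_\pi$ is normalized Lebesgue (probability) measure on $\mathbb T_\pi$, and $\mathbb D$ is the open unit disk in $\mathbb C$. $|\nu|$ is the total variation measure, $\|\nu\|_{\mathrm{TV}}=|\nu|(\mathbb T_\pi)$, and $S_\#$ denotes pushforward. $\mathrm{Cauchy}(0,1)$ is the standard Cauchy law. *)

theory Defs
  imports "HOL-Probability.Probability"
begin

section \<open>The circle \<open>\<real> / \<pi>\<int>\<close>\<close>

quotient_type tpi = real / "\<lambda>x y. \<exists>k::int. x - y = of_int k * pi"
  morphisms rep_tpi tpi_of_real
proof (rule equivpI)
  show "reflp (\<lambda>x y. \<exists>k::int. x - y = of_int k * pi)"
    by (rule reflpI) (rule exI[of _ 0], simp)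
  show "symp (\<lambda>x y. \<exists>k::int. x - y = of_int k * pi)"
  proof (rule sympI)
    fix x y :: real
    assume "\<exists>k::int. x - y = of_int k * pi"
    then obtain k :: int where "x - y = of_int k * pi" by blast
    then have "y - x = of_int (- k) * pi" by simp
    then show "\<exists>k::int. y - x = of_int k * pi" by blast
  qed
  show "transp (\<lambda>x y. \<exists>k::int. x - y = of_int k * pi)"
  proof (rule transpI)
    fix x y z :: real
    assume "\<exists>k::int. x - y = of_int k * pi" "\<exists>k::int. y - z = of_int k * pi"
    then obtain k l :: int where "x - y = of_int k * pi" "y - z = of_int l * pi" by blast
    then have "x - z = of_int (k + l) * pi" by (simp add: algebra_simps)
    then show "\<exists>k::int. x - z = of_int k * pi" by blast
  qed
qed

text \<open>The quotient topology; \<open>borel :: tpi measure\<close> is generated by it.\<close>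

instantiation tpi :: topological_space
begin

definition open_tpi :: "tpi set \<Rightarrow> bool" where
  "open_tpi U \<longleftrightarrow> open (tpi_of_real -` U)"

instance
proof
  show "open (UNIV :: tpi set)"
    by (simp add: open_tpi_def)
  show "open (S \<inter> T)" if "open S" "open T" for S T :: "tpi set"
    using that by (simp add: open_tpi_def vimage_Int open_Int)
  show "open (\<Union>K)" if "\<forall>S\<in>K. open S" for K :: "tpi set set"
    using that by (auto simp: open_tpi_def vimage_Union)
qed

end

definition m_pi :: "tpi measure" where
  "m_pi = distr (uniform_measure lborel {0..<pi}) borel tpi_of_real"

lift_definition shift_half :: "tpi \<Rightarrow> tpi" is "\<lambda>\<alpha>. \<alpha> + pi / 2"
  by simp

lemma exp_2i_cong:
  fixes x y :: real and k :: int
  assumes "x - y = of_int k * pi"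
  shows "exp (2 * \<i> * of_real x) = exp (2 * \<i> * of_real y)"
proof -
  have "x = y + of_int k * pi"
    using assms by simp
  then have "2 * \<i> * of_real x = 2 * \<i> * of_real y + of_int (2 * k) * (of_real pi * \<i>)"
    by (simp add: algebra_simps)
  then show ?thesis
    by (subst exp_eq) (auto intro!: exI[of _ k])
qed

lift_definition circle_point :: "tpi \<Rightarrow> complex" is "\<lambda>\<phi>. exp (2 * \<i> * of_real \<phi>)"
  using exp_2i_cong by blast

section \<open>Finite real signed measures\<close>

text \<open>
  A finite signed measure on the measurable space \<open>M\<close> is a real-valued set function that is
  countably additive on \<open>sets M\<close>; its values outside \<open>sets M\<close> are irrelevant.
\<close>

definition finite_signed_measure :: "'a measure \<Rightarrow> ('a set \<Rightarrow> real) \<Rightarrow> bool" where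
  "finite_signed_measure M \<nu> \<longleftrightarrow>
     (\<forall>A :: nat \<Rightarrow> 'a set. range A \<subseteq> sets M \<longrightarrow> disjoint_family A \<longrightarrow>
        (\<lambda>i. \<nu> (A i)) sums \<nu> (\<Union>i. A i))"

text \<open>Total variation, as a supremum over countable measurable partitions.\<close>

definition total_variation :: "'a measure \<Rightarrow> ('a set \<Rightarrow> real) \<Rightarrow> 'a measure" where
  "total_variation M \<nu> = measure_of (space M) (sets M)
     (\<lambda>A. SUP E \<in> {E :: nat \<Rightarrow> 'a set. range E \<subseteq> sets M \<and> disjoint_family E \<and> (\<Union>i. E i) = A}.
        \<Sum>i. ennreal \<bar>\<nu> (E i)\<bar>)"

definition tv_norm :: "'a measure \<Rightarrow> ('a set \<Rightarrow> real) \<Rightarrow> real" where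
  "tv_norm M \<nu> = measure (total_variation M \<nu>) (space M)"

text \<open>The Jordan decomposition \<open>\<nu>\<^sup>\<plusminus> = (|\<nu>| \<plusminus> \<nu>) / 2\<close>.\<close>

definition pos_part :: "'a measure \<Rightarrow> ('a set \<Rightarrow> real) \<Rightarrow> 'a measure" where
  "pos_part M \<nu> = measure_of (space M) (sets M)
     (\<lambda>A. ennreal ((measure (total_variation M \<nu>) A + \<nu> A) / 2))"

definition neg_part :: "'a measure \<Rightarrow> ('a set \<Rightarrow> real) \<Rightarrow> 'a measure" where
  "neg_part M \<nu> = measure_of (space M) (sets M)
     (\<lambda>A. ennreal ((measure (total_variation M \<nu>) A - \<nu> A) / 2))"

definition signed_integral ::
  "'a measure \<Rightarrow> ('a set \<Rightarrow> real) \<Rightarrow> ('a \<Rightarrow> 'b::{banach, second_countable_topology}) \<Rightarrow> 'b" where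
  "signed_integral M \<nu> f = integral\<^sup>L (pos_part M \<nu>) f - integral\<^sup>L (neg_part M \<nu>) f"

definition singular_to :: "'a measure \<Rightarrow> ('a set \<Rightarrow> real) \<Rightarrow> bool" where
  "singular_to M \<nu> \<longleftrightarrow>
     (\<exists>N \<in> sets M. emeasure M N = 0 \<and> emeasure (total_variation M \<nu>) (space M - N) = 0)"

definition is_positive_probability :: "'a measure \<Rightarrow> ('a set \<Rightarrow> real) \<Rightarrow> bool" where
  "is_positive_probability M \<nu> \<longleftrightarrow>
     (\<exists>P. prob_space P \<and> sets P = sets M \<and> (\<forall>A \<in> sets M. \<nu> A = measure P A))"

section \<open>The transform and its boundary values\<close>

lift_definition kernel :: "tpi \<Rightarrow> complex \<Rightarrow> complex" is
  "\<lambda>\<alpha> z. \<i> * ((1 - exp (- 2 * \<i> * of_real \<alpha>) * z) / (1 + exp (- 2 * \<i> * of_real \<alpha>) * z))"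
proof -
  fix x y :: real
  assume "\<exists>k::int. x - y = of_int k * pi"
  then have "exp (- (2 * \<i> * of_real x)) = exp (- (2 * \<i> * of_real y))"
    using exp_2i_cong by (metis exp_minus)
  then show "(\<lambda>z. \<i> * ((1 - exp (- 2 * \<i> * of_real x) * z) / (1 + exp (- 2 * \<i> * of_real x) * z))) =
             (\<lambda>z. \<i> * ((1 - exp (- 2 * \<i> * of_real y) * z) / (1 + exp (- 2 * \<i> * of_real y) * z)))"
    by simp
qed

definition herglotz_transform :: "(tpi set \<Rightarrow> real) \<Rightarrow> complex \<Rightarrow> complex" where
  "herglotz_transform \<nu> z = signed_integral borel \<nu> (\<lambda>\<alpha>. kernel \<alpha> z)"

text \<open>The approach region is empty for aperture \<open>a \<le> 1\<close>, hence the restriction to \<open>a > 1\<close> below.\<close>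

definition stolz_region :: "real \<Rightarrow> complex \<Rightarrow> complex set" where
  "stolz_region a \<zeta> = {z \<in> ball 0 1. dist z \<zeta> < a * (1 - cmod z)}"

definition has_nontangential_limit :: "(complex \<Rightarrow> complex) \<Rightarrow> complex \<Rightarrow> complex \<Rightarrow> bool" where
  "has_nontangential_limit f \<zeta> L \<longleftrightarrow>
     (\<forall>a > 1. (f \<longlongrightarrow> L) (at \<zeta> within stolz_region a \<zeta>))"

text \<open>The value \<open>0\<close> at points without a nontangential limit is a dummy.\<close>

definition boundary_value :: "(complex \<Rightarrow> complex) \<Rightarrow> complex \<Rightarrow> complex" where
  "boundary_value f \<zeta> =
     (if \<exists>L. has_nontangential_limit f \<zeta> L then THE L. has_nontangential_limit f \<zeta> L else 0)"

section \<open>Weak-* convergence and the Cauchy law\<close>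

definition weak_star_tendsto ::
  "('i \<Rightarrow> tpi measure) \<Rightarrow> tpi measure \<Rightarrow> 'i filter \<Rightarrow> bool" where
  "weak_star_tendsto \<mu> \<mu>0 F \<longleftrightarrow>
     (\<forall>f :: tpi \<Rightarrow> real. continuous_on UNIV f \<longrightarrow>
        ((\<lambda>i. integral\<^sup>L (\<mu> i) f) \<longlongrightarrow> integral\<^sup>L \<mu>0 f) F)"

definition cauchy_density :: "real \<Rightarrow> real \<Rightarrow> real \<Rightarrow> real" where
  "cauchy_density x0 \<gamma> t = \<gamma> / (pi * ((t - x0)\<^sup>2 + \<gamma>\<^sup>2))"

end

theory Submission
  imports Defs "HOL-Complex_Analysis.Complex_Analysis" "HOL-Real_Asymp.Real_Asymp"
begin

text \<open>
  After \<open>\<alpha> \<mapsto> \<omega> = - exp (2 \<i> \<alpha>)\<close> the transform becomes the classical Herglotz integral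
  \<open>H \<mu> z = \<integral> \<i> (\<omega> + z) / (\<omega> - z) d\<mu>\<close> over the unit circle; the sign in \<open>\<omega>\<close> absorbs the
  half turn \<open>S\<close>, because \<open>H \<mu>\<close> is singular exactly at the mass of \<open>\<mu>\<close>. The Jordan decomposition
  then turns \<open>\<nu>\<close> into a difference of two positive measures \<open>p\<close>, \<open>n\<close> that are singular to arc
  length and to each other, and the image of \<open>|\<nu>|\<close> under \<open>S\<close> into \<open>p + n\<close>. Everything rests on three facts about one
  positive measure \<open>\<mu>\<close> on the circle.

  \<^item> \<^emph>\<open>Maximal estimate.\<close> Since \<open>Im (H \<mu>) > 0\<close> for \<open>\<mu> \<noteq> 0\<close>, the square root \<open>G\<close> of \<open>H \<mu> / \<i>\<close> is holomorphic
    with \<open>|H \<mu>| \<le> 2 (Re G)\<^sup>2\<close>. So the nontangential maximal function of \<open>H \<mu>\<close>, conjugate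
    function included, is controlled by that of the positive harmonic function \<open>Re G\<close>, for which a
    covering argument suffices (\<open>poisson_maximal\<close>). The resulting bound \<open>C sqrt (\<mu>(1) / \<lambda>)\<close> is not
    sharp, but it tends to \<open>0\<close> with the mass (\<open>herglotz_maximal\<close>).

  \<^item> \<^emph>\<open>Boundary values.\<close> A singular \<open>\<mu>\<close> lives, up to arbitrarily small mass, on a compact null set
    \<open>K\<close>. Off \<open>K\<close> the integral over \<open>K\<close> is Lipschitz up to the circle and real on it, and the
    maximal estimate handles the remainder. Hence nontangential limits exist almost everywhere and
    are real (\<open>AE_nontangential_limit\<close>).

  \<^item> \<^emph>\<open>Exact law.\<close> For \<open>t > 0\<close> the function \<open>exp (\<i> t H \<mu>)\<close> is bounded and holomorphic, so its
    boundary values have mean \<open>exp (\<i> t H \<mu> 0) = exp (- t \<mu>(1))\<close>. This is the characteristic function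
    of the Cauchy law of scale \<open>\<mu>(1)\<close>, whose tail \<open>(2 / \<pi>) arctan (\<mu>(1) / x)\<close> is explicit
    (\<open>radial_limit_tail\<close>).

  For the signed problem, restrict \<open>p\<close> and \<open>n\<close> to disjoint compact sets inside an open set \<open>G\<close>,
  losing little mass there. Near each compact set all other pieces, save the small ones, are bounded.
  So to leading order the events that the two main pieces exceed \<open>x\<close> are disjoint, lie in \<open>G\<close>, and
  have the exact tails of the third fact, while the small pieces cost \<open>\<epsilon> / (\<delta> x)\<close>
  (\<open>ex_localized\<close>). This bounds \<open>x\<close> times the measure of the exceedance set in \<open>G\<close> from below by
  \<open>(2 / \<pi>) (p + n)(G)\<close> in the limit and, for the whole circle, also from above. Lower bounds on open
  sets and convergence of the total mass give weak convergence
  (\<open>integral_tendsto_of_open_liminf\<close>).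

  If \<open>\<nu>\<close> is positive, the third fact is the Cauchy law. Conversely, the Cauchy law forces the tail
  constant \<open>2 / \<pi>\<close>, so \<open>\<nu>\<close> has total variation \<open>1 = \<nu>(1)\<close> and the negative part vanishes.
\<close>

section \<open>Jordan decomposition of finite signed measures\<close>

lemma finite_signed_measure_sums:
  assumes "finite_signed_measure M \<nu>" "\<And>i::nat. A i \<in> sets M" "disjoint_family A"
  shows "(\<lambda>i. \<nu> (A i)) sums \<nu> (\<Union>i. A i)"
proof -
  have "range A \<subseteq> sets M" using assms(2) by (rule image_subsetI)
  then show ?thesis
    using assms(1,3) unfolding finite_signed_measure_def by simp
qed

lemma finite_signed_measure_empty:
  assumes "finite_signed_measure M \<nu>"
  shows "\<nu> {} = 0"
proof -
  have "(\<lambda>i::nat. \<nu> {}) sums \<nu> (\<Union>i::nat. {})"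
    using assms unfolding finite_signed_measure_def
    by (elim allE[of _ "\<lambda>_::nat. {}"]) (auto simp: disjoint_family_on_def)
  then show ?thesis
    by (auto dest!: sums_summable simp: summable_const_iff)
qed

lemma finite_signed_measure_Un:
  assumes "finite_signed_measure M \<nu>" "A \<in> sets M" "B \<in> sets M" "A \<inter> B = {}"
  shows "\<nu> (A \<union> B) = \<nu> A + \<nu> B"
proof -
  have "disjoint_family (binaryset A B)"
    using assms(4) by (auto simp: disjoint_family_on_def binaryset_def)
  moreover have "range (binaryset A B) \<subseteq> sets M"
    using assms(2,3) by (auto simp: range_binaryset_eq)
  ultimately have "(\<lambda>i. \<nu> (binaryset A B i)) sums \<nu> (A \<union> B)"
    using assms(1) unfolding finite_signed_measure_def UN_binaryset_eq[symmetric] by blast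
  moreover have "(\<lambda>i. \<nu> (binaryset A B i)) sums (\<Sum>i\<in>{0,1}. \<nu> (binaryset A B i))"
    by (rule sums_finite) (auto simp: binaryset_def finite_signed_measure_empty[OF assms(1)])
  ultimately show ?thesis
    by (auto dest: sums_unique2 simp: binaryset_def)
qed

lemma finite_signed_measure_Diff:
  assumes "finite_signed_measure M \<nu>" "A \<in> sets M" "B \<in> sets M" "B \<subseteq> A"
  shows "\<nu> (A - B) = \<nu> A - \<nu> B"
proof -
  have "(A - B) \<union> B = A" "(A - B) \<inter> B = {}" using assms(4) by auto
  then show ?thesis
    using finite_signed_measure_Un[OF assms(1), of "A - B" B] assms(2,3) by simp
qed

lemma finite_signed_measure_restrict:
  assumes "finite_signed_measure M \<nu>" "P \<in> sets M"
  shows "finite_signed_measure M (\<lambda>A. \<nu> (A \<inter> P))"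
  unfolding finite_signed_measure_def
proof (intro allI impI)
  fix A :: "nat \<Rightarrow> 'a set"
  assume "range A \<subseteq> sets M" "disjoint_family A"
  then have "range (\<lambda>i. A i \<inter> P) \<subseteq> sets M" "disjoint_family (\<lambda>i. A i \<inter> P)"
    using assms(2) by (auto simp: disjoint_family_on_def)
  then show "(\<lambda>i. \<nu> (A i \<inter> P)) sums \<nu> ((\<Union>i. A i) \<inter> P)"
    using assms(1) unfolding finite_signed_measure_def by (metis UN_extend_simps(4))
qed

lemma finite_signed_measure_diff:
  assumes "finite_signed_measure M \<mu>" "finite_signed_measure M \<nu>"
  shows "finite_signed_measure M (\<lambda>A. \<mu> A - \<nu> A)"
  unfolding finite_signed_measure_def
proof (intro allI impI sums_diff)
  fix A :: "nat \<Rightarrow> 'a set"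
  assume A: "range A \<subseteq> sets M" "disjoint_family A"
  show "(\<lambda>i. \<mu> (A i)) sums \<mu> (\<Union>i. A i)" "(\<lambda>i. \<nu> (A i)) sums \<nu> (\<Union>i. A i)"
    using assms A unfolding finite_signed_measure_def by metis+
qed

lemma finite_signed_measure_UN_nonneg:
  fixes P :: "nat \<Rightarrow> 'a set"
  assumes \<nu>: "finite_signed_measure M \<nu>"
    and P: "\<And>n. P n \<in> sets M" "\<And>n A. A \<in> sets M \<Longrightarrow> A \<subseteq> P n \<Longrightarrow> 0 \<le> \<nu> A"
    and A: "A \<in> sets M" "A \<subseteq> (\<Union>n. P n)"
  shows "0 \<le> \<nu> A"
proof -
  let ?A = "\<lambda>n. A \<inter> disjointed P n"
  have meas: "?A n \<in> sets M" for n
    using A(1) sets.range_disjointed_sets[of P M] P(1) by blast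
  have "disjoint_family ?A"
    using disjoint_family_disjointed[of P] by (auto simp: disjoint_family_on_def)
  then have sums: "(\<lambda>n. \<nu> (?A n)) sums \<nu> (\<Union>n. ?A n)"
    by (intro finite_signed_measure_sums[OF \<nu>] meas)
  have "(\<Union>n. ?A n) = A"
    using A(2) UN_disjointed_eq[of P] by blast
  moreover have "0 \<le> \<nu> (?A n)" for n
    using meas disjointed_subset[of P n] by (intro P(2)[of _ n]) auto
  ultimately show ?thesis
    using sums_le[OF _ sums_zero sums] by simp
qed

text \<open>
  Negative pieces are removed greedily. The values of the removed disjoint pieces are summable, hence
  tend to zero, and each of them is comparable to the most negative value that was still available.
  So nothing negative remains in the limit.
\<close>

lemma ex_nonneg_subset:
  assumes \<nu>: "finite_signed_measure M \<nu>" and D: "D \<in> sets M"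
  obtains P where "P \<in> sets M" "P \<subseteq> D" "\<nu> D \<le> \<nu> P"
    "\<And>A. A \<in> sets M \<Longrightarrow> A \<subseteq> P \<Longrightarrow> 0 \<le> \<nu> A"
proof -
  note [simp] = finite_signed_measure_empty[OF \<nu>]
  \<comment> \<open>The alternative with \<open>-1\<close> covers sets \<open>E\<close> on which the infimum of \<open>\<nu>\<close> is not yet known to be finite.\<close>
  have "\<exists>B\<in>sets M. B \<subseteq> E \<and> \<nu> B \<le> 0 \<and>
      (\<nu> B \<le> -1 \<or> (\<forall>C\<in>sets M. C \<subseteq> E \<longrightarrow> 2 * \<nu> B \<le> \<nu> C))" if "E \<in> sets M" for E
  proof (cases "\<exists>B\<in>sets M. B \<subseteq> E \<and> \<nu> B \<le> -1")
    case True
    then obtain B where "B \<in> sets M" "B \<subseteq> E" "\<nu> B \<le> -1" by blast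
    then show ?thesis by (intro bexI[of _ B]) auto
  next
    case False
    let ?V = "\<nu> ` {C \<in> sets M. C \<subseteq> E}"
    define t where "t = Inf ?V"
    have bdd: "bdd_below ?V"
      using False by (intro bdd_belowI[of _ "-1"]) (auto simp: not_le less_imp_le)
    have ne: "?V \<noteq> {}" by blast
    have t: "t \<le> \<nu> C" if "C \<in> sets M" "C \<subseteq> E" for C
      unfolding t_def using that bdd by (intro cInf_lower) auto
    have "t \<le> 0" using t[of "{}"] by simp
    show ?thesis
    proof (cases "t = 0")
      case True
      then show ?thesis using t by (intro bexI[of _ "{}"]) auto
    next
      case False
      then have "t < t / 2" using \<open>t \<le> 0\<close> by simp
      then obtain B where "B \<in> sets M" "B \<subseteq> E" "\<nu> B < t / 2"
        unfolding t_def using cInf_lessD[OF ne] by blast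
      then have "\<nu> B \<le> 0" "\<forall>C\<in>sets M. C \<subseteq> E \<longrightarrow> 2 * \<nu> B \<le> \<nu> C"
        using t \<open>t \<le> 0\<close> by force+
      with \<open>B \<in> sets M\<close> \<open>B \<subseteq> E\<close> show ?thesis by blast
    qed
  qed
  then obtain b where b: "b E \<in> sets M" "b E \<subseteq> E" "\<nu> (b E) \<le> 0"
      "\<nu> (b E) \<le> -1 \<or> (\<forall>C\<in>sets M. C \<subseteq> E \<longrightarrow> 2 * \<nu> (b E) \<le> \<nu> C)" if "E \<in> sets M" for E
    by metis
  define F where "F n = ((\<lambda>E. E - b E) ^^ n) D" for n
  have F0: "F 0 = D" and FSuc: "F (Suc n) = F n - b (F n)" for n
    by (simp_all add: F_def)
  have Fm: "F n \<in> sets M" for n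
    by (induction n) (use D b(1) in \<open>auto simp: F0 FSuc\<close>)
  have Fdec: "F n \<subseteq> F m" if "m \<le> n" for m n
    using lift_Suc_antimono_le[of F, OF _ that] by (auto simp: FSuc)
  have "disjoint_family (\<lambda>n. b (F n))"
    unfolding disjoint_family_on_def
  proof (intro ballI impI)
    have "b (F m) \<inter> b (F n) = {}" if "m < n" for m n
      using b(2)[OF Fm, of n] Fdec[of "Suc m" n] that by (auto simp: FSuc)
    then show "b (F m) \<inter> b (F n) = {}" if "m \<noteq> n" for m n
      using that by (metis inf_commute linorder_neqE_nat)
  qed
  then have sums: "(\<lambda>n. \<nu> (b (F n))) sums \<nu> (\<Union>n. b (F n))"
    by (intro finite_signed_measure_sums[OF \<nu>] b(1) Fm)
  let ?B = "\<Union>n. b (F n)"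
  have "b (F n) \<subseteq> D" for n
    using b(2)[OF Fm, of n] Fdec[of 0 n] by (auto simp: F0)
  then have B: "?B \<in> sets M" "?B \<subseteq> D" "\<nu> ?B \<le> 0"
    using b(1)[OF Fm] sums_le[OF _ sums sums_zero] b(3)[OF Fm] by auto
  show ?thesis
  proof
    show "D - ?B \<in> sets M" "D - ?B \<subseteq> D" using B D by auto
    show "\<nu> D \<le> \<nu> (D - ?B)"
      using B D by (simp add: finite_signed_measure_Diff[OF \<nu>])
    fix C assume C: "C \<in> sets M" "C \<subseteq> D - ?B"
    have "D - ?B \<subseteq> F n" for n
      by (induction n) (auto simp: F0 FSuc)
    then have CF: "C \<subseteq> F n" for n using C(2) by blast
    have lim: "(\<lambda>n. \<nu> (b (F n))) \<longlonglongrightarrow> 0"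
      using sums by (intro summable_LIMSEQ_zero) (auto simp: sums_iff)
    then have lim2: "(\<lambda>n. 2 * \<nu> (b (F n))) \<longlonglongrightarrow> 0" by (rule tendsto_mult_right_zero)
    have "eventually (\<lambda>n. -1 < \<nu> (b (F n))) sequentially"
      using lim by (rule order_tendstoD) simp
    then have "eventually (\<lambda>n. 2 * \<nu> (b (F n)) \<le> \<nu> C) sequentially"
    proof eventually_elim
      fix n assume "-1 < \<nu> (b (F n))"
      then show "2 * \<nu> (b (F n)) \<le> \<nu> C"
        using b(4)[OF Fm, of n] C(1) CF by auto
    qed
    then show "0 \<le> \<nu> C"
      by (rule tendsto_upperbound[OF lim2 _ sequentially_bot])
  qed
qed

text \<open>
  The values of \<open>\<nu>\<close> on sets without negative subsets are bounded, because such sets are closed under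
  countable unions and \<open>\<nu>\<close> is finite on the union. A set \<open>P\<close> attaining the supremum works: positive
  mass outside \<open>P\<close> would, by the previous lemma, contain a set that could be added to \<open>P\<close>.
\<close>

lemma signed_Hahn_decomposition:
  assumes \<nu>: "finite_signed_measure M \<nu>"
  obtains P where "P \<in> sets M" "\<And>A. A \<in> sets M \<Longrightarrow> A \<subseteq> P \<Longrightarrow> 0 \<le> \<nu> A"
    "\<And>A. A \<in> sets M \<Longrightarrow> A \<inter> P = {} \<Longrightarrow> \<nu> A \<le> 0"
proof -
  define pos where "pos = {P \<in> sets M. \<forall>A\<in>sets M. A \<subseteq> P \<longrightarrow> 0 \<le> \<nu> A}"
  have UN: "(\<Union>n. P n) \<in> pos" if "\<And>n::nat. P n \<in> pos" for P
    using that finite_signed_measure_UN_nonneg[OF \<nu>, of P] by (auto simp: pos_def)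
  have mono: "\<nu> Q \<le> \<nu> P" if "P \<in> pos" "Q \<in> sets M" "Q \<subseteq> P" for P Q
    using that finite_signed_measure_Diff[OF \<nu>, of P Q] unfolding pos_def
    by (smt (verit, ccfv_threshold) Diff_subset mem_Collect_eq sets.Diff)
  have bdd: "bdd_above (\<nu> ` pos)"
  proof (rule ccontr)
    assume "\<not> bdd_above (\<nu> ` pos)"
    then have "\<exists>P\<in>pos. real n < \<nu> P" for n :: nat
      by (force simp: bdd_above_def not_le)
    then obtain P where P: "\<And>n. P n \<in> pos" "\<And>n. real n < \<nu> (P n)" by metis
    obtain n :: nat where "\<nu> (\<Union>n. P n) < real n" using reals_Archimedean2 by blast
    moreover have "\<nu> (P n) \<le> \<nu> (\<Union>n. P n)"
      using P(1) by (intro mono UN) (auto simp: pos_def)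
    ultimately show False using P(2)[of n] by simp
  qed
  have "{} \<in> pos" using finite_signed_measure_empty[OF \<nu>] by (auto simp: pos_def)
  then have ne: "\<nu> ` pos \<noteq> {}" by blast
  define s where "s = Sup (\<nu> ` pos)"
  have s: "\<nu> P \<le> s" if "P \<in> pos" for P
    unfolding s_def using that bdd by (intro cSup_upper) auto
  have "\<exists>P\<in>pos. s - 1 / Suc n < \<nu> P" for n
    using less_cSupE[OF _ ne, of "s - 1 / Suc n"] unfolding s_def[symmetric] by fastforce
  then obtain P where P: "\<And>n. P n \<in> pos" "\<And>n. s - 1 / Suc n < \<nu> (P n)" by metis
  let ?P = "\<Union>n. P n"
  have "?P \<in> pos" by (rule UN[OF P(1)])
  have "s \<le> \<nu> ?P"
  proof (rule field_le_epsilon)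
    fix e :: real assume "0 < e"
    then obtain n where "1 / Suc n < e" using nat_approx_posE by blast
    moreover have "\<nu> (P n) \<le> \<nu> ?P"
      using P(1) by (intro mono UN) (auto simp: pos_def)
    ultimately show "s \<le> \<nu> ?P + e" using P(2)[of n] by linarith
  qed
  show ?thesis
  proof
    show "?P \<in> sets M" "\<And>A. A \<in> sets M \<Longrightarrow> A \<subseteq> ?P \<Longrightarrow> 0 \<le> \<nu> A"
      using \<open>?P \<in> pos\<close> unfolding pos_def by auto
    fix A assume A: "A \<in> sets M" "A \<inter> ?P = {}"
    obtain Q where Q: "Q \<in> sets M" "Q \<subseteq> A" "\<nu> A \<le> \<nu> Q"
        "\<And>B. B \<in> sets M \<Longrightarrow> B \<subseteq> Q \<Longrightarrow> 0 \<le> \<nu> B"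
      using ex_nonneg_subset[OF \<nu> A(1)] by blast
    \<comment> \<open>The binary union is phrased as a countable one, to which \<open>UN\<close> applies.\<close>
    have "(\<Union>n::nat. if n = 0 then Q else ?P) \<in> pos"
      using Q \<open>?P \<in> pos\<close>
      by (intro UN[of "\<lambda>n. if n = 0 then Q else ?P"]) (auto simp: pos_def)
    moreover have "(\<Union>n::nat. if n = 0 then Q else ?P) = Q \<union> ?P" by (auto intro: exI[of _ 0] exI[of _ 1])
    ultimately have "\<nu> (Q \<union> ?P) \<le> s" using s by metis
    moreover have "\<nu> (Q \<union> ?P) = \<nu> Q + \<nu> ?P"
      using A Q(1,2) \<open>?P \<in> pos\<close> by (intro finite_signed_measure_Un[OF \<nu>]) (auto simp: pos_def)
    ultimately show "\<nu> A \<le> 0" using \<open>s \<le> \<nu> ?P\<close> Q(3) by linarith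
  qed
qed

lemma emeasure_measure_of_nonneg_signed:
  assumes g: "finite_signed_measure M g" "\<And>A. A \<in> sets M \<Longrightarrow> 0 \<le> g A" and "A \<in> sets M"
  shows "emeasure (measure_of (space M) (sets M) (\<lambda>A. ennreal (g A))) A = ennreal (g A)"
proof (rule emeasure_measure_of_sigma)
  show "sigma_algebra (space M) (sets M)" ..
  show "positive (sets M) (\<lambda>A. ennreal (g A))"
    by (simp add: positive_def finite_signed_measure_empty[OF g(1)])
  show "countably_additive (sets M) (\<lambda>A. ennreal (g A))"
  proof (rule countably_additiveI)
    fix A :: "nat \<Rightarrow> 'a set"
    assume A: "range A \<subseteq> sets M" "disjoint_family A"
    then have "(\<lambda>i. g (A i)) sums g (\<Union>i. A i)"
      using g(1) unfolding finite_signed_measure_def by metis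
    then show "(\<Sum>i. ennreal (g (A i))) = ennreal (g (\<Union>i. A i))"
      using A g(2) by (intro suminf_ennreal_eq) auto
  qed
qed fact

lemma measure_of_eq_measure:
  assumes "\<And>A. A \<in> sets M \<Longrightarrow> f A = emeasure N A" "sets N = sets M"
  shows "measure_of (space M) (sets M) f = N"
proof -
  have "measure_of (space M) (sets M) f = measure_of (space M) (sets M) (emeasure N)"
    using assms by (intro measure_of_eq) (auto simp: sets.space_closed sets.sigma_sets_eq)
  then show ?thesis
    using measure_of_of_measure[of N] assms(2) sets_eq_imp_space_eq[OF assms(2)] by simp
qed

text \<open>
  The supremum that defines the total variation of \<open>A\<close> is attained by the partition of \<open>A\<close> into
  \<open>A \<inter> P\<close> and \<open>A - P\<close>, where \<open>P\<close> is a Hahn set. This identifies the total variation and both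
  parts with restrictions of \<open>\<plusminus>\<nu>\<close>; in particular all three are finite measures.
\<close>

lemma Jordan_decomposition:
  assumes \<nu>: "finite_signed_measure M \<nu>"
  obtains P where "P \<in> sets M"
    "finite_measure (pos_part M \<nu>)" "finite_measure (neg_part M \<nu>)"
    "sets (pos_part M \<nu>) = sets M" "sets (neg_part M \<nu>) = sets M"
    "sets (total_variation M \<nu>) = sets M"
    "emeasure (pos_part M \<nu>) (space M - P) = 0" "emeasure (neg_part M \<nu>) P = 0"
    "\<And>A. A \<in> sets M \<Longrightarrow> \<nu> A = measure (pos_part M \<nu>) A - measure (neg_part M \<nu>) A"
    "\<And>A. A \<in> sets M \<Longrightarrow> emeasure (total_variation M \<nu>) A
        = emeasure (pos_part M \<nu>) A + emeasure (neg_part M \<nu>) A"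
proof -
  obtain P where P: "P \<in> sets M" "\<And>A. A \<in> sets M \<Longrightarrow> A \<subseteq> P \<Longrightarrow> 0 \<le> \<nu> A"
    "\<And>A. A \<in> sets M \<Longrightarrow> A \<inter> P = {} \<Longrightarrow> \<nu> A \<le> 0"
    using signed_Hahn_decomposition[OF \<nu>] by blast
  define p where "p A = \<nu> (A \<inter> P)" for A
  define n where "n A = 0 - \<nu> (A \<inter> (space M - P))" for A
  define v where "v A = p A - (0 - n A)" for A
  have zero: "finite_signed_measure M (\<lambda>_. 0)" by (simp add: finite_signed_measure_def)
  have fp: "finite_signed_measure M p"
    unfolding p_def by (intro finite_signed_measure_restrict \<nu> P)
  have fn: "finite_signed_measure M n"
    unfolding n_def by (intro finite_signed_measure_diff zero finite_signed_measure_restrict \<nu>) (use P in auto)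
  have fv: "finite_signed_measure M v"
    unfolding v_def by (intro finite_signed_measure_diff zero fp fn)
  have p0: "0 \<le> p A" if "A \<in> sets M" for A
    unfolding p_def using that P by auto
  have n0: "0 \<le> n A" if "A \<in> sets M" for A
    unfolding n_def using that P(1) P(3)[of "A \<inter> (space M - P)"] by auto
  have v0: "0 \<le> v A" if "A \<in> sets M" for A
    using p0[OF that] n0[OF that] by (simp add: v_def)
  have pn: "\<nu> A = p A - n A" if "A \<in> sets M" for A
  proof -
    have "A = (A \<inter> P) \<union> (A \<inter> (space M - P))" using sets.sets_into_space[OF that] by blast
    then show ?thesis
      using finite_signed_measure_Un[OF \<nu>, of "A \<inter> P" "A \<inter> (space M - P)"] that P(1)
      by (auto simp: p_def n_def)
  qed
  define V where "V = measure_of (space M) (sets M) (\<lambda>A. ennreal (v A))"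
  have V: "emeasure V A = ennreal (v A)" "sets V = sets M" if "A \<in> sets M" for A
    unfolding V_def using emeasure_measure_of_nonneg_signed[OF fv v0 that] by auto
  have sV: "sets V = sets M" by (simp add: V_def)
  have TV: "total_variation M \<nu> = V"
    unfolding total_variation_def
  proof (rule measure_of_eq_measure)
    fix A assume A: "A \<in> sets M"
    let ?S = "{E :: nat \<Rightarrow> 'a set. range E \<subseteq> sets M \<and> disjoint_family E \<and> (\<Union>i. E i) = A}"
    show "(SUP E\<in>?S. \<Sum>i. ennreal \<bar>\<nu> (E i)\<bar>) = emeasure V A"
    proof (rule antisym)
      show "(SUP E\<in>?S. \<Sum>i. ennreal \<bar>\<nu> (E i)\<bar>) \<le> emeasure V A"
      proof (rule SUP_least)
        fix E assume E: "E \<in> ?S"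
        then have Em: "E i \<in> sets M" for i by auto
        have "\<bar>\<nu> (E i)\<bar> \<le> v (E i)" for i
          using pn[OF Em, of i] p0[OF Em, of i] n0[OF Em, of i] by (simp add: v_def)
        then have "(\<Sum>i. ennreal \<bar>\<nu> (E i)\<bar>) \<le> (\<Sum>i. emeasure V (E i))"
          by (intro suminf_le) (auto simp: V(1)[OF Em] intro!: ennreal_leI)
        also have "\<dots> = emeasure V A"
          using E sV by (subst suminf_emeasure) auto
        finally show "(\<Sum>i. ennreal \<bar>\<nu> (E i)\<bar>) \<le> emeasure V A" .
      qed
      let ?E = "binaryset (A \<inter> P) (A \<inter> (space M - P))"
      have "A = (A \<inter> P) \<union> (A \<inter> (space M - P))" using sets.sets_into_space[OF A] by blast
      then have "?E \<in> ?S"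
        using A P(1) by (auto simp: range_binaryset_eq UN_binaryset_eq disjoint_family_on_def binaryset_def)
      have "(\<Sum>i. ennreal \<bar>\<nu> (?E i)\<bar>) = (\<Sum>i\<in>{0,1}. ennreal \<bar>\<nu> (?E i)\<bar>)"
        by (rule suminf_finite) (auto simp: binaryset_def finite_signed_measure_empty[OF \<nu>])
      also have "\<dots> = ennreal (p A) + ennreal (n A)"
        using p0[OF A] n0[OF A] unfolding p_def n_def
        by (simp add: binaryset_def del: sum_ennreal)
      also have "\<dots> = emeasure V A"
        using p0[OF A] n0[OF A] by (simp add: V(1)[OF A] v_def)
      finally show "emeasure V A \<le> (SUP E\<in>?S. \<Sum>i. ennreal \<bar>\<nu> (E i)\<bar>)"
        using SUP_upper[OF \<open>?E \<in> ?S\<close>, of "\<lambda>E. \<Sum>i. ennreal \<bar>\<nu> (E i)\<bar>"] by simp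
    qed
  qed (simp add: sV)
  have mV: "measure V A = v A" if "A \<in> sets M" for A
    using V(1)[OF that] v0[OF that] by (simp add: measure_def)
  have pos: "pos_part M \<nu> = measure_of (space M) (sets M) (\<lambda>A. ennreal (p A))" (is "_ = ?p")
    unfolding pos_part_def TV
    using emeasure_measure_of_nonneg_signed[OF fp p0]
    by (intro measure_of_eq_measure) (auto simp: mV pn v_def)
  have neg: "neg_part M \<nu> = measure_of (space M) (sets M) (\<lambda>A. ennreal (n A))" (is "_ = ?n")
    unfolding neg_part_def TV
    using emeasure_measure_of_nonneg_signed[OF fn n0]
    by (intro measure_of_eq_measure) (auto simp: mV pn v_def)
  have ep: "emeasure (pos_part M \<nu>) A = ennreal (p A)" if "A \<in> sets M" for A
    using emeasure_measure_of_nonneg_signed[OF fp p0 that] by (simp add: pos)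
  have en: "emeasure (neg_part M \<nu>) A = ennreal (n A)" if "A \<in> sets M" for A
    using emeasure_measure_of_nonneg_signed[OF fn n0 that] by (simp add: neg)
  show ?thesis
  proof
    show "P \<in> sets M" by fact
    show "sets (pos_part M \<nu>) = sets M" "sets (neg_part M \<nu>) = sets M"
      by (auto simp: pos neg)
    have sp: "space (pos_part M \<nu>) = space M" "space (neg_part M \<nu>) = space M"
      by (auto simp: pos neg)
    show "finite_measure (pos_part M \<nu>)" "finite_measure (neg_part M \<nu>)"
      by (intro finite_measureI; simp add: sp ep en)+
    show "sets (total_variation M \<nu>) = sets M" by (simp add: TV sV)
    show "emeasure (pos_part M \<nu>) (space M - P) = 0"
      using P(1) finite_signed_measure_empty[OF \<nu>]
      by (subst ep) (auto simp: p_def Diff_Int_distrib2)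
    have "P \<inter> (space M - P) = {}" by auto
    then show "emeasure (neg_part M \<nu>) P = 0"
      using P(1) finite_signed_measure_empty[OF \<nu>] by (subst en) (auto simp: n_def)
    show "\<nu> A = measure (pos_part M \<nu>) A - measure (neg_part M \<nu>) A" if "A \<in> sets M" for A
      using pn[OF that] p0[OF that] n0[OF that] by (simp add: measure_def ep[OF that] en[OF that])
    show "emeasure (total_variation M \<nu>) A
        = emeasure (pos_part M \<nu>) A + emeasure (neg_part M \<nu>) A" if "A \<in> sets M" for A
      using p0[OF that] n0[OF that] by (simp add: TV V(1) ep en v_def that)
  qed
qed

section \<open>Normalized arc length and the Poisson kernel\<close>

text \<open>
  Arc length is parametrized by the closed path that occurs in Cauchy's integral formula, so that
  contour integrals over it become expectations.
\<close>

definition unif_circle :: "complex measure" where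
  "unif_circle = distr (restrict_space lborel {0..1}) borel (circlepath 0 1)"

lemma borel_measurable_circlepath [measurable]: "circlepath z r \<in> borel_measurable borel"
  unfolding circlepath by measurable

lemma sets_unif_circle [simp, measurable_cong]: "sets unif_circle = sets borel"
  and space_unif_circle [simp]: "space unif_circle = UNIV"
  by (simp_all add: unif_circle_def)

lemma prob_space_unif_circle: "prob_space unif_circle"
  unfolding unif_circle_def
  by (intro prob_space.prob_space_distr prob_spaceI)
     (auto simp: emeasure_restrict_space space_restrict_space intro!: measurable_restrict_space1)

interpretation unif_circle: prob_space unif_circle
  by (rule prob_space_unif_circle)

lemma emeasure_unif_circle:
  assumes [measurable]: "B \<in> sets borel"
  shows "emeasure unif_circle B = emeasure lborel {t \<in> {0..1}. circlepath 0 1 t \<in> B}"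
proof -
  have "circlepath 0 1 -` B \<inter> {0..1} = {t \<in> {0..1}. circlepath 0 1 t \<in> B}" by auto
  moreover have "\<dots> \<in> sets lborel" by measurable
  ultimately show ?thesis
    unfolding unif_circle_def
    by (subst emeasure_distr)
       (auto simp: space_restrict_space intro!: measurable_restrict_space1 emeasure_restrict_space)
qed

lemma integral_unif_circle:
  fixes f :: "complex \<Rightarrow> 'b::{banach, second_countable_topology}"
  assumes [measurable]: "f \<in> borel_measurable borel"
  shows "integral\<^sup>L unif_circle f = (LINT t:{0..1}|lborel. f (circlepath 0 1 t))"
  unfolding unif_circle_def set_lebesgue_integral_def
  by (subst integral_distr) (auto simp: integral_restrict_space intro!: measurable_restrict_space1)

lemma continuous_on_circlepath: "continuous_on A (circlepath z r)"
  unfolding circlepath by (intro continuous_intros)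

lemma norm_circlepath_0_1 [simp]: "norm (circlepath 0 1 t) = 1"
  by (simp add: circlepath norm_exp_eq_Re)

lemma AE_unif_circle_norm: "AE \<zeta> in unif_circle. norm \<zeta> = 1"
  unfolding unif_circle_def
  by (subst AE_distr_iff) (auto intro!: measurable_restrict_space1)

lemma integrable_unif_circle:
  fixes f :: "complex \<Rightarrow> 'b::{banach, second_countable_topology}"
  assumes "f \<in> borel_measurable borel" "continuous_on (sphere 0 1) f"
  shows "integrable unif_circle f"
proof -
  have "bounded (f ` sphere 0 1)"
    using assms(2) by (intro compact_imp_bounded compact_continuous_image) auto
  then obtain B where "\<And>\<zeta>. norm \<zeta> = 1 \<Longrightarrow> norm (f \<zeta>) \<le> B"
    unfolding bounded_iff by fastforce
  then show ?thesis
    using assms(1) AE_unif_circle_norm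
    by (intro unif_circle.integrable_const_bound[of _ B]) auto
qed

lemma Cauchy_unif_circle:
  assumes f [measurable]: "f \<in> borel_measurable borel"
    and cont: "continuous_on (cball 0 1) f" and hol: "f holomorphic_on ball 0 1" and w: "norm w < 1"
  shows "(\<integral>\<zeta>. f \<zeta> * (\<zeta> / (\<zeta> - w)) \<partial>unif_circle) = f w"
proof -
  let ?c = "circlepath 0 1"
  have "((\<lambda>u. f u / (u - w)) has_contour_integral (2 * of_real pi * \<i> * f w)) ?c"
    using assms by (intro Cauchy_integral_circlepath) auto
  then have "((\<lambda>x. f (?c x) / (?c x - w) * (2 * of_real pi * \<i> * ?c x)) has_integral (2 * of_real pi * \<i> * f w)) {0..1}"
    unfolding has_contour_integral_def
    by (rule has_integral_eq[rotated]) (simp add: vector_derivative_circlepath01, simp add: circlepath)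
  then have "((\<lambda>x. 1 / (2 * of_real pi * \<i>) * (f (?c x) / (?c x - w) * (2 * of_real pi * \<i> * ?c x)))
       has_integral 1 / (2 * of_real pi * \<i>) * (2 * of_real pi * \<i> * f w)) {0..1}"
    by (rule has_integral_mult_right)
  then have *: "((\<lambda>x. f (?c x) * (?c x / (?c x - w))) has_integral f w) {0..1}"
    by (simp add: field_simps)
  have ne: "?c x \<noteq> w" for x
    using w norm_circlepath_0_1[of x] by auto
  have "continuous_on {0..1} (\<lambda>x. f (?c x) * (?c x / (?c x - w)))"
    using ne by (intro continuous_intros continuous_on_compose2[OF cont]) (auto simp: continuous_on_circlepath)
  then have "set_integrable lborel {0..1} (\<lambda>x. f (?c x) * (?c x / (?c x - w)))"
    by (rule borel_integrable_atLeastAtMost')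
  then have "(LINT x:{0..1}|lborel. f (?c x) * (?c x / (?c x - w))) = f w"
    using * by (metis integral_unique set_borel_integral_eq_integral(2))
  then show ?thesis
    by (subst integral_unif_circle) auto
qed

lemma mean_value_unif_circle:
  assumes "f \<in> borel_measurable borel" "continuous_on (cball 0 1) f" "f holomorphic_on ball 0 1"
  shows "integral\<^sup>L unif_circle f = f 0"
proof -
  have "AE \<zeta> in unif_circle. f \<zeta> = f \<zeta> * (\<zeta> / (\<zeta> - 0))"
    using AE_unif_circle_norm by eventually_elim auto
  then have "integral\<^sup>L unif_circle f = (\<integral>\<zeta>. f \<zeta> * (\<zeta> / (\<zeta> - 0)) \<partial>unif_circle)"
    using assms(1) by (intro integral_cong_AE) auto
  then show ?thesis
    using Cauchy_unif_circle[OF assms, of 0] by simp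
qed

definition poisson :: "complex \<Rightarrow> complex \<Rightarrow> real" where
  "poisson w \<zeta> = (1 - (norm w)\<^sup>2) / (norm (\<zeta> - w))\<^sup>2"

lemma borel_measurable_poisson [measurable]: "poisson w \<in> borel_measurable borel"
  unfolding poisson_def by measurable

lemma poisson_nonneg: "norm w < 1 \<Longrightarrow> 0 \<le> poisson w \<zeta>"
  by (simp add: poisson_def abs_square_le_1)

text \<open>
  Cauchy's formula is applied to \<open>h \<zeta> = f \<zeta> (1 - |w|\<^sup>2) / (1 - w\<^sup>* \<zeta>)\<close>, where \<open>w\<^sup>*\<close> is the complex
  conjugate of \<open>w\<close>. It has the same value as \<open>f\<close> at \<open>w\<close>, and on the unit circle the new factor turns
  the Cauchy kernel into the Poisson kernel.
\<close>

lemma poisson_unif_circle: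
  assumes f [measurable]: "f \<in> borel_measurable borel"
    and cont: "continuous_on (cball 0 1) f" and hol: "f holomorphic_on ball 0 1" and w: "norm w < 1"
  shows "(\<integral>\<zeta>. f \<zeta> * poisson w \<zeta> \<partial>unif_circle) = f w"
proof -
  define h where "h \<zeta> = f \<zeta> * (1 - (norm w)\<^sup>2) / (1 - cnj w * \<zeta>)" for \<zeta>
  have ne: "1 - cnj w * \<zeta> \<noteq> 0" if "norm \<zeta> \<le> 1" for \<zeta>
  proof -
    have "norm (cnj w * \<zeta>) \<le> norm w * 1"
      unfolding norm_mult using that by (intro mult_mono) auto
    then show ?thesis using w by auto
  qed
  have "(\<integral>\<zeta>. h \<zeta> * (\<zeta> / (\<zeta> - w)) \<partial>unif_circle) = h w"
    unfolding h_def
    using ne w f cont hol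
    by (intro Cauchy_unif_circle continuous_intros holomorphic_intros borel_measurable_divide
        borel_measurable_times borel_measurable_diff borel_measurable_const measurable_ident) auto
  moreover have "h w = f w"
    using ne[of w] w complex_norm_square[of w] by (simp add: h_def mult.commute)
  moreover have "h \<zeta> * (\<zeta> / (\<zeta> - w)) = f \<zeta> * poisson w \<zeta>" if "norm \<zeta> = 1" for \<zeta>
  proof -
    have "\<zeta> \<noteq> w" using that w by auto
    have "\<zeta> * cnj \<zeta> = 1" using that complex_norm_square[of \<zeta>] by simp
    then have "(1 - cnj w * \<zeta>) * (\<zeta> - w) = \<zeta> * ((\<zeta> - w) * cnj (\<zeta> - w))"
      by (simp add: algebra_simps)
    also have "\<dots> = \<zeta> * (norm (\<zeta> - w))\<^sup>2"
      by (simp only: complex_norm_square[symmetric] of_real_power)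
    finally have "\<zeta> / ((1 - cnj w * \<zeta>) * (\<zeta> - w)) = \<zeta> / (\<zeta> * (norm (\<zeta> - w))\<^sup>2)"
      by (simp only:)
    also have "\<dots> = 1 / (norm (\<zeta> - w))\<^sup>2"
      using that by (cases "\<zeta> = 0") simp_all
    finally have "\<zeta> / ((1 - cnj w * \<zeta>) * (\<zeta> - w)) = 1 / (norm (\<zeta> - w))\<^sup>2" .
    moreover have "h \<zeta> * (\<zeta> / (\<zeta> - w)) = f \<zeta> * (1 - (norm w)\<^sup>2) * (\<zeta> / ((1 - cnj w * \<zeta>) * (\<zeta> - w)))"
      by (simp add: h_def)
    ultimately show ?thesis by (simp add: poisson_def)
  qed
  then have "(\<integral>\<zeta>. h \<zeta> * (\<zeta> / (\<zeta> - w)) \<partial>unif_circle) = (\<integral>\<zeta>. f \<zeta> * poisson w \<zeta> \<partial>unif_circle)"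
    using AE_unif_circle_norm by (intro integral_cong_AE) (auto simp: h_def)
  ultimately show ?thesis by simp
qed

text \<open>
  The reflection is a shift of the parameter by \<open>1/2\<close> modulo \<open>1\<close>.
\<close>

lemma null_unif_circle_uminus:
  assumes [measurable]: "B \<in> sets borel" and 0: "emeasure unif_circle B = 0"
  shows "emeasure unif_circle (uminus -` B) = 0"
proof -
  let ?c = "circlepath 0 1"
  define N where "N = {t \<in> {0..1}. ?c t \<in> B}"
  have N [measurable]: "N \<in> sets borel" unfolding N_def by measurable
  have N0: "emeasure lborel N = 0" using 0 by (simp add: emeasure_unif_circle N_def)
  have sm: "(\<lambda>t. a + t) -` N \<in> sets lborel" for a
    using measurable_sets[of "\<lambda>t. a + t" borel borel N] by simp
  have shift: "emeasure lborel ((\<lambda>t. a + t) -` N) = 0" for a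
    using N0 lborel_distr_plus[of a] emeasure_distr[of "\<lambda>t. a + t" lborel borel N] by simp
  have [measurable]: "uminus -` B \<in> sets borel"
    using measurable_sets[of uminus borel borel B] by simp
  have sub: "{t \<in> {0..1}. ?c t \<in> uminus -` B} \<subseteq> ((\<lambda>t. 1/2 + t) -` N) \<union> ((\<lambda>t. -1/2 + t) -` N)"
  proof
    fix t assume t: "t \<in> {t \<in> {0..1}. ?c t \<in> uminus -` B}"
    have "- ?c t = ?c (t + 1/2)" using circlepath_minus[of 0 1 t] by (simp add: circlepath)
    moreover have "?c (t + 1/2) = ?c (t - 1/2)" by (rule circlepath_add_half)
    ultimately show "t \<in> ((\<lambda>t. 1/2 + t) -` N) \<union> ((\<lambda>t. -1/2 + t) -` N)"
      using t by (cases "t \<le> 1/2") (auto simp: N_def add.commute)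
  qed
  have "emeasure lborel {t \<in> {0..1}. ?c t \<in> uminus -` B}
      \<le> emeasure lborel (((\<lambda>t. 1/2 + t) -` N) \<union> ((\<lambda>t. -1/2 + t) -` N))"
    using sm by (intro emeasure_mono sub sets.Un)
  also have "\<dots> \<le> 0"
    using sm by (intro order_trans[OF emeasure_subadditive]) (simp_all only: shift, simp)
  finally show ?thesis by (simp add: emeasure_unif_circle)
qed

text \<open>
  The chord between the parameters \<open>t\<close> and \<open>t0\<close> has length \<open>2 |sin (\<pi> (t - t0))|\<close>, and concavity of
  the sine bounds it below by four times the distance of \<open>t - t0\<close> to the integers.
\<close>

lemma unif_circle_ball:
  assumes "norm \<zeta> = 1" "0 < s"
  shows "measure unif_circle (ball \<zeta> s) \<le> 2 * s"
proof -
  let ?c = "circlepath 0 1"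
  have "\<zeta> \<in> path_image ?c" using assms(1) by simp
  then obtain t0 where t0: "0 \<le> t0" "t0 \<le> 1" "\<zeta> = ?c t0"
    unfolding path_image_def by auto
  have near: "2 * \<bar>u\<bar> \<le> \<bar>sin (pi * u)\<bar>" if "\<bar>u\<bar> \<le> 1/2" for u
  proof (cases "u = 0")
    case False
    have "2 * v \<le> sin (pi * v)" if "0 < v" "v \<le> 1/2" for v
    proof -
      have "convex_on {0..pi} (\<lambda>x. - sin x)"
        by (rule f''_ge0_imp_convex[where f' = "\<lambda>x. - cos x" and f'' = sin])
           (auto intro!: derivative_eq_intros sin_ge_zero)
      from convex_onD[OF this, of "2 * v" 0 "pi/2"] that show ?thesis
        by (simp add: mult.commute)
    qed
    then have "2 * \<bar>u\<bar> \<le> sin (pi * \<bar>u\<bar>)" using False that by auto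
    also have "\<dots> \<le> \<bar>sin (pi * u)\<bar>" by (cases "0 \<le> u") auto
    finally show ?thesis .
  qed simp
  have chord: "norm (?c t - ?c t0) = 2 * \<bar>sin (pi * (t - t0))\<bar>" for t
  proof -
    have "?c t - ?c t0 = ?c t0 * (exp (\<i> * of_real (2 * pi * (t - t0))) - 1)"
      by (simp add: circlepath algebra_simps flip: exp_add)
    then show ?thesis
      using dist_exp_i_1[of "2 * pi * (t - t0)"] by (simp add: norm_mult)
  qed
  \<comment> \<open>The two outer intervals are needed when \<open>\<zeta>\<close> is close to the base point \<open>1\<close> of the parametrization.\<close>
  have sub: "{t \<in> {0..1}. ?c t \<in> ball \<zeta> s} \<subseteq> {t0 - s/4..t0 + s/4} \<union> {t0 + 1 - s/4..t0 + 1 + s/4}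
      \<union> {t0 - 1 - s/4..t0 - 1 + s/4}"
  proof
    fix t assume t: "t \<in> {t \<in> {0..1}. ?c t \<in> ball \<zeta> s}"
    then have "\<bar>sin (pi * (t - t0))\<bar> < s / 2"
      using chord[of t] by (simp add: dist_norm norm_minus_commute t0(3))
    moreover have "\<bar>sin (pi * (t - t0 - 1))\<bar> = \<bar>sin (pi * (t - t0))\<bar>"
      "\<bar>sin (pi * (t - t0 + 1))\<bar> = \<bar>sin (pi * (t - t0))\<bar>"
      by (simp_all add: right_diff_distrib distrib_left sin_diff sin_add)
    moreover have "\<bar>t - t0\<bar> \<le> 1/2 \<or> \<bar>t - t0 - 1\<bar> \<le> 1/2 \<or> \<bar>t - t0 + 1\<bar> \<le> 1/2"
    proof -
      have "0 \<le> t" "t \<le> 1" using t by auto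
      then show ?thesis using t0(1,2) by arith
    qed
    ultimately consider "\<bar>t - t0\<bar> < s / 4" | "\<bar>t - t0 - 1\<bar> < s / 4" | "\<bar>t - t0 + 1\<bar> < s / 4"
      using near[of "t - t0"] near[of "t - t0 - 1"] near[of "t - t0 + 1"] by force
    then show "t \<in> {t0 - s/4..t0 + s/4} \<union> {t0 + 1 - s/4..t0 + 1 + s/4}
      \<union> {t0 - 1 - s/4..t0 - 1 + s/4}"
    proof cases
      case 1
      then have "t0 - s/4 \<le> t" "t \<le> t0 + s/4" by linarith+
      then show ?thesis by simp
    next
      case 2
      then have "t0 + 1 - s/4 \<le> t" "t \<le> t0 + 1 + s/4" by linarith+
      then show ?thesis by simp
    next
      case 3
      then have "t0 - 1 - s/4 \<le> t" "t \<le> t0 - 1 + s/4" by linarith+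
      then show ?thesis by simp
    qed
  qed
  have "emeasure unif_circle (ball \<zeta> s) \<le> emeasure lborel ({t0 - s/4..t0 + s/4} \<union> {t0 + 1 - s/4..t0 + 1 + s/4}
      \<union> {t0 - 1 - s/4..t0 - 1 + s/4})"
    by (subst emeasure_unif_circle, simp) (rule emeasure_mono[OF sub], simp)
  also have "\<dots> \<le> emeasure lborel {t0 - s/4..t0 + s/4} + emeasure lborel {t0 + 1 - s/4..t0 + 1 + s/4}
      + emeasure lborel {t0 - 1 - s/4..t0 - 1 + s/4}"
    by (intro order_trans[OF emeasure_subadditive] add_mono emeasure_subadditive) auto
  also have "\<dots> = ennreal (s/2) + ennreal (s/2) + ennreal (s/2)"
    using assms(2) by simp
  also have "\<dots> \<le> ennreal (2 * s)"
    using assms(2) by (simp flip: ennreal_plus)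
  finally show ?thesis
    using assms(2) by (simp add: unif_circle.emeasure_eq_measure)
qed

section \<open>The Poisson maximal function\<close>

text \<open>
  For \<open>w\<close> in the Stolz region with vertex \<open>\<zeta>\<close>, the distance \<open>|\<omega> - w|\<close> is at least a constant times
  \<open>max (1 - |w|) |\<omega> - \<zeta>|\<close>.
  On the dyadic annulus of radius \<open>2 ^ k (1 - |w|)\<close> about \<open>\<zeta>\<close> the Poisson kernel is therefore at most
  a constant times \<open>1 / (4 ^ k (1 - |w|))\<close>.
\<close>

lemma poisson_le_dyadic:
  assumes w: "w \<in> stolz_region a \<zeta>" and a: "1 < a" and \<omega>: "norm \<omega> = 1"
  shows "ennreal (poisson w \<omega>) \<le>
    (\<Sum>k. ennreal (8 * (1 + a)\<^sup>2 / (4 ^ k * (1 - norm w))) * indicator (ball \<zeta> (2 ^ k * (1 - norm w))) \<omega>)"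
proof -
  define \<delta> where "\<delta> = 1 - norm w"
  have \<delta>: "0 < \<delta>" and wz: "dist w \<zeta> < a * \<delta>"
    using w by (auto simp: stolz_region_def \<delta>_def)
  have num: "1 - (norm w)\<^sup>2 \<le> 2 * \<delta>" "0 \<le> 1 - (norm w)\<^sup>2"
    using zero_le_power2[of "norm w - 1"] \<delta> abs_square_le_1[of "norm w"]
    by (simp_all add: \<delta>_def power2_eq_square algebra_simps)
  have far: "\<delta> \<le> norm (\<omega> - w)"
    using norm_triangle_ineq2[of \<omega> w] \<omega> by (simp add: \<delta>_def)
  have far': "dist \<zeta> \<omega> \<le> (1 + a) * norm (\<omega> - w)"
  proof -
    have "dist \<zeta> \<omega> \<le> dist w \<zeta> + norm (\<omega> - w)"
      using dist_triangle[of \<zeta> \<omega> w] by (simp add: dist_norm norm_minus_commute)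
    also have "\<dots> \<le> a * norm (\<omega> - w) + norm (\<omega> - w)"
      using wz far a by (smt (verit) mult_left_mono)
    finally show ?thesis by (simp add: algebra_simps)
  qed
  obtain k0 :: nat where "dist \<zeta> \<omega> / \<delta> < 2 ^ k0"
    using real_arch_pow[of 2 "dist \<zeta> \<omega> / \<delta>"] by auto
  then have "dist \<zeta> \<omega> < 2 ^ k0 * \<delta>"
    using \<delta> by (simp add: field_simps)
  \<comment> \<open>The one term of the series that is used belongs to the smallest of the balls containing \<open>\<omega>\<close>.\<close>
  define k where "k = (LEAST k. dist \<zeta> \<omega> < 2 ^ k * \<delta>)"
  have k: "dist \<zeta> \<omega> < 2 ^ k * \<delta>"
    unfolding k_def by (rule LeastI) fact
  have "poisson w \<omega> \<le> 8 * (1 + a)\<^sup>2 / (4 ^ k * \<delta>)"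
  proof (cases k)
    case 0
    have "poisson w \<omega> \<le> 2 * \<delta> / \<delta>\<^sup>2"
      unfolding poisson_def using num far \<delta> by (intro frac_le power_mono) auto
    also have "\<dots> = 2 / \<delta>" using \<delta> by (simp add: power2_eq_square)
    also have "\<dots> \<le> 8 * (1 + a)\<^sup>2 / \<delta>"
    proof -
      have "1 \<le> (1 + a)\<^sup>2" using a by (intro one_le_power) simp
      then have "2 \<le> 8 * (1 + a)\<^sup>2" by linarith
      then show ?thesis using \<delta> by (intro divide_right_mono) simp_all
    qed
    finally show ?thesis using 0 by simp
  next
    case (Suc j)
    then have "2 ^ j * \<delta> \<le> dist \<zeta> \<omega>"
      unfolding k_def using not_less_Least[of j "\<lambda>k. dist \<zeta> \<omega> < 2 ^ k * \<delta>"] by (simp add: not_less)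
    then have "2 ^ j * \<delta> / (1 + a) \<le> norm (\<omega> - w)"
      using far' a by (simp add: field_simps)
    then have "poisson w \<omega> \<le> 2 * \<delta> / (2 ^ j * \<delta> / (1 + a))\<^sup>2"
      unfolding poisson_def using num \<delta> a by (intro frac_le power_mono) auto
    also have "\<dots> = 8 * (1 + a)\<^sup>2 / (4 ^ k * \<delta>)"
      using \<delta> a Suc by (simp add: field_simps power2_eq_square power_mult_distrib flip: power_add power_mult)
        (simp add: power_mult mult_2_right flip: mult_2 power_add)
    finally show ?thesis .
  qed
  then have "ennreal (poisson w \<omega>) \<le>
      (\<Sum>k\<in>{k}. ennreal (8 * (1 + a)\<^sup>2 / (4 ^ k * \<delta>)) * indicator (ball \<zeta> (2 ^ k * \<delta>)) \<omega>)"
    using k by (simp add: ennreal_leI)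
  also have "\<dots> \<le> (\<Sum>k. ennreal (8 * (1 + a)\<^sup>2 / (4 ^ k * \<delta>)) * indicator (ball \<zeta> (2 ^ k * \<delta>)) \<omega>)"
    by (intro sum_le_suminf) auto
  finally show ?thesis by (simp add: \<delta>_def)
qed

text \<open>
  The linear growth of the ball masses beats the dyadic decay of the kernel, leaving a geometric series.
  The constant \<open>16\<close> normalizes its sum to \<open>l\<close>.
\<close>

lemma poisson_integral_le_of_balls:
  assumes "finite_measure \<rho>" and sets [measurable_cong]: "sets \<rho> = sets borel" and "AE \<omega> in \<rho>. norm \<omega> = 1"
    and w: "w \<in> stolz_region a \<zeta>" and a: "1 < a" and l: "0 \<le> l"
    and balls: "\<And>s. 0 < s \<Longrightarrow> measure \<rho> (ball \<zeta> s) \<le> l / (16 * (1 + a)\<^sup>2) * s"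
  shows "(\<integral>\<^sup>+\<omega>. poisson w \<omega> \<partial>\<rho>) \<le> ennreal l"
proof -
  interpret \<rho>: finite_measure \<rho> by fact
  define \<delta> where "\<delta> = 1 - norm w"
  have \<delta>: "0 < \<delta>" using w by (auto simp: stolz_region_def \<delta>_def)
  have "(\<integral>\<^sup>+\<omega>. poisson w \<omega> \<partial>\<rho>) \<le>
    (\<integral>\<^sup>+\<omega>. (\<Sum>k. ennreal (8 * (1 + a)\<^sup>2 / (4 ^ k * \<delta>)) * indicator (ball \<zeta> (2 ^ k * \<delta>)) \<omega>) \<partial>\<rho>)"
    using assms(3) poisson_le_dyadic[OF w a] unfolding \<delta>_def
    by (intro nn_integral_mono_AE) (auto elim!: eventually_mono)
  also have "\<dots> = (\<Sum>k. ennreal (8 * (1 + a)\<^sup>2 / (4 ^ k * \<delta>)) * emeasure \<rho> (ball \<zeta> (2 ^ k * \<delta>)))"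
  proof (subst nn_integral_suminf)
    show "(\<lambda>\<omega>. ennreal (8 * (1 + a)\<^sup>2 / (4 ^ k * \<delta>)) * indicator (ball \<zeta> (2 ^ k * \<delta>)) \<omega>) \<in> borel_measurable \<rho>" for k
      by measurable (auto simp: sets)
  qed (auto simp: nn_integral_cmult_indicator sets)
  also have "\<dots> \<le> (\<Sum>k. ennreal (l / 2 * (1 / 2) ^ k))"
  proof (intro suminf_le)
    fix k :: nat
    have "8 * (1 + a)\<^sup>2 / (4 ^ k * \<delta>) * measure \<rho> (ball \<zeta> (2 ^ k * \<delta>))
        \<le> 8 * (1 + a)\<^sup>2 / (4 ^ k * \<delta>) * (l / (16 * (1 + a)\<^sup>2) * (2 ^ k * \<delta>))"
      using \<delta> a by (intro mult_left_mono balls) auto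
    also have "\<dots> = l / 2 * (2 ^ k / 4 ^ k)"
    proof -
      have "8 * A / (D * \<delta>) * (l / (16 * A) * (T * \<delta>)) = l / 2 * (T / D)"
        if "0 < A" "0 < D" for A D T :: real
        using that \<delta> by (simp add: field_simps)
      then show ?thesis using a by simp
    qed
    also have "\<dots> = l / 2 * (1 / 2) ^ k"
      by (simp flip: power_divide)
    finally show "ennreal (8 * (1 + a)\<^sup>2 / (4 ^ k * \<delta>)) * emeasure \<rho> (ball \<zeta> (2 ^ k * \<delta>)) \<le> ennreal (l / 2 * (1 / 2) ^ k)"
      using \<delta> a by (simp add: \<rho>.emeasure_eq_measure ennreal_leI flip: ennreal_mult')
  qed auto
  also have "\<dots> = ennreal l"
    using l sums_mult[OF geometric_sums[of "1/2::real"], of "l/2"] by (intro suminf_ennreal_eq) auto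
  finally show ?thesis .
qed

lemma open_stolz_conv: "open {\<zeta>. w \<in> stolz_region a \<zeta>}"
proof -
  have "{\<zeta>. w \<in> stolz_region a \<zeta>} = (if norm w < 1 then ball w (a * (1 - norm w)) else {})"
    by (auto simp: stolz_region_def)
  then show ?thesis by simp
qed

lemma open_stolz_region: "open (stolz_region a \<zeta>)"
proof -
  have "stolz_region a \<zeta> = ball 0 1 \<inter> {z. dist z \<zeta> < a * (1 - norm z)}"
    by (auto simp: stolz_region_def)
  then show ?thesis
    by (auto intro!: open_Int open_Collect_less continuous_intros)
qed

text \<open>
  Belonging to a Stolz region is an open condition on its vertex.
\<close>

lemma sets_stolz_ex:
  "{\<zeta> \<in> sphere 0 1. \<exists>w\<in>stolz_region a \<zeta>. P w} \<in> sets borel"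
proof -
  have "{\<zeta> \<in> sphere 0 1. \<exists>w\<in>stolz_region a \<zeta>. P w}
      = sphere 0 1 \<inter> (\<Union>w\<in>{w. P w}. {\<zeta>. w \<in> stolz_region a \<zeta>})" by auto
  also have "\<dots> \<in> sets borel"
    by (intro sets.Int borel_closed borel_open[OF open_UN] ballI open_stolz_conv) auto
  finally show ?thesis .
qed

text \<open>
  By the previous estimate, each point where the maximal function exceeds \<open>l\<close> is the centre of a ball
  whose mass is at least a constant times \<open>l\<close> times its radius. Vitali's covering lemma selects disjoint
  balls whose fivefold dilates still cover, and arc length is at most linear in the radius.
\<close>

lemma poisson_maximal:
  assumes fin: "finite_measure \<rho>" and sets [measurable_cong]: "sets \<rho> = sets borel" and AE1: "AE \<omega> in \<rho>. norm \<omega> = 1"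
    and a: "1 < a" and l: "0 < l"
  defines "E \<equiv> {\<zeta> \<in> sphere 0 1. \<exists>w\<in>stolz_region a \<zeta>. ennreal l < (\<integral>\<^sup>+\<omega>. poisson w \<omega> \<partial>\<rho>)}"
  shows "measure unif_circle E \<le> 160 * (1 + a)\<^sup>2 / l * measure \<rho> UNIV"
proof -
  interpret \<rho>: finite_measure \<rho> by fact
  define c where "c = l / (16 * (1 + a)\<^sup>2)"
  have c: "0 < c" using l a by (simp add: c_def)
  have "\<exists>s>0. c * s < measure \<rho> (ball \<zeta> s)" if "\<zeta> \<in> E" for \<zeta>
  proof (rule ccontr)
    assume "\<not> ?thesis"
    then have balls: "\<And>s. 0 < s \<Longrightarrow> measure \<rho> (ball \<zeta> s) \<le> c * s"
      by (meson not_le)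
    obtain w where "w \<in> stolz_region a \<zeta>" "ennreal l < (\<integral>\<^sup>+\<omega>. poisson w \<omega> \<partial>\<rho>)"
      using \<open>\<zeta> \<in> E\<close> unfolding E_def by blast
    then show False
      using poisson_integral_le_of_balls[OF fin sets AE1 _ a less_imp_le[OF l] balls[unfolded c_def]] by (auto simp: not_le[symmetric])
  qed
  then obtain s where s: "\<And>\<zeta>. \<zeta> \<in> E \<Longrightarrow> 0 < s \<zeta>" "\<And>\<zeta>. \<zeta> \<in> E \<Longrightarrow> c * s \<zeta> < measure \<rho> (ball \<zeta> (s \<zeta>))"
    by metis
  have "s \<zeta> \<le> measure \<rho> UNIV / c" if "\<zeta> \<in> E" for \<zeta>
  proof -
    have "measure \<rho> (ball \<zeta> (s \<zeta>)) \<le> measure \<rho> UNIV"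
      by (intro \<rho>.finite_measure_mono) (auto simp: sets)
    then show ?thesis using s[OF that] c by (simp add: field_simps)
  qed
  then obtain C where C: "countable C" "C \<subseteq> E" "pairwise (\<lambda>i j. disjnt (ball i (s i)) (ball j (s j))) C"
      "E \<subseteq> (\<Union>i\<in>C. ball i (5 * s i))"
    using Vitali_covering_lemma_balls[where S = E and K = E and a = "\<lambda>x. x" and r = s and B = "measure \<rho> UNIV / c"]
      s(1) by force
  \<comment> \<open>The disjoint balls are enumerated without repetition, padding with empty sets if there are finitely many.\<close>
  define I where "I = to_nat_on C ` C"
  define g where "g = from_nat_into C"
  have g: "g n \<in> C" if "n \<in> I" for n
    using that C(1) by (auto simp: I_def g_def)
  have Cg: "C = g ` I"
    using C(1) by (auto simp: I_def g_def image_image)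
  have inj: "inj_on g I"
    using C(1) by (auto simp: I_def g_def inj_on_def)
  define X where "X n = (if n \<in> I then ball (g n) (s (g n)) else {})" for n
  define Y where "Y n = (if n \<in> I then ball (g n) (5 * s (g n)) else {})" for n
  have Ym: "range Y \<subseteq> sets borel" and Xm: "range X \<subseteq> sets borel"
    by (auto simp: Y_def X_def)
  have disj: "disjoint_family X"
    unfolding disjoint_family_on_def
  proof (intro ballI impI)
    fix m n :: nat assume "m \<noteq> n"
    show "X m \<inter> X n = {}"
    proof (cases "m \<in> I \<and> n \<in> I")
      case True
      then have "g m \<noteq> g n" using inj \<open>m \<noteq> n\<close> by (auto simp: inj_on_def)
      then show ?thesis
        using C(3) g True by (auto simp: pairwise_def disjnt_def X_def)
    qed (auto simp: X_def)
  qed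
  have "emeasure unif_circle E \<le> emeasure unif_circle (\<Union>n. Y n)"
    using C(4) Ym by (intro emeasure_mono) (auto simp: Cg Y_def)
  also have "\<dots> \<le> (\<Sum>n. emeasure unif_circle (Y n))"
    using Ym by (intro emeasure_subadditive_countably) auto
  also have "\<dots> \<le> (\<Sum>n. ennreal (10 / c) * emeasure \<rho> (X n))"
  proof (intro suminf_le)
    fix n
    show "emeasure unif_circle (Y n) \<le> ennreal (10 / c) * emeasure \<rho> (X n)"
    proof (cases "n \<in> I")
      case True
      then have gE: "g n \<in> E" using g C(2) by auto
      then have "norm (g n) = 1" by (simp add: E_def)
      then have "measure unif_circle (Y n) \<le> 10 * s (g n)"
        using unif_circle_ball[of "g n" "5 * s (g n)"] s(1)[OF gE] True by (simp add: Y_def)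
      also have "\<dots> \<le> 10 / c * measure \<rho> (X n)"
        using s(2)[OF gE] c True by (simp add: X_def field_simps)
      finally show ?thesis
        using c by (simp add: unif_circle.emeasure_eq_measure \<rho>.emeasure_eq_measure ennreal_leI flip: ennreal_mult)
    qed (auto simp: Y_def)
  qed auto
  also have "\<dots> = ennreal (10 / c) * emeasure \<rho> (\<Union>n. X n)"
    using Xm disj by (subst ennreal_suminf_cmult) (auto simp: suminf_emeasure sets)
  also have "\<dots> \<le> ennreal (10 / c) * emeasure \<rho> UNIV"
    by (intro mult_left_mono emeasure_mono) (auto simp: sets)
  finally have "measure unif_circle E \<le> 10 / c * measure \<rho> UNIV"
    using c by (simp add: unif_circle.emeasure_eq_measure \<rho>.emeasure_eq_measure flip: ennreal_mult)
  then show ?thesis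
    using l a by (simp add: c_def)
qed

definition radius :: "nat \<Rightarrow> real" where "radius n = 1 - 1 / (real n + 2)"

lemma radius: "0 < radius n" "radius n < 1"
  by (auto simp: radius_def field_simps)

lemma radius_tendsto: "radius \<longlonglongrightarrow> 1"
  unfolding radius_def by real_asymp

text \<open>
  The maximal estimate is applied on the circles of radius \<open>r < 1\<close>, where \<open>Re G\<close> is the Poisson
  integral of the measure with density \<open>Re G\<close> and mass \<open>Re (G 0)\<close>. The constant does not depend on
  \<open>r\<close>, so \<open>r\<close> may tend to \<open>1\<close>.
\<close>

lemma positive_harmonic_maximal:
  assumes G: "G holomorphic_on ball 0 1" and pos: "\<And>z. norm z < 1 \<Longrightarrow> 0 \<le> Re (G z)"
    and a: "1 < a" and l: "0 < l"
  shows "measure unif_circle {\<zeta> \<in> sphere 0 1. \<exists>w\<in>stolz_region a \<zeta>. l < Re (G w)}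
     \<le> 160 * (1 + a)\<^sup>2 / l * Re (G 0)" (is "measure _ ?E \<le> ?b")
proof -
  define E where "E n = {\<zeta> \<in> sphere 0 1. \<exists>w\<in>stolz_region a \<zeta>. l < Re (G (radius n * w))}" for n
  have Em: "E n \<in> sets borel" for n
    unfolding E_def by (rule sets_stolz_ex)
  have En: "measure unif_circle (E n) \<le> ?b" for n
  proof -
    define r where "r = radius n"
    have r: "0 < r" "r < 1" using radius by (auto simp: r_def)
    \<comment> \<open>Nothing is known about \<open>G\<close> outside the disc; the cutoff makes \<open>f\<close> Borel on the plane.\<close>
    define f where "f \<zeta> = indicator (cball 0 1) \<zeta> *\<^sub>R G (r * \<zeta>)" for \<zeta> :: complex
    have in_ball: "norm (r * \<zeta>) < 1" if "norm \<zeta> \<le> 1" for \<zeta> :: complex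
    proof -
      have "norm (r * \<zeta>) \<le> r * 1"
        unfolding norm_mult using r that by (intro mult_mono) auto
      then show ?thesis using r by simp
    qed
    have cont': "continuous_on (cball 0 1) (\<lambda>\<zeta>::complex. G (r * \<zeta>))"
      using in_ball
      by (intro continuous_on_compose2[OF holomorphic_on_imp_continuous_on[OF G]] continuous_intros) auto
    have hol': "(\<lambda>\<zeta>::complex. G (r * \<zeta>)) holomorphic_on ball 0 1"
      using in_ball by (intro holomorphic_on_compose_gen[OF _ G, unfolded o_def] holomorphic_intros) auto
    have cont: "continuous_on (cball 0 1) f"
      using cont' by (rule continuous_on_eq) (auto simp: f_def)
    have hol: "f holomorphic_on ball 0 1"
      using hol' by (rule holomorphic_transform) (auto simp: f_def)
    have f [measurable]: "f \<in> borel_measurable borel"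
      unfolding f_def by (intro borel_measurable_continuous_on_indicator cont') auto
    have f0: "0 \<le> Re (f \<zeta>)" for \<zeta>
      using pos in_ball by (auto simp: f_def indicator_def)
    define \<rho> where "\<rho> = density unif_circle (\<lambda>\<zeta>. ennreal (Re (f \<zeta>)))"
    have int: "integrable unif_circle f"
      by (intro integrable_unif_circle f continuous_on_subset[OF cont]) auto
    have intP: "integrable unif_circle (\<lambda>\<zeta>. f \<zeta> * poisson w \<zeta>)" if w: "norm w < 1" for w
    proof (intro integrable_unif_circle)
      have "\<zeta> \<noteq> w" if "norm \<zeta> = 1" for \<zeta> using that w by auto
      then show "continuous_on (sphere 0 1) (\<lambda>\<zeta>. f \<zeta> * complex_of_real (poisson w \<zeta>))"
        unfolding poisson_def by (intro continuous_intros continuous_on_subset[OF cont]) auto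
    qed measurable
    have pf: "(\<integral>\<^sup>+\<omega>. poisson w \<omega> \<partial>\<rho>) = ennreal (Re (f w))" if w: "norm w < 1" for w
    proof -
      have "(\<integral>\<^sup>+\<omega>. poisson w \<omega> \<partial>\<rho>) = (\<integral>\<^sup>+\<omega>. ennreal (Re (f \<omega> * poisson w \<omega>)) \<partial>unif_circle)"
        unfolding \<rho>_def using f0 poisson_nonneg[OF w]
        by (subst nn_integral_density) (auto simp: ennreal_mult)
      also have "\<dots> = ennreal (\<integral>\<omega>. Re (f \<omega> * poisson w \<omega>) \<partial>unif_circle)"
        using f0 poisson_nonneg[OF w] intP[OF w] by (intro nn_integral_eq_integral integrable_Re) auto
      also have "(\<integral>\<omega>. Re (f \<omega> * poisson w \<omega>) \<partial>unif_circle) = Re (f w)"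
        using poisson_unif_circle[OF f cont hol w] intP[OF w] by (subst integral_Re) auto
      finally show ?thesis .
    qed
    have mass: "emeasure \<rho> UNIV = ennreal (Re (f 0))"
    proof -
      have "emeasure \<rho> UNIV = (\<integral>\<^sup>+\<omega>. ennreal (Re (f \<omega>)) \<partial>unif_circle)"
        by (simp add: \<rho>_def emeasure_density)
      also have "\<dots> = ennreal (\<integral>\<omega>. Re (f \<omega>) \<partial>unif_circle)"
        using f0 int by (intro nn_integral_eq_integral integrable_Re) auto
      also have "(\<integral>\<omega>. Re (f \<omega>) \<partial>unif_circle) = Re (f 0)"
        using mean_value_unif_circle[OF f cont hol] int by (subst integral_Re) auto
      finally show ?thesis .
    qed
    have "{\<zeta> \<in> sphere 0 1. \<exists>w\<in>stolz_region a \<zeta>. ennreal l < (\<integral>\<^sup>+\<omega>. poisson w \<omega> \<partial>\<rho>)} = E n"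
      using l f0 by (auto simp: E_def stolz_region_def pf ennreal_less_iff f_def r_def)
    moreover have "AE \<omega> in \<rho>. norm \<omega> = 1"
      unfolding \<rho>_def using AE_unif_circle_norm
      by (subst AE_density) (auto elim!: eventually_mono)
    then have "measure unif_circle {\<zeta> \<in> sphere 0 1. \<exists>w\<in>stolz_region a \<zeta>. ennreal l < (\<integral>\<^sup>+\<omega>. poisson w \<omega> \<partial>\<rho>)}
       \<le> 160 * (1 + a)\<^sup>2 / l * measure \<rho> UNIV"
      using mass by (intro poisson_maximal a l finite_measureI) (auto simp: \<rho>_def)
    moreover have "measure \<rho> UNIV = Re (G 0)"
      using mass f0[of 0] by (simp add: measure_def f_def)
    ultimately show ?thesis by simp
  qed
  define A where "A m = (\<Inter>n\<in>{m..}. E n)" for m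
  have Am: "A m \<in> sets borel" for m
    unfolding A_def using Em by (intro sets.countable_INT) auto
  have "incseq A" unfolding A_def incseq_def by (auto intro: INT_anti_mono)
  have AE: "measure unif_circle (A m) \<le> ?b" for m
    by (rule order_trans[OF unif_circle.finite_measure_mono En[of m]]) (use Em in \<open>auto simp: A_def\<close>)
  have "?E \<subseteq> (\<Union>m. A m)"
  proof
    fix \<zeta> assume "\<zeta> \<in> ?E"
    then obtain w where w: "norm \<zeta> = 1" "w \<in> stolz_region a \<zeta>" "l < Re (G w)" by auto
    \<comment> \<open>Stolz regions are open, so \<open>w / r\<close> lies in the region of \<open>w\<close> once \<open>r\<close> is close to \<open>1\<close>.\<close>
    have "(\<lambda>n. w / radius n) \<longlonglongrightarrow> w / of_real 1"
      by (intro tendsto_intros tendsto_of_real radius_tendsto) auto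
    then have "(\<lambda>n. w / radius n) \<longlonglongrightarrow> w" by simp
    then have "eventually (\<lambda>n. w / radius n \<in> stolz_region a \<zeta>) sequentially"
      using open_stolz_region w(2) by (rule topological_tendstoD)
    then obtain m where m: "\<And>n. m \<le> n \<Longrightarrow> w / radius n \<in> stolz_region a \<zeta>"
      by (auto simp: eventually_sequentially)
    have "\<zeta> \<in> E n" if "m \<le> n" for n
      unfolding E_def using m[OF that] w(1,3) radius(1)[of n]
      by (auto intro!: bexI[of _ "w / radius n"])
    then show "\<zeta> \<in> (\<Union>m. A m)" by (auto simp: A_def)
  qed
  then have "measure unif_circle ?E \<le> measure unif_circle (\<Union>m. A m)"
    using Am by (intro unif_circle.finite_measure_mono) auto
  also have "\<dots> \<le> ?b"
  proof (rule LIMSEQ_le_const2)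
    show "(\<lambda>m. measure unif_circle (A m)) \<longlonglongrightarrow> measure unif_circle (\<Union>m. A m)"
      using Am \<open>incseq A\<close> by (intro unif_circle.finite_Lim_measure_incseq) auto
    show "\<exists>N. \<forall>n\<ge>N. measure unif_circle (A n) \<le> ?b"
      using AE by blast
  qed
  finally show ?thesis .
qed

section \<open>Herglotz integrals of positive measures\<close>

definition herglotz_kernel :: "complex \<Rightarrow> complex \<Rightarrow> complex" where
  "herglotz_kernel \<omega> z = \<i> * ((\<omega> + z) / (\<omega> - z))"

definition herglotz :: "complex measure \<Rightarrow> complex \<Rightarrow> complex" where
  "herglotz M z = (\<integral>\<omega>. herglotz_kernel \<omega> z \<partial>M)"

lemma borel_measurable_herglotz_kernel [measurable]:
  "(\<lambda>\<omega>. herglotz_kernel \<omega> z) \<in> borel_measurable borel"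
  unfolding herglotz_kernel_def by measurable

lemma norm_herglotz_kernel_le:
  assumes "norm \<omega> = 1" "norm z \<le> 1" "d \<le> norm (\<omega> - z)" "0 < d"
  shows "norm (herglotz_kernel \<omega> z) \<le> 2 / d"
proof -
  have "norm (\<omega> + z) \<le> 2" using norm_triangle_ineq[of \<omega> z] assms by simp
  then show ?thesis
    using assms by (auto simp: herglotz_kernel_def norm_mult norm_divide intro!: frac_le)
qed

lemma Im_herglotz_kernel:
  assumes "norm \<omega> = 1" "\<omega> \<noteq> z"
  shows "Im (herglotz_kernel \<omega> z) = poisson z \<omega>"
proof -
  have "(\<omega> + z) / (\<omega> - z) = (\<omega> + z) * cnj (\<omega> - z) / (norm (\<omega> - z))\<^sup>2"
    using complex_div_cnj[of "\<omega> + z" "\<omega> - z"] by simp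
  then have "Im (herglotz_kernel \<omega> z) = Re ((\<omega> + z) * cnj (\<omega> - z)) / (norm (\<omega> - z))\<^sup>2"
    unfolding herglotz_kernel_def by (simp add: Re_divide_of_real flip: of_real_power)
  moreover have "Re ((\<omega> + z) * cnj (\<omega> - z)) = (norm \<omega>)\<^sup>2 - (norm z)\<^sup>2"
    unfolding cmod_power2 by (simp add: algebra_simps power2_eq_square)
  ultimately show ?thesis using assms by (simp add: poisson_def)
qed

lemma norm_herglotz_kernel_diff:
  assumes "norm \<omega> = 1" "d \<le> norm (\<omega> - z)" "d \<le> norm (\<omega> - w)" "0 < d"
  shows "norm (herglotz_kernel \<omega> z - herglotz_kernel \<omega> w) \<le> 2 / d\<^sup>2 * norm (z - w)"
proof -
  have ne: "\<omega> - z \<noteq> 0" "\<omega> - w \<noteq> 0" using assms by auto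
  have "herglotz_kernel \<omega> z - herglotz_kernel \<omega> w = \<i> * (2 * \<omega> * (z - w) / ((\<omega> - z) * (\<omega> - w)))"
    using ne by (simp add: herglotz_kernel_def field_simps)
  then have "norm (herglotz_kernel \<omega> z - herglotz_kernel \<omega> w) = 2 * norm (z - w) / (norm (\<omega> - z) * norm (\<omega> - w))"
    using assms(1) by (simp add: norm_mult norm_divide)
  also have "\<dots> \<le> 2 * norm (z - w) / (d * d)"
    using assms by (intro divide_left_mono mult_mono) (auto intro!: mult_pos_pos simp: ne[unfolded right_minus_eq])
  finally show ?thesis by (simp add: power2_eq_square)
qed

locale circle_measure = finite_measure M for M :: "complex measure" +
  assumes sets_M [simp, measurable_cong]: "sets M = sets borel"
    and AE_norm: "AE \<omega> in M. norm \<omega> = 1"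
begin

lemma space_M [simp]: "space M = UNIV"
  using sets_eq_imp_space_eq[OF sets_M] by simp

lemma borel_measurable_herglotz [measurable]: "herglotz M \<in> borel_measurable borel"
proof -
  have "(\<lambda>x. herglotz_kernel (snd x) (fst x)) \<in> borel_measurable (borel \<Otimes>\<^sub>M M)"
    unfolding herglotz_kernel_def by measurable
  then show ?thesis
    unfolding herglotz_def by (intro borel_measurable_lebesgue_integral) (simp add: split_beta')
qed

lemma AE_norm_diff_ge: "AE \<omega> in M. 1 - norm z \<le> norm (\<omega> - z)"
  using AE_norm
proof eventually_elim
  fix \<omega> :: complex assume "norm \<omega> = 1"
  then show "1 - norm z \<le> norm (\<omega> - z)" using norm_triangle_ineq2[of \<omega> z] by simp
qed

lemma integrable_herglotz_kernel_gap:
  assumes "AE \<omega> in M. d \<le> norm (\<omega> - z)" "0 < d" "norm z \<le> 1"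
  shows "integrable M (\<lambda>\<omega>. herglotz_kernel \<omega> z)"
proof (rule integrable_const_bound)
  show "AE \<omega> in M. norm (herglotz_kernel \<omega> z) \<le> 2 / d"
    using AE_norm assms(1) by eventually_elim (use assms norm_herglotz_kernel_le in blast)
qed simp

lemma integrable_herglotz_kernel:
  assumes "norm z < 1"
  shows "integrable M (\<lambda>\<omega>. herglotz_kernel \<omega> z)"
  by (rule integrable_herglotz_kernel_gap[OF AE_norm_diff_ge]) (use assms in auto)

lemma norm_herglotz_le:
  assumes "AE \<omega> in M. d \<le> norm (\<omega> - z)" "0 < d" "norm z \<le> 1"
  shows "norm (herglotz M z) \<le> 2 / d * measure M UNIV"
proof -
  have "norm (herglotz M z) \<le> (\<integral>\<omega>. norm (herglotz_kernel \<omega> z) \<partial>M)"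
    unfolding herglotz_def by (rule integral_norm_bound)
  also have "\<dots> \<le> (\<integral>\<omega>. 2 / d \<partial>M)"
  proof (rule integral_mono_AE)
    show "AE \<omega> in M. norm (herglotz_kernel \<omega> z) \<le> 2 / d"
      using AE_norm assms(1) by eventually_elim (use assms norm_herglotz_kernel_le in blast)
  qed (use integrable_herglotz_kernel_gap[OF assms] in auto)
  finally show ?thesis by (simp add: mult.commute)
qed

lemma herglotz_Lipschitz:
  assumes "AE \<omega> in M. d \<le> norm (\<omega> - z)" "AE \<omega> in M. d \<le> norm (\<omega> - w)" "0 < d" "norm z \<le> 1" "norm w \<le> 1"
  shows "norm (herglotz M z - herglotz M w) \<le> 2 / d\<^sup>2 * measure M UNIV * norm (z - w)"
proof -
  note int = integrable_herglotz_kernel_gap[OF assms(1,3,4)] integrable_herglotz_kernel_gap[OF assms(2,3,5)]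
  have "herglotz M z - herglotz M w = (\<integral>\<omega>. herglotz_kernel \<omega> z - herglotz_kernel \<omega> w \<partial>M)"
    unfolding herglotz_def using int by simp
  also have "norm \<dots> \<le> (\<integral>\<omega>. norm (herglotz_kernel \<omega> z - herglotz_kernel \<omega> w) \<partial>M)"
    by (rule integral_norm_bound)
  also have "\<dots> \<le> (\<integral>\<omega>. 2 / d\<^sup>2 * norm (z - w) \<partial>M)"
  proof (rule integral_mono_AE)
    show "AE \<omega> in M. norm (herglotz_kernel \<omega> z - herglotz_kernel \<omega> w) \<le> 2 / d\<^sup>2 * norm (z - w)"
      using AE_norm assms(1,2) by eventually_elim (use assms norm_herglotz_kernel_diff in blast)
  qed (use int in auto)
  finally show ?thesis by (simp add: mult_ac)
qed

text \<open>
  On the circle itself the kernel is real away from its pole.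
\<close>

lemma Im_herglotz_eq_0:
  assumes "AE \<omega> in M. d \<le> norm (\<omega> - \<zeta>)" "0 < d" "norm \<zeta> = 1"
  shows "Im (herglotz M \<zeta>) = 0"
proof -
  have "Im (herglotz M \<zeta>) = (\<integral>\<omega>. Im (herglotz_kernel \<omega> \<zeta>) \<partial>M)"
    unfolding herglotz_def using integrable_herglotz_kernel_gap[OF assms(1,2)] assms(3)
    by (subst integral_Im) auto
  also have "\<dots> = (\<integral>\<omega>. 0 \<partial>M)"
  proof (rule integral_cong_AE)
    show "AE \<omega> in M. Im (herglotz_kernel \<omega> \<zeta>) = 0"
      using AE_norm assms(1)
    proof eventually_elim
      fix \<omega> assume "norm \<omega> = 1" "d \<le> norm (\<omega> - \<zeta>)"
      moreover from this have "\<omega> \<noteq> \<zeta>" using assms(2) by auto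
      ultimately show "Im (herglotz_kernel \<omega> \<zeta>) = 0"
        using assms(3) by (simp add: Im_herglotz_kernel poisson_def)
    qed
  qed auto
  finally show ?thesis by simp
qed

lemma Im_herglotz_ge:
  assumes "norm z < 1"
  shows "(1 - (norm z)\<^sup>2) / 4 * measure M UNIV \<le> Im (herglotz M z)"
proof -
  note int = integrable_herglotz_kernel[OF assms]
  have "(1 - (norm z)\<^sup>2) / 4 * measure M UNIV = (\<integral>\<omega>. (1 - (norm z)\<^sup>2) / 4 \<partial>M)"
    by simp
  also have "\<dots> \<le> (\<integral>\<omega>. Im (herglotz_kernel \<omega> z) \<partial>M)"
  proof (rule integral_mono_AE)
    show "AE \<omega> in M. (1 - (norm z)\<^sup>2) / 4 \<le> Im (herglotz_kernel \<omega> z)"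
      using AE_norm
    proof eventually_elim
      fix \<omega> :: complex assume \<omega>: "norm \<omega> = 1"
      then have ne: "\<omega> \<noteq> z" using assms by auto
      have "norm (\<omega> - z) \<le> 2" using norm_triangle_ineq4[of \<omega> z] \<omega> assms by simp
      then have "(norm (\<omega> - z))\<^sup>2 \<le> 2\<^sup>2" by (intro power_mono) auto
      then show "(1 - (norm z)\<^sup>2) / 4 \<le> Im (herglotz_kernel \<omega> z)"
        using \<omega> ne assms abs_square_le_1[of "norm z"] unfolding Im_herglotz_kernel[OF \<omega> ne] poisson_def
        by (intro divide_left_mono) auto
    qed
  qed (use int in auto)
  also have "\<dots> = Im (herglotz M z)"
    unfolding herglotz_def using int by (subst integral_Im) auto
  finally show ?thesis .
qed

lemma Im_herglotz_nonneg: "norm z < 1 \<Longrightarrow> 0 \<le> Im (herglotz M z)"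
  using Im_herglotz_ge[of z] abs_square_le_1[of "norm z"]
  by (smt (verit) divide_nonneg_nonneg measure_nonneg mult_nonneg_nonneg norm_ge_zero)

lemma herglotz_0: "herglotz M 0 = \<i> * measure M UNIV"
proof -
  have "herglotz M 0 = (\<integral>\<omega>. \<i> \<partial>M)"
    unfolding herglotz_def
  proof (rule integral_cong_AE)
    show "AE \<omega> in M. herglotz_kernel \<omega> 0 = \<i>"
      using AE_norm by eventually_elim (auto simp: herglotz_kernel_def)
  qed auto
  then show ?thesis by (simp add: scaleR_conv_of_real mult.commute)
qed

text \<open>
  The identity \<open>(kernel / \<i> + 1) / 2 = 1 / (1 - z / \<omega>)\<close> and the geometric series give a
  power series in the disc.
\<close>

lemma herglotz_holomorphic: "herglotz M holomorphic_on ball 0 1"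
proof -
  define c where "c n = (\<integral>\<omega>. (1 / \<omega>) ^ n \<partial>M)" for n :: nat
  define g where "g z = (herglotz M z / \<i> + measure M UNIV) / 2" for z
  have "g holomorphic_on ball 0 1"
  proof (rule power_series_holomorphic)
    fix z :: complex assume "z \<in> ball 0 1"
    then have z: "norm z < 1" by simp
    have ae: "AE \<omega> in M. norm ((z / \<omega>) ^ n) = norm z ^ n" for n
      using AE_norm by eventually_elim (simp add: norm_power norm_divide)
    have int: "integrable M (\<lambda>\<omega>. (z / \<omega>) ^ n)" for n
      using ae[of n] by (intro integrable_const_bound[of _ "norm z ^ n"]) (auto elim!: eventually_mono)
    have "(\<lambda>n. \<integral>\<omega>. (z / \<omega>) ^ n \<partial>M) sums (\<integral>\<omega>. (\<Sum>n. (z / \<omega>) ^ n) \<partial>M)"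
    proof (rule sums_integral[OF int])
      show "AE \<omega> in M. summable (\<lambda>n. norm ((z / \<omega>) ^ n))"
        using AE_norm by eventually_elim (use z in \<open>simp add: norm_power norm_divide\<close>)
      have "(\<integral>\<omega>. norm ((z / \<omega>) ^ n) \<partial>M) = norm z ^ n * measure M UNIV" for n
        using integral_cong_AE[OF _ _ ae[of n]] by simp
      then show "summable (\<lambda>n. \<integral>\<omega>. norm ((z / \<omega>) ^ n) \<partial>M)"
        using z by (simp add: summable_mult2)
    qed
    moreover have "(\<integral>\<omega>. (z / \<omega>) ^ n \<partial>M) = c n * (z - 0) ^ n" for n
    proof -
      have "(\<lambda>\<omega>. (z / \<omega>) ^ n) = (\<lambda>\<omega>. (1 / \<omega>) ^ n * z ^ n)"
        by (simp add: power_divide)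
      then show ?thesis by (simp add: c_def)
    qed
    moreover have "(\<integral>\<omega>. (\<Sum>n. (z / \<omega>) ^ n) \<partial>M) = (\<integral>\<omega>. (herglotz_kernel \<omega> z / \<i> + 1) / 2 \<partial>M)"
    proof (rule integral_cong_AE)
      show "AE \<omega> in M. (\<Sum>n. (z / \<omega>) ^ n) = (herglotz_kernel \<omega> z / \<i> + 1) / 2"
        using AE_norm
      proof eventually_elim
        fix \<omega> :: complex assume \<omega>: "norm \<omega> = 1"
        then have sum: "(\<Sum>n. (z / \<omega>) ^ n) = 1 / (1 - z / \<omega>)"
          using z by (intro suminf_geometric) (simp add: norm_divide)
        have "\<omega> \<noteq> 0" "\<omega> \<noteq> z" using z \<omega> by auto
        then have kernel: "(herglotz_kernel \<omega> z / \<i> + 1) / 2 = 1 / (1 - z / \<omega>)"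
          by (simp add: herglotz_kernel_def field_simps)
        show "(\<Sum>n. (z / \<omega>) ^ n) = (herglotz_kernel \<omega> z / \<i> + 1) / 2"
          by (rule trans[OF sum kernel[symmetric]])
      qed
    qed (auto intro!: borel_measurable_suminf)
    moreover have "(\<integral>\<omega>. (herglotz_kernel \<omega> z / \<i> + 1) / 2 \<partial>M) = g z"
      using integrable_herglotz_kernel[OF z]
      by (simp add: g_def herglotz_def scaleR_conv_of_real)
    ultimately show "(\<lambda>n. c n * (z - 0) ^ n) sums g z" by simp
  qed
  then have "(\<lambda>z. \<i> * (2 * g z - measure M UNIV)) holomorphic_on ball 0 1"
    by (intro holomorphic_intros)
  then show ?thesis
    by (rule holomorphic_transform) (simp add: g_def field_simps)
qed

text \<open>
  With \<open>G\<close> the square root of \<open>H / \<i>\<close>, positivity of \<open>Re (G\<^sup>2) = Im H\<close> says that \<open>|Im G| \<le> Re G\<close>,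
  so \<open>|H| = |G|\<^sup>2 \<le> 2 (Re G)\<^sup>2\<close>. The estimate for positive harmonic functions applies to \<open>Re G\<close>, whose
  value at the centre is the square root of the mass.
\<close>

lemma herglotz_maximal:
  assumes a: "1 < a" and l: "0 < l"
  shows "measure unif_circle {\<zeta> \<in> sphere 0 1. \<exists>w\<in>stolz_region a \<zeta>. l < norm (herglotz M w)}
     \<le> 160 * (1 + a)\<^sup>2 * sqrt (2 * measure M UNIV / l)"
proof (cases "measure M UNIV = 0")
  case True
  have "herglotz M w = 0" if "w \<in> stolz_region a \<zeta>" for w \<zeta>
    using norm_herglotz_le[OF AE_norm_diff_ge, of w] that True by (simp add: stolz_region_def)
  then have empty: "{\<zeta> \<in> sphere 0 1. \<exists>w\<in>stolz_region a \<zeta>. l < norm (herglotz M w)} = {}"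
    using l by auto
  show ?thesis unfolding empty using True by simp
next
  case False
  then have mass: "0 < measure M UNIV" by (simp add: zero_less_measure_iff)
  have pos: "0 < Im (herglotz M z)" if "norm z < 1" for z
  proof -
    have "(norm z)\<^sup>2 < 1" using that by (simp add: abs_square_less_1)
    then show ?thesis using Im_herglotz_ge[OF that] mass by (smt (verit) divide_pos_pos mult_pos_pos)
  qed
  define G where "G z = csqrt (- \<i> * herglotz M z)" for z
  have hol: "G holomorphic_on ball 0 1"
    unfolding G_def
  proof (intro holomorphic_intros herglotz_holomorphic)
    fix z :: complex assume "z \<in> ball 0 1"
    then show "- \<i> * herglotz M z \<notin> \<real>\<^sub>\<le>\<^sub>0"
      using pos[of z] by (auto simp: complex_nonpos_Reals_iff)
  qed
  have ReG: "0 \<le> Re (G z)" for z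
    unfolding G_def by (rule Re_csqrt)
  have bound: "norm (herglotz M z) \<le> 2 * (Re (G z))\<^sup>2" if "norm z < 1" for z
  proof -
    have sq: "(G z)\<^sup>2 = - \<i> * herglotz M z" by (simp add: G_def)
    have "Re ((G z)\<^sup>2) = Im (herglotz M z)" unfolding sq by simp
    then have "(Im (G z))\<^sup>2 \<le> (Re (G z))\<^sup>2"
      using pos[OF that] by (simp add: power2_eq_square)
    moreover have "norm (herglotz M z) = (norm (G z))\<^sup>2"
      unfolding norm_power[symmetric] sq by (simp add: norm_mult)
    ultimately show ?thesis by (simp add: cmod_power2)
  qed
  have sub: "{\<zeta> \<in> sphere 0 1. \<exists>w\<in>stolz_region a \<zeta>. l < norm (herglotz M w)}
     \<subseteq> {\<zeta> \<in> sphere 0 1. \<exists>w\<in>stolz_region a \<zeta>. sqrt (l / 2) < Re (G w)}"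
  proof safe
    fix \<zeta> w assume w: "w \<in> stolz_region a \<zeta>" "l < norm (herglotz M w)" and "\<zeta> \<in> sphere 0 1"
    then have "l / 2 < (Re (G w))\<^sup>2" using bound[of w] by (auto simp: stolz_region_def)
    then have "sqrt (l / 2) < sqrt ((Re (G w))\<^sup>2)" by (rule real_sqrt_less_mono)
    also have "\<dots> = Re (G w)" by (rule real_sqrt_unique[OF refl ReG])
    finally have "sqrt (l / 2) < Re (G w)" .
    then show "\<exists>w\<in>stolz_region a \<zeta>. sqrt (l / 2) < Re (G w)" using w by blast
  qed
  have "measure unif_circle {\<zeta> \<in> sphere 0 1. \<exists>w\<in>stolz_region a \<zeta>. l < norm (herglotz M w)}
      \<le> measure unif_circle {\<zeta> \<in> sphere 0 1. \<exists>w\<in>stolz_region a \<zeta>. sqrt (l / 2) < Re (G w)}"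
    using sets_stolz_ex by (intro unif_circle.finite_measure_mono sub) simp
  also have "\<dots> \<le> 160 * (1 + a)\<^sup>2 / sqrt (l / 2) * Re (G 0)"
    using a l by (intro positive_harmonic_maximal hol ReG) auto
  also have "Re (G 0) = sqrt (measure M UNIV)"
    by (simp add: G_def herglotz_0)
  also have "160 * (1 + a)\<^sup>2 / sqrt (l / 2) * sqrt (measure M UNIV) = 160 * (1 + a)\<^sup>2 * sqrt (2 * measure M UNIV / l)"
    using l by (simp add: real_sqrt_divide real_sqrt_mult field_simps)
  finally show ?thesis .
qed

end

section \<open>Nontangential limits for singular measures\<close>

definition restr :: "complex measure \<Rightarrow> complex set \<Rightarrow> complex measure" where
  "restr M B = density M (\<lambda>\<omega>. ennreal (indicator B \<omega>))"

lemma radius_in_stolz_region: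
  fixes \<zeta> :: complex
  assumes "norm \<zeta> = 1" "1 < a"
  shows "of_real (radius n) * \<zeta> \<in> stolz_region a \<zeta>"
proof -
  have "of_real (radius n) * \<zeta> - \<zeta> = of_real (radius n - 1) * \<zeta>" by (simp add: algebra_simps)
  then have "dist (of_real (radius n) * \<zeta>) \<zeta> = 1 - radius n"
    using radius[of n] assms(1) by (simp add: dist_norm norm_mult del: of_real_diff)
  moreover have "norm (of_real (radius n) * \<zeta>) = radius n"
    using radius[of n] assms(1) by (simp add: norm_mult)
  ultimately show ?thesis
    using radius[of n] assms(2) by (simp add: stolz_region_def)
qed

lemma radius_mult_tendsto: "(\<lambda>n. of_real (radius n) * \<zeta>) \<longlonglongrightarrow> (\<zeta> :: complex)"
proof -
  have "(\<lambda>n. of_real (radius n) * \<zeta>) \<longlonglongrightarrow> of_real 1 * \<zeta>"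
    by (intro tendsto_intros tendsto_of_real radius_tendsto)
  then show ?thesis by simp
qed

lemma nontangential_limit_imp_radial:
  fixes f :: "complex \<Rightarrow> complex" and \<zeta> :: complex
  assumes lim: "has_nontangential_limit f \<zeta> L" and \<zeta>: "norm \<zeta> = 1"
  shows "(\<lambda>n. f (of_real (radius n) * \<zeta>)) \<longlonglongrightarrow> L"
proof -
  have "(f \<longlongrightarrow> L) (at \<zeta> within stolz_region 2 \<zeta>)"
    using lim by (simp add: has_nontangential_limit_def)
  moreover have "filterlim (\<lambda>n. of_real (radius n) * \<zeta>) (at \<zeta> within stolz_region 2 \<zeta>) sequentially"
    unfolding filterlim_at
  proof (intro conjI always_eventually allI radius_mult_tendsto)
    fix n
    show "of_real (radius n) * \<zeta> \<in> stolz_region 2 \<zeta>" by (intro radius_in_stolz_region \<zeta>) simp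
    show "of_real (radius n) * \<zeta> \<noteq> \<zeta>" using radius[of n] \<zeta> by auto
  qed
  ultimately show ?thesis by (rule filterlim_compose)
qed

lemma boundary_value_eq:
  fixes f :: "complex \<Rightarrow> complex" and \<zeta> :: complex
  assumes lim: "has_nontangential_limit f \<zeta> L" and \<zeta>: "norm \<zeta> = 1"
  shows "boundary_value f \<zeta> = L"
proof -
  have "(THE L. has_nontangential_limit f \<zeta> L) = L"
  proof (rule the_equality[of "has_nontangential_limit f \<zeta>", OF lim])
    fix L' assume "has_nontangential_limit f \<zeta> L'"
    then show "L' = L"
      by (rule LIMSEQ_unique[OF nontangential_limit_imp_radial[OF _ \<zeta>] nontangential_limit_imp_radial[OF lim \<zeta>]])
  qed
  then show ?thesis using lim by (auto simp: boundary_value_def)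
qed

text \<open>
  The limit is that along the radius, which lies in all Stolz regions; hence it is the same for every
  aperture. Integer apertures \<open>k + 2\<close> and tolerances \<open>1 / (n + 1)\<close> suffice because the regions
  increase with the aperture.
\<close>

lemma nontangential_Cauchy_imp_limit:
  fixes F :: "complex \<Rightarrow> complex" and \<zeta> :: complex
  assumes \<zeta>: "norm \<zeta> = 1"
    and osc: "\<And>k n::nat. \<exists>d>0. \<forall>z\<in>stolz_region (real k + 2) \<zeta> \<inter> ball \<zeta> d.
      \<forall>w\<in>stolz_region (real k + 2) \<zeta> \<inter> ball \<zeta> d. norm (F z - F w) \<le> 1 / Suc n"
  shows "\<exists>L. has_nontangential_limit F \<zeta> L"
proof -
  let ?f = "\<lambda>j. F (of_real (radius j) * \<zeta>)"
  have tail: "\<exists>d>0. \<exists>J. \<forall>z\<in>stolz_region a \<zeta> \<inter> ball \<zeta> d. \<forall>j\<ge>J. norm (F z - ?f j) < e"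
    if a: "1 < a" and "0 < e" for a e
  proof -
    obtain n where n: "1 / Suc n < e" using nat_approx_posE[OF \<open>0 < e\<close>] by blast
    obtain k :: nat where "a \<le> real k" using real_arch_simple by blast
    then have sub: "stolz_region a \<zeta> \<subseteq> stolz_region (real k + 2) \<zeta>"
      by (auto simp: stolz_region_def elim!: less_le_trans intro!: mult_right_mono)
    obtain d where d: "0 < d" "\<And>z w. z \<in> stolz_region (real k + 2) \<zeta> \<inter> ball \<zeta> d \<Longrightarrow>
        w \<in> stolz_region (real k + 2) \<zeta> \<inter> ball \<zeta> d \<Longrightarrow> norm (F z - F w) \<le> 1 / Suc n"
      using osc[of k n] by blast
    have "eventually (\<lambda>j. of_real (radius j) * \<zeta> \<in> ball \<zeta> d) sequentially"
      using d(1) by (intro topological_tendstoD[OF radius_mult_tendsto]) auto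
    then obtain J where J: "\<And>j. J \<le> j \<Longrightarrow> of_real (radius j) * \<zeta> \<in> ball \<zeta> d"
      by (auto simp: eventually_sequentially)
    have "norm (F z - ?f j) < e" if "z \<in> stolz_region a \<zeta> \<inter> ball \<zeta> d" "J \<le> j" for z j
    proof -
      have "of_real (radius j) * \<zeta> \<in> stolz_region (real k + 2) \<zeta> \<inter> ball \<zeta> d"
        using J[OF that(2)] radius_in_stolz_region[OF \<zeta>, of "real k + 2" j] by simp
      then have "norm (F z - ?f j) \<le> 1 / Suc n"
        using d(2)[of z "of_real (radius j) * \<zeta>"] that(1) sub by blast
      then show ?thesis using n by simp
    qed
    then show ?thesis using d(1) by blast
  qed
  have "Cauchy ?f"
  proof (rule metric_CauchyI)
    fix e :: real assume "0 < e"
    then obtain d J where d: "0 < d"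
      "\<forall>z\<in>stolz_region 2 \<zeta> \<inter> ball \<zeta> d. \<forall>j\<ge>J. norm (F z - ?f j) < e"
      using tail[of 2 e] by auto
    have "eventually (\<lambda>j. of_real (radius j) * \<zeta> \<in> ball \<zeta> d) sequentially"
      using d(1) by (intro topological_tendstoD[OF radius_mult_tendsto]) auto
    then obtain J' where J': "\<And>j. J' \<le> j \<Longrightarrow> of_real (radius j) * \<zeta> \<in> ball \<zeta> d"
      by (auto simp: eventually_sequentially)
    have "dist (?f m) (?f n) < e" if "max J J' \<le> m" "max J J' \<le> n" for m n
    proof -
      have "of_real (radius m) * \<zeta> \<in> stolz_region 2 \<zeta> \<inter> ball \<zeta> d"
        using J'[of m] radius_in_stolz_region[OF \<zeta>, of 2 m] that by simp
      then show ?thesis using d(2) that unfolding dist_norm by simp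
    qed
    then show "\<exists>M. \<forall>m\<ge>M. \<forall>n\<ge>M. dist (?f m) (?f n) < e" by blast
  qed
  then obtain L where L: "?f \<longlonglongrightarrow> L" using Cauchy_convergent convergent_def by blast
  have "(F \<longlongrightarrow> L) (at \<zeta> within stolz_region a \<zeta>)" if a: "1 < a" for a
    unfolding Lim_within
  proof (intro allI impI)
    fix e :: real assume "0 < e"
    then have "0 < e / 2" by simp
    from tail[OF a this] obtain d J where d: "0 < d"
        "\<forall>z\<in>stolz_region a \<zeta> \<inter> ball \<zeta> d. \<forall>j\<ge>J. norm (F z - ?f j) < e / 2"
      by blast
    have "dist (F z) L < e" if z: "z \<in> stolz_region a \<zeta>" "dist z \<zeta> < d" for z
    proof -
      have "(\<lambda>j. norm (F z - ?f j)) \<longlonglongrightarrow> norm (F z - L)"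
        by (intro tendsto_intros L)
      then have "norm (F z - L) \<le> e / 2"
        using d(2) z by (intro LIMSEQ_le_const2[where X = "\<lambda>j. norm (F z - ?f j)"])
          (auto simp: dist_commute intro!: exI[of _ J] less_imp_le)
      then show ?thesis using \<open>0 < e\<close> by (simp add: dist_norm)
    qed
    then show "\<exists>d>0. \<forall>x\<in>stolz_region a \<zeta>. 0 < dist x \<zeta> \<and> dist x \<zeta> < d \<longrightarrow> dist (F x) L < e"
      using d(1) by blast
  qed
  then show ?thesis unfolding has_nontangential_limit_def by blast
qed

lemma nontangential_limit_imp_Cauchy:
  fixes F :: "complex \<Rightarrow> complex" and \<zeta> :: complex
  assumes lim: "has_nontangential_limit F \<zeta> L" and \<zeta>: "norm \<zeta> = 1" and "1 < a" "0 < e"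
  shows "\<exists>d>0. \<forall>z\<in>stolz_region a \<zeta> \<inter> ball \<zeta> d. \<forall>w\<in>stolz_region a \<zeta> \<inter> ball \<zeta> d. norm (F z - F w) \<le> e"
proof -
  have "(F \<longlongrightarrow> L) (at \<zeta> within stolz_region a \<zeta>)"
    using lim \<open>1 < a\<close> by (simp add: has_nontangential_limit_def)
  moreover have "0 < e / 2" using \<open>0 < e\<close> by simp
  ultimately obtain d where d: "0 < d"
    "\<And>z. z \<in> stolz_region a \<zeta> \<Longrightarrow> 0 < dist z \<zeta> \<Longrightarrow> dist z \<zeta> < d \<Longrightarrow> dist (F z) L < e / 2"
    unfolding Lim_within by blast
  have near: "norm (F z - L) < e / 2" if z: "z \<in> stolz_region a \<zeta> \<inter> ball \<zeta> d" for z
  proof -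
    have "z \<noteq> \<zeta>" using z \<zeta> by (auto simp: stolz_region_def)
    then show ?thesis using d(2)[of z] z by (simp add: dist_norm norm_minus_commute)
  qed
  have "norm (F z - F w) \<le> e"
    if "z \<in> stolz_region a \<zeta> \<inter> ball \<zeta> d" "w \<in> stolz_region a \<zeta> \<inter> ball \<zeta> d" for z w
    using norm_triangle_ineq4[of "F z - L" "F w - L"] near[OF that(1)] near[OF that(2)] by simp
  then show ?thesis using d(1) by blast
qed

definition nontangential_set :: "(complex \<Rightarrow> complex) \<Rightarrow> complex set" where
  "nontangential_set F = {\<zeta> \<in> sphere 0 1. \<exists>L. has_nontangential_limit F \<zeta> L}"

text \<open>
  By the Cauchy criterion, existence of the limit is a countable combination of conditions that are
  closed in the vertex \<open>\<zeta>\<close>.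
\<close>

lemma sets_nontangential_set [measurable]: "nontangential_set F \<in> sets borel"
proof -
  define Q where "Q k n j = {\<zeta>. \<forall>z w. z \<in> stolz_region (real k + 2) \<zeta> \<inter> ball \<zeta> (1 / Suc j) \<and>
      w \<in> stolz_region (real k + 2) \<zeta> \<inter> ball \<zeta> (1 / Suc j) \<longrightarrow> norm (F z - F w) \<le> 1 / Suc n}"
    for k n j :: nat
  have "closed (Q k n j)" for k n j
  proof -
    have "- Q k n j = (\<Union>(z, w)\<in>{(z, w). \<not> norm (F z - F w) \<le> 1 / Suc n}.
        {\<zeta>. z \<in> stolz_region (real k + 2) \<zeta>} \<inter> ball z (1 / Suc j) \<inter> ({\<zeta>. w \<in> stolz_region (real k + 2) \<zeta>} \<inter> ball w (1 / Suc j)))"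
      unfolding Q_def by (force simp: dist_commute)
    moreover have "open \<dots>"
      by (intro open_UN ballI) (auto intro!: open_Int open_stolz_conv)
    ultimately show ?thesis by (simp add: closed_def)
  qed
  then have [measurable]: "Q k n j \<in> sets borel" for k n j by simp
  have "nontangential_set F = sphere 0 1 \<inter> (\<Inter>k n. \<Union>j. Q k n j)"
  proof (rule set_eqI)
    fix \<zeta> :: complex
    show "\<zeta> \<in> nontangential_set F \<longleftrightarrow> \<zeta> \<in> sphere 0 1 \<inter> (\<Inter>k n. \<Union>j. Q k n j)"
    proof
      assume "\<zeta> \<in> nontangential_set F"
      then obtain L where \<zeta>: "norm \<zeta> = 1" and L: "has_nontangential_limit F \<zeta> L"
        by (auto simp: nontangential_set_def)
      have "\<exists>j. \<zeta> \<in> Q k n j" for k n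
      proof -
        obtain d where d: "0 < d" "\<forall>z\<in>stolz_region (real k + 2) \<zeta> \<inter> ball \<zeta> d.
            \<forall>w\<in>stolz_region (real k + 2) \<zeta> \<inter> ball \<zeta> d. norm (F z - F w) \<le> 1 / Suc n"
          using nontangential_limit_imp_Cauchy[OF L \<zeta>, of "real k + 2" "1 / Suc n"] by auto
        obtain j where "1 / Suc j < d" using nat_approx_posE[OF d(1)] by blast
        then have "ball \<zeta> (1 / Suc j) \<subseteq> ball \<zeta> d" by auto
        then show ?thesis using d(2) unfolding Q_def by blast
      qed
      then show "\<zeta> \<in> sphere 0 1 \<inter> (\<Inter>k n. \<Union>j. Q k n j)" using \<zeta> by auto
    next
      assume *: "\<zeta> \<in> sphere 0 1 \<inter> (\<Inter>k n. \<Union>j. Q k n j)"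
      have "\<exists>L. has_nontangential_limit F \<zeta> L"
      proof (rule nontangential_Cauchy_imp_limit)
        show "norm \<zeta> = 1" using * by simp
        fix k n :: nat
        obtain j where "\<zeta> \<in> Q k n j" using * by blast
        then show "\<exists>d>0. \<forall>z\<in>stolz_region (real k + 2) \<zeta> \<inter> ball \<zeta> d.
            \<forall>w\<in>stolz_region (real k + 2) \<zeta> \<inter> ball \<zeta> d. norm (F z - F w) \<le> 1 / Suc n"
          unfolding Q_def by (intro exI[of _ "1 / Suc j"]) auto
      qed
      then show "\<zeta> \<in> nontangential_set F" using * by (auto simp: nontangential_set_def)
    qed
  qed
  then show ?thesis by simp
qed

lemma compact_inner_approx:
  fixes M :: "complex measure"
  assumes "finite_measure M" "sets M = sets borel" "B \<in> sets borel" "0 < e"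
  obtains K where "compact K" "K \<subseteq> B" "measure M (B - K) < e"
proof -
  interpret finite_measure M by fact
  have SUP: "emeasure M B = (SUP K \<in> {K. K \<subseteq> B \<and> compact K}. emeasure M K)"
    by (rule inner_regular) (use assms in auto)
  have "\<exists>K. K \<subseteq> B \<and> compact K \<and> measure M B < measure M K + e"
  proof (cases "measure M B = 0")
    case True
    then show ?thesis using assms(4) by (intro exI[of _ "{}"]) auto
  next
    case False
    then have "ennreal (measure M B - e) < emeasure M B"
      using assms(4) unfolding emeasure_eq_measure by (intro ennreal_lessI) (auto simp: zero_less_measure_iff)
    then obtain K where K: "K \<subseteq> B" "compact K" "ennreal (measure M B - e) < ennreal (measure M K)"
      unfolding SUP less_SUP_iff by (auto simp: emeasure_eq_measure)
    then have "measure M B - e < measure M K"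
      using ennreal_leI[of "measure M K" "measure M B - e"] by (force simp: not_le[symmetric])
    then show ?thesis using K by (intro exI[of _ K]) auto
  qed
  then obtain K where K: "K \<subseteq> B" "compact K" "measure M B < measure M K + e" by auto
  moreover have "measure M (B - K) = measure M B - measure M K"
    using K assms by (intro finite_measure_Diff) (auto simp: borel_compact)
  ultimately show ?thesis using K by (intro that[of K]) auto
qed

locale singular_circle_measure = circle_measure +
  assumes singular: "\<exists>A\<in>null_sets unif_circle. AE \<omega> in M. \<omega> \<in> A"

text \<open>
  A limit along one sequence of Borel functions, hence itself Borel on the whole plane. For singular
  measures it represents the nontangential limit, with which it agrees almost everywhere.
\<close>

definition radial_limit :: "complex measure \<Rightarrow> complex \<Rightarrow> real" where
  "radial_limit M \<zeta> = Re (lim (\<lambda>n. herglotz M (of_real (radius n) * \<zeta>)))"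

context circle_measure
begin

lemma sets_restr [simp, measurable_cong]: "sets (restr M B) = sets borel"
  by (simp add: restr_def)

lemma emeasure_restr:
  assumes "B \<in> sets borel" "X \<in> sets borel"
  shows "emeasure (restr M B) X = emeasure M (B \<inter> X)"
  using assms by (simp add: restr_def emeasure_density indicator_inter_arith[symmetric] ennreal_indicator)

lemma measure_restr:
  assumes "B \<in> sets borel" "X \<in> sets borel"
  shows "measure (restr M B) X = measure M (B \<inter> X)"
  using emeasure_restr[OF assms] by (simp add: measure_def)

lemma AE_restr:
  assumes "B \<in> sets borel"
  shows "(AE \<omega> in restr M B. P \<omega>) \<longleftrightarrow> (AE \<omega> in M. \<omega> \<in> B \<longrightarrow> P \<omega>)"
  unfolding restr_def using assms by (subst AE_density) (auto simp: indicator_def)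

lemma circle_measure_restr:
  assumes "B \<in> sets borel"
  shows "circle_measure (restr M B)"
proof (intro circle_measure.intro circle_measure_axioms.intro finite_measureI)
  show "emeasure (restr M B) (space (restr M B)) \<noteq> \<infinity>"
    using emeasure_restr[OF assms, of UNIV] by (simp add: restr_def emeasure_eq_measure)
  show "AE \<omega> in restr M B. norm \<omega> = 1"
    using AE_norm by (auto simp: AE_restr[OF assms])
qed simp

lemma herglotz_restr_split:
  assumes [measurable]: "B \<in> sets borel" and z: "norm z < 1"
  shows "herglotz M z = herglotz (restr M B) z + herglotz (restr M (- B)) z"
proof -
  note int = integrable_herglotz_kernel[OF z]
  have eq: "herglotz (restr M C) z = (\<integral>\<omega>. indicator C \<omega> *\<^sub>R herglotz_kernel \<omega> z \<partial>M)"
    if [measurable]: "C \<in> sets borel" for C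
    unfolding herglotz_def restr_def by (subst integral_density) auto
  have [measurable]: "- B \<in> sets borel" using assms by auto
  have "herglotz (restr M B) z + herglotz (restr M (- B)) z
      = (\<integral>\<omega>. indicator B \<omega> *\<^sub>R herglotz_kernel \<omega> z + indicator (- B) \<omega> *\<^sub>R herglotz_kernel \<omega> z \<partial>M)"
    unfolding eq[OF assms(1)] eq[OF \<open>- B \<in> sets borel\<close>]
    using int by (subst Bochner_Integration.integral_add) (auto intro!: integrable_mult_indicator)
  also have "\<dots> = herglotz M z"
    unfolding herglotz_def by (intro Bochner_Integration.integral_cong) (auto simp: indicator_def)
  finally show ?thesis by simp
qed

lemma borel_measurable_radial_limit [measurable]: "radial_limit M \<in> borel_measurable borel"
proof -
  have "(\<lambda>\<zeta>::complex. herglotz M (of_real (radius n) * \<zeta>)) \<in> borel_measurable borel" for n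
    by measurable
  then have "(\<lambda>\<zeta>::complex. lim (\<lambda>n. herglotz M (of_real (radius n) * \<zeta>))) \<in> borel_measurable borel"
    by (intro borel_measurable_lim_metric)
  then show ?thesis
    unfolding radial_limit_def by measurable
qed

end

context singular_circle_measure
begin

lemma compact_null_approx:
  assumes "0 < e"
  obtains K where "compact K" "K \<in> null_sets unif_circle" "measure M (- K) < e"
proof -
  obtain A where A: "A \<in> null_sets unif_circle" "AE \<omega> in M. \<omega> \<in> A" using singular by blast
  then have Ab: "A \<in> sets borel" by auto
  obtain K where K: "compact K" "K \<subseteq> A" "measure M (A - K) < e"
    using compact_inner_approx[OF finite_measure_axioms sets_M Ab assms] by blast
  have "measure M (- K) = measure M (A - K)"
    using A(2) Ab K(1) by (intro measure_eq_AE) (auto simp: borel_compact borel_comp elim!: eventually_mono)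
  then show ?thesis
    using K null_sets_subset[OF A(1) _ K(2)] by (intro that[of K]) (auto intro: borel_compact)
qed

text \<open>
  Write the measure as its restriction to a compact null set \<open>K\<close> plus a remainder of mass
  below \<open>1 / (n + 1)\<close>. Near a point off \<open>K\<close> the first part oscillates little and is nearly real; outside a
  set of measure \<open>O(n powr (-1/2))\<close> the remainder is below \<open>l / 4\<close> on the whole Stolz region. The
  exceptional set \<open>\<Inter>n. N n\<close> is null.
\<close>

lemma oscillation_null:
  assumes a: "1 < a" and l: "0 < l"
  shows "AE \<zeta> in unif_circle. \<exists>d>0. \<forall>z\<in>stolz_region a \<zeta> \<inter> ball \<zeta> d. \<forall>w\<in>stolz_region a \<zeta> \<inter> ball \<zeta> d.
     norm (herglotz M z - herglotz M w) \<le> l \<and> \<bar>Im (herglotz M z)\<bar> \<le> l"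
proof -
  let ?F = "herglotz M"
  have "\<exists>K. compact K \<and> K \<in> null_sets unif_circle \<and> measure M (- K) < 1 / Suc n" for n
    using compact_null_approx[of "1 / Suc n"] by (metis of_nat_0_less_iff zero_less_Suc zero_less_divide_1_iff)
  then obtain K where K: "\<And>n. compact (K n)" "\<And>n. K n \<in> null_sets unif_circle" "\<And>n::nat. measure M (- K n) < 1 / Suc n"
    by metis
  have Kb: "K n \<in> sets borel" "- K n \<in> sets borel" for n using borel_compact[OF K(1)[of n]] borel_comp by auto
  define N where "N n = K n \<union> {\<zeta> \<in> sphere 0 1. \<exists>w\<in>stolz_region a \<zeta>. l / 4 < norm (herglotz (restr M (- K n)) w)}" for n
  have Nm: "N n \<in> sets borel" for n
    unfolding N_def using Kb sets_stolz_ex by (intro sets.Un) auto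
  define c where "c = 160 * (1 + a)\<^sup>2"
  have "measure unif_circle (\<Inter>n. N n) \<le> c * sqrt (2 * (1 / Suc n) / (l / 4))" for n
  proof -
    interpret R: circle_measure "restr M (- K n)" by (intro circle_measure_restr Kb)
    have "measure unif_circle (\<Inter>n. N n) \<le> measure unif_circle (N n)"
      using Nm by (intro unif_circle.finite_measure_mono) auto
    also have "\<dots> \<le> measure unif_circle (K n) + measure unif_circle {\<zeta> \<in> sphere 0 1. \<exists>w\<in>stolz_region a \<zeta>. l / 4 < norm (herglotz (restr M (- K n)) w)}"
      unfolding N_def using Kb sets_stolz_ex by (intro measure_Un_le) auto
    also have "measure unif_circle (K n) = 0" using K(2)[of n] by (simp add: null_sets_def measure_def)
    also have "0 + measure unif_circle {\<zeta> \<in> sphere 0 1. \<exists>w\<in>stolz_region a \<zeta>. l / 4 < norm (herglotz (restr M (- K n)) w)}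
        \<le> c * sqrt (2 * measure (restr M (- K n)) UNIV / (l / 4))"
      unfolding c_def using R.herglotz_maximal[OF a, of "l / 4"] l by simp
    also have "\<dots> \<le> c * sqrt (2 * (1 / Suc n) / (l / 4))"
      using K(3)[of n] l Kb[of n] unfolding c_def
      by (intro mult_left_mono real_sqrt_le_mono divide_right_mono) (auto simp: measure_restr)
    finally show ?thesis .
  qed
  moreover have "(\<lambda>n. c * sqrt (2 * (1 / Suc n) / (l / 4))) \<longlonglongrightarrow> 0"
    using l by real_asymp
  ultimately have "measure unif_circle (\<Inter>n. N n) \<le> 0"
    by (intro LIMSEQ_le_const[of _ 0]) auto
  then have N0: "(\<Inter>n. N n) \<in> null_sets unif_circle"
    using Nm by (auto simp: null_sets_def unif_circle.emeasure_eq_measure intro!: antisym sets.countable_INT)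
  show ?thesis
    using AE_not_in[OF N0] AE_unif_circle_norm
  proof eventually_elim
    fix \<zeta> :: complex assume "\<zeta> \<notin> (\<Inter>n. N n)" and \<zeta>: "norm \<zeta> = 1"
    then obtain n where n: "\<zeta> \<notin> N n" by auto
    let ?R = "herglotz (restr M (- K n))" and ?G = "herglotz (restr M (K n))"
    interpret G: circle_measure "restr M (K n)" by (intro circle_measure_restr Kb)
    have small: "norm (?R w) \<le> l / 4" if "w \<in> stolz_region a \<zeta>" for w
      using n \<zeta> that by (auto simp: N_def not_less)
    have "\<zeta> \<notin> K n" using n by (simp add: N_def)
    then obtain e where e: "0 < e" "\<And>\<omega>. \<omega> \<in> K n \<Longrightarrow> e \<le> dist \<zeta> \<omega>"
      using separate_point_closed[OF compact_imp_closed[OF K(1)]] by blast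
    have gap: "AE \<omega> in restr M (K n). e / 2 \<le> norm (\<omega> - z)" if "dist \<zeta> z < e / 2" for z
      unfolding AE_restr[OF Kb(1)]
    proof (intro AE_I2 impI)
      fix \<omega> assume "\<omega> \<in> K n"
      then have "e \<le> dist \<zeta> z + norm (\<omega> - z)"
        using e(2) dist_triangle[of \<zeta> \<omega> z] by (fastforce simp: dist_norm norm_minus_commute)
      then show "e / 2 \<le> norm (\<omega> - z)" using that by simp
    qed
    define L where "L = 2 / (e / 2)\<^sup>2 * measure (restr M (K n)) UNIV"
    have L: "0 \<le> L" by (simp add: L_def)
    have Lip: "norm (?G z - ?G w) \<le> L * norm (z - w)"
      if "dist \<zeta> z < e / 2" "dist \<zeta> w < e / 2" "norm z \<le> 1" "norm w \<le> 1" for z w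
      unfolding L_def using gap[OF that(1)] gap[OF that(2)] e(1) that by (intro G.herglotz_Lipschitz) auto
    have real: "Im (?G \<zeta>) = 0"
      using gap[of \<zeta>] e(1) \<zeta> by (intro G.Im_herglotz_eq_0[of "e / 2"]) auto
    \<comment> \<open>\<open>L + 1\<close> replaces the Lipschitz constant \<open>L\<close>, which may vanish.\<close>
    define d where "d = min (e / 2) (l / (4 * (L + 1)))"
    have d: "0 < d" using e(1) l L by (simp add: d_def)
    have near: "norm (?G z - ?G \<zeta>) \<le> l / 4" if "z \<in> stolz_region a \<zeta> \<inter> ball \<zeta> d" for z
    proof -
      have "norm (?G z - ?G \<zeta>) \<le> L * norm (z - \<zeta>)"
        using that e(1) \<zeta> by (intro Lip) (auto simp: d_def stolz_region_def)
      also have "\<dots> \<le> (L + 1) * (l / (4 * (L + 1)))"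
        using that L by (intro mult_mono) (auto simp: d_def dist_norm norm_minus_commute)
      also have "\<dots> = l / 4" using L by (simp add: field_simps)
      finally show ?thesis .
    qed
    have split: "?F z = ?G z + ?R z" if "z \<in> stolz_region a \<zeta>" for z
      using herglotz_restr_split[OF Kb(1)] that by (auto simp: stolz_region_def)
    have "norm (?F z - ?F w) \<le> l \<and> \<bar>Im (?F z)\<bar> \<le> l"
      if z: "z \<in> stolz_region a \<zeta> \<inter> ball \<zeta> d" and w: "w \<in> stolz_region a \<zeta> \<inter> ball \<zeta> d" for z w
    proof
      have "?F z - ?F w = (?G z - ?G \<zeta>) - (?G w - ?G \<zeta>) + ?R z - ?R w"
        using split z w by simp
      also have "norm \<dots> \<le> norm (?G z - ?G \<zeta>) + norm (?G w - ?G \<zeta>) + norm (?R z) + norm (?R w)"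
        by (intro order_trans[OF norm_triangle_ineq4] order_trans[OF norm_triangle_ineq] add_mono norm_triangle_ineq4 order_refl)
      finally show "norm (?F z - ?F w) \<le> l"
        using near[OF z] near[OF w] small[of z] small[of w] z w by simp
      have "Im (?F z) = Im (?G z - ?G \<zeta>) + Im (?R z)"
        using split z real by simp
      then show "\<bar>Im (?F z)\<bar> \<le> l"
        using near[OF z] small[of z] z abs_Im_le_cmod[of "?G z - ?G \<zeta>"] abs_Im_le_cmod[of "?R z"] l
        by simp
    qed
    then show "\<exists>d>0. \<forall>z\<in>stolz_region a \<zeta> \<inter> ball \<zeta> d. \<forall>w\<in>stolz_region a \<zeta> \<inter> ball \<zeta> d.
        norm (?F z - ?F w) \<le> l \<and> \<bar>Im (?F z)\<bar> \<le> l"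
      using d by blast
  qed
qed

text \<open>
  Existence follows from the preceding lemma by the Cauchy criterion; the limit is real since the imaginary part
  becomes small along the radius.
\<close>

theorem AE_nontangential_limit:
  "AE \<zeta> in unif_circle. has_nontangential_limit (herglotz M) \<zeta> (of_real (radial_limit M \<zeta>))"
proof -
  let ?F = "herglotz M"
  have "AE \<zeta> in unif_circle. \<forall>k n::nat. \<exists>d>0. \<forall>z\<in>stolz_region (real k + 2) \<zeta> \<inter> ball \<zeta> d.
     \<forall>w\<in>stolz_region (real k + 2) \<zeta> \<inter> ball \<zeta> d. norm (?F z - ?F w) \<le> 1 / Suc n \<and> \<bar>Im (?F z)\<bar> \<le> 1 / Suc n"
    unfolding AE_all_countable by (intro allI oscillation_null) auto
  with AE_unif_circle_norm show ?thesis
  proof eventually_elim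
    fix \<zeta> :: complex assume \<zeta>: "norm \<zeta> = 1"
    assume osc: "\<forall>k n::nat. \<exists>d>0. \<forall>z\<in>stolz_region (real k + 2) \<zeta> \<inter> ball \<zeta> d.
     \<forall>w\<in>stolz_region (real k + 2) \<zeta> \<inter> ball \<zeta> d. norm (?F z - ?F w) \<le> 1 / Suc n \<and> \<bar>Im (?F z)\<bar> \<le> 1 / Suc n"
    have "\<exists>L. has_nontangential_limit ?F \<zeta> L"
    proof (rule nontangential_Cauchy_imp_limit[OF \<zeta>])
      fix k n :: nat
      show "\<exists>d>0. \<forall>z\<in>stolz_region (real k + 2) \<zeta> \<inter> ball \<zeta> d.
          \<forall>w\<in>stolz_region (real k + 2) \<zeta> \<inter> ball \<zeta> d. norm (?F z - ?F w) \<le> 1 / Suc n"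
        using osc[rule_format, of k n] by blast
    qed
    then obtain L where L: "has_nontangential_limit ?F \<zeta> L" by blast
    let ?f = "\<lambda>j. ?F (of_real (radius j) * \<zeta>)"
    have radial: "?f \<longlonglongrightarrow> L" by (rule nontangential_limit_imp_radial[OF L \<zeta>])
    have "\<bar>Im L\<bar> \<le> 0 + e" if "0 < e" for e
    proof -
      obtain n where n: "1 / Suc n < e" using nat_approx_posE[OF \<open>0 < e\<close>] by blast
      obtain d where d: "0 < d" "\<And>z. z \<in> stolz_region 2 \<zeta> \<inter> ball \<zeta> d \<Longrightarrow> \<bar>Im (?F z)\<bar> \<le> 1 / Suc n"
        using osc[rule_format, of 0 n] by auto
      have "eventually (\<lambda>j. of_real (radius j) * \<zeta> \<in> ball \<zeta> d) sequentially"
        using d(1) by (intro topological_tendstoD[OF radius_mult_tendsto]) auto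
      then have "eventually (\<lambda>j. \<bar>Im (?f j)\<bar> \<le> 1 / Suc n) sequentially"
        by eventually_elim (use d(2) radius_in_stolz_region[OF \<zeta>, of 2] in auto)
      then have "\<bar>Im L\<bar> \<le> 1 / Suc n"
        by (rule tendsto_upperbound[OF tendsto_rabs[OF tendsto_Im[OF radial]] _ sequentially_bot])
      then show ?thesis using n by simp
    qed
    then have "\<bar>Im L\<bar> \<le> 0" by (rule field_le_epsilon)
    then have "L = of_real (radial_limit M \<zeta>)"
      unfolding radial_limit_def limI[OF radial] by (simp add: complex_eq_iff)
    then show "has_nontangential_limit ?F \<zeta> (of_real (radial_limit M \<zeta>))" using L by simp
  qed
qed

end

section \<open>The Cauchy law of the boundary values\<close>

context singular_circle_measure
begin

text \<open>
  On each circle of radius \<open>r < 1\<close> the mean value property gives \<open>exp (\<i> t H 0)\<close>. The functions are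
  bounded by \<open>1\<close> because \<open>Im H \<ge> 0\<close>, so the mean passes to the boundary.
\<close>

lemma integral_exp_radial_limit:
  assumes "0 < t"
  shows "(\<integral>\<zeta>. exp (\<i> * of_real (t * radial_limit M \<zeta>)) \<partial>unif_circle) = exp (of_real (- t * measure M UNIV))"
proof -
  define f where "f n \<zeta> = exp (\<i> * of_real t * herglotz M (of_real (radius n) * \<zeta>))" for n and \<zeta> :: complex
  have in_ball: "norm (of_real (radius n) * \<zeta>) < 1" if "norm \<zeta> \<le> 1" for n and \<zeta> :: complex
  proof -
    have "norm (of_real (radius n) * \<zeta>) \<le> radius n * 1"
      unfolding norm_mult using radius[of n] that by (intro mult_mono) auto
    then show ?thesis using radius[of n] by simp
  qed
  have meas: "f n \<in> borel_measurable borel" for n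
    unfolding f_def by measurable
  have "integral\<^sup>L unif_circle (f n) = exp (of_real (- t * measure M UNIV))" for n
  proof -
    have "integral\<^sup>L unif_circle (f n) = f n 0"
    proof (rule mean_value_unif_circle[OF meas])
      show "continuous_on (cball 0 1) (f n)"
        unfolding f_def using in_ball
        by (intro continuous_intros continuous_on_compose2[OF holomorphic_on_imp_continuous_on[OF herglotz_holomorphic]]) auto
      have "(\<lambda>\<zeta>::complex. herglotz M (of_real (radius n) * \<zeta>)) holomorphic_on ball 0 1"
        using in_ball
        by (intro holomorphic_on_compose_gen[OF _ herglotz_holomorphic, unfolded o_def] holomorphic_intros) auto
      then show "f n holomorphic_on ball 0 1"
        unfolding f_def by (intro holomorphic_intros)
    qed
    also have "f n 0 = exp (of_real (- t * measure M UNIV))"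
      by (simp add: f_def herglotz_0 mult_ac)
    finally show ?thesis .
  qed
  moreover have "(\<lambda>n. integral\<^sup>L unif_circle (f n)) \<longlonglongrightarrow>
      (\<integral>\<zeta>. exp (\<i> * of_real (t * radial_limit M \<zeta>)) \<partial>unif_circle)"
  proof (rule integral_dominated_convergence[where w = "\<lambda>_. 1"])
    show "AE \<zeta> in unif_circle. (\<lambda>n. f n \<zeta>) \<longlonglongrightarrow> exp (\<i> * of_real (t * radial_limit M \<zeta>))"
      using AE_nontangential_limit AE_unif_circle_norm
    proof eventually_elim
      fix \<zeta> :: complex
      assume "has_nontangential_limit (herglotz M) \<zeta> (of_real (radial_limit M \<zeta>))" "norm \<zeta> = 1"
      then have "(\<lambda>n. herglotz M (of_real (radius n) * \<zeta>)) \<longlonglongrightarrow> of_real (radial_limit M \<zeta>)"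
        by (rule nontangential_limit_imp_radial)
      then show "(\<lambda>n. f n \<zeta>) \<longlonglongrightarrow> exp (\<i> * of_real (t * radial_limit M \<zeta>))"
        unfolding f_def of_real_mult mult.assoc[symmetric] by (intro tendsto_intros)
    qed
    show "AE \<zeta> in unif_circle. norm (f n \<zeta>) \<le> 1" for n
      using AE_unif_circle_norm
    proof eventually_elim
      fix \<zeta> :: complex assume "norm \<zeta> = 1"
      then have "0 \<le> Im (herglotz M (of_real (radius n) * \<zeta>))"
        by (intro Im_herglotz_nonneg in_ball) simp
      then show "norm (f n \<zeta>) \<le> 1"
        using assms by (simp add: f_def norm_exp_eq_Re)
    qed
  qed (use meas in \<open>auto\<close>)
  ultimately show ?thesis by (simp add: LIMSEQ_const_iff)
qed

lemma char_radial_limit: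
  "char (distr unif_circle borel (radial_limit M)) t = exp (of_real (- \<bar>t\<bar> * measure M UNIV))"
proof -
  have char: "char (distr unif_circle borel (radial_limit M)) s = (\<integral>\<zeta>. exp (\<i> * of_real (s * radial_limit M \<zeta>)) \<partial>unif_circle)" for s
    unfolding char_def by (subst integral_distr) auto
  consider "0 < t" | "t = 0" | "t < 0" by linarith
  then show ?thesis
  proof cases
    case 1
    then show ?thesis by (simp only: char integral_exp_radial_limit abs_of_pos)
  next
    case 2
    then show ?thesis using unif_circle.prob_space by (simp add: char)
  next
    case 3
    have "char (distr unif_circle borel (radial_limit M)) t
        = (\<integral>\<zeta>. cnj (exp (\<i> * of_real (- t * radial_limit M \<zeta>))) \<partial>unif_circle)"
      unfolding char by (simp add: exp_cnj)
    also have "\<dots> = cnj (exp (of_real (- (- t) * measure M UNIV)))"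
      using 3 integral_exp_radial_limit[of "- t"] by (simp only: Bochner_Integration.integral_cnj)
    finally show ?thesis using 3 by (simp add: exp_cnj)
  qed
qed

end

lemma singular_circle_measure_return: "singular_circle_measure (return borel 1)"
proof -
  interpret R: prob_space "return borel (1 :: complex)" by (intro prob_space_return) simp
  show ?thesis
  proof (intro singular_circle_measure.intro circle_measure.intro circle_measure_axioms.intro singular_circle_measure_axioms.intro)
    show "finite_measure (return borel (1 :: complex))" by (rule R.finite_measure_axioms)
    show "AE \<omega> in return borel 1. norm (\<omega> :: complex) = 1" by (subst AE_return) auto
    have "measure unif_circle {1} \<le> 0 + s" if "0 < s" for s
    proof -
      have "measure unif_circle {1} \<le> measure unif_circle (ball 1 (s / 2))"
        using that by (intro unif_circle.finite_measure_mono) auto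
      then show ?thesis using unif_circle_ball[of 1 "s / 2"] that by simp
    qed
    then have "measure unif_circle {1} \<le> 0" by (rule field_le_epsilon)
    then have "{1} \<in> null_sets unif_circle"
      by (intro null_setsI) (auto simp: unif_circle.emeasure_eq_measure measure_le_0_iff)
    moreover have "AE \<omega> in return borel 1. \<omega> \<in> {1 :: complex}" by (subst AE_return) auto
    ultimately show "\<exists>A\<in>null_sets unif_circle. AE \<omega> in return borel 1. \<omega> \<in> A" by blast
  qed simp
qed

text \<open>
  For a unit mass at \<open>1\<close> the boundary function is \<open>\<i> (1 + \<zeta>) / (1 - \<zeta>)\<close>, a shifted tangent. This
  explicit case supplies the Cauchy law, so the Fourier transform of its density is never computed.
\<close>

lemma radial_limit_return:
  assumes "0 < t" "t < 1"
  shows "radial_limit (return borel 1) (circlepath 0 1 t) = tan (pi * (t - 1/2))"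
proof -
  let ?\<zeta> = "circlepath 0 1 t"
  define s where "s = pi * (t - 1/2)"
  have s: "- (pi / 2) < s" "s < pi / 2"
    using assms by (auto simp: s_def field_simps)
  then have cos: "cos s \<noteq> 0" using cos_gt_zero_pi[of s] by auto
  have \<zeta>: "?\<zeta> = - (exp (\<i> * of_real s))\<^sup>2"
  proof -
    have "2 * of_real pi * \<i> * of_real t = of_real pi * \<i> + 2 * (\<i> * of_real s)"
      by (simp add: s_def algebra_simps)
    then have "?\<zeta> = exp (of_real pi * \<i> + 2 * (\<i> * of_real s))" by (simp add: circlepath)
    then show ?thesis by (simp add: exp_add exp_double)
  qed
  let ?e = "exp (\<i> * of_real s)"
  have e: "?e \<noteq> 0" "?e = of_real (cos s) + \<i> * of_real (sin s)" "1 / ?e = of_real (cos s) - \<i> * of_real (sin s)"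
  proof -
    show "?e \<noteq> 0" by simp
    show "?e = of_real (cos s) + \<i> * of_real (sin s)"
      by (simp only: exp_Euler cos_of_real sin_of_real)
    have "1 / ?e = exp (\<i> * of_real (- s))" by (simp add: exp_minus inverse_eq_divide)
    also have "\<dots> = of_real (cos (- s)) + \<i> * of_real (sin (- s))"
      by (simp only: exp_Euler cos_of_real sin_of_real)
    finally show "1 / ?e = of_real (cos s) - \<i> * of_real (sin s)" by simp
  qed
  have "1 + ?e\<^sup>2 = ?e * (1 / ?e + ?e)" "1 - ?e\<^sup>2 = ?e * (1 / ?e - ?e)"
    using e(1) by (simp_all add: field_simps power2_eq_square)
  moreover have "1 / ?e + ?e = of_real (2 * cos s)" "1 / ?e - ?e = - \<i> * of_real (2 * sin s)"
    unfolding e(3) unfolding e(2) by simp_all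
  ultimately have pm: "1 - ?\<zeta> = ?e * of_real (2 * cos s)" "1 + ?\<zeta> = ?e * (- \<i> * of_real (2 * sin s))"
    unfolding \<zeta> by simp_all
  have ne: "?\<zeta> \<noteq> 1" using pm(1) cos by auto
  have "(\<lambda>n. herglotz_kernel 1 (of_real (radius n) * ?\<zeta>)) \<longlonglongrightarrow> herglotz_kernel 1 ?\<zeta>"
    unfolding herglotz_kernel_def using ne by (intro tendsto_intros radius_mult_tendsto) auto
  moreover have "herglotz (return borel 1) z = herglotz_kernel 1 z" for z
    unfolding herglotz_def by (intro integral_return) auto
  ultimately have "lim (\<lambda>n. herglotz (return borel 1) (of_real (radius n) * ?\<zeta>)) = herglotz_kernel 1 ?\<zeta>"
    by (simp add: limI)
  also have "\<dots> = of_real (tan s)"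
    unfolding herglotz_kernel_def pm using e(1) cos by (simp add: tan_def field_simps)
  finally show ?thesis by (simp add: radial_limit_def s_def)
qed

lemma borel_measurable_cauchy_density [measurable]: "cauchy_density x \<gamma> \<in> borel_measurable borel"
  unfolding cauchy_density_def by measurable

lemma emeasure_cauchy_Ioc:
  assumes "a \<le> b"
  shows "emeasure (density lborel (cauchy_density 0 1)) {a<..b} = ennreal ((arctan b - arctan a) / pi)"
proof -
  have "emeasure (density lborel (cauchy_density 0 1)) {a<..b}
      = (\<integral>\<^sup>+x. ennreal (cauchy_density 0 1 x) * indicator {a<..b} x \<partial>lborel)"
    by (simp add: emeasure_density)
  also have "\<dots> = (\<integral>\<^sup>+x. ennreal (cauchy_density 0 1 x) * indicator {a..b} x \<partial>lborel)"
  proof (rule nn_integral_cong_AE)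
    show "AE x in lborel. ennreal (cauchy_density 0 1 x) * indicator {a<..b} x = ennreal (cauchy_density 0 1 x) * indicator {a..b} x"
      using AE_lborel_singleton[of a] by eventually_elim (auto simp: indicator_def)
  qed
  also have "\<dots> = ennreal (arctan b / pi - arctan a / pi)"
  proof (rule nn_integral_FTC_Icc[OF _ _ _ assms])
    fix x :: real
    show "0 \<le> cauchy_density 0 1 x" by (simp add: cauchy_density_def)
    have "((\<lambda>x. arctan x / pi) has_real_derivative inverse (1 + x\<^sup>2) / pi) (at x)"
      by (intro DERIV_cdivide DERIV_arctan)
    then show "((\<lambda>x. arctan x / pi) has_real_derivative cauchy_density 0 1 x) (at x)"
      by (simp add: cauchy_density_def field_simps)
  qed simp
  finally show ?thesis by (simp add: diff_divide_distrib)
qed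

lemma distr_radial_limit_return:
  "distr unif_circle borel (radial_limit (return borel 1)) = density lborel (cauchy_density 0 1)"
proof -
  interpret R: singular_circle_measure "return borel 1" by (rule singular_circle_measure_return)
  let ?R = "radial_limit (return borel 1)"
  have Ioc: "emeasure (distr unif_circle borel ?R) {a<..b} = ennreal ((arctan b - arctan a) / pi)" if "a \<le> b" for a b
  proof -
    have "emeasure (distr unif_circle borel ?R) {a<..b} = emeasure unif_circle (?R -` {a<..b})"
      by (simp add: emeasure_distr)
    also have "\<dots> = emeasure lborel {t \<in> {0..1}. circlepath 0 1 t \<in> ?R -` {a<..b}}"
      using measurable_sets[OF R.borel_measurable_radial_limit, of "{a<..b}"] by (intro emeasure_unif_circle) simp
    also have "\<dots> = emeasure lborel {arctan a / pi + 1/2<..arctan b / pi + 1/2}"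
    proof (rule emeasure_eq_AE)
      show "AE t in lborel. t \<in> {t \<in> {0..1}. circlepath 0 1 t \<in> ?R -` {a<..b}} \<longleftrightarrow> t \<in> {arctan a / pi + 1/2<..arctan b / pi + 1/2}"
        using AE_lborel_singleton[of 0] AE_lborel_singleton[of 1]
      proof eventually_elim
        fix t :: real assume t: "t \<noteq> 0" "t \<noteq> 1"
        show "t \<in> {t \<in> {0..1}. circlepath 0 1 t \<in> ?R -` {a<..b}} \<longleftrightarrow> t \<in> {arctan a / pi + 1/2<..arctan b / pi + 1/2}"
        proof (cases "0 < t \<and> t < 1")
          case True
          then have s: "- (pi / 2) < pi * (t - 1/2)" "pi * (t - 1/2) < pi / 2"
            by (auto simp: field_simps)
          have "a < tan (pi * (t - 1/2)) \<longleftrightarrow> arctan a < pi * (t - 1/2)"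
            using arctan_less_iff[of a "tan (pi * (t - 1/2))"] arctan_tan[OF s] by simp
          moreover have "tan (pi * (t - 1/2)) \<le> b \<longleftrightarrow> pi * (t - 1/2) \<le> arctan b"
            using arctan_le_iff[of "tan (pi * (t - 1/2))" b] arctan_tan[OF s] by simp
          ultimately show ?thesis
            using True by (auto simp: radial_limit_return field_simps)
        next
          case False
          have "0 < arctan a / pi + 1/2" "arctan b / pi + 1/2 < 1"
            using arctan_lbound[of a] arctan_ubound[of b] by (auto simp: field_simps)
          then show ?thesis using False t by auto
        qed
      qed
      have "(\<lambda>t. ?R (circlepath 0 1 t)) \<in> borel_measurable borel" by measurable
      then have [measurable]: "(\<lambda>t. ?R (circlepath 0 1 t)) -` {a<..b} \<in> sets borel"
        using measurable_sets[of "\<lambda>t. ?R (circlepath 0 1 t)" borel borel "{a<..b}"] by simp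
      have "{t \<in> {0..1}. circlepath 0 1 t \<in> ?R -` {a<..b}} = {0..1} \<inter> (\<lambda>t. ?R (circlepath 0 1 t)) -` {a<..b}" by auto
      then show "{t \<in> {0..1}. circlepath 0 1 t \<in> ?R -` {a<..b}} \<in> sets lborel" by simp
    qed simp
    also have "\<dots> = ennreal ((arctan b - arctan a) / pi)"
      using that by (simp add: divide_right_mono arctan_le_iff diff_divide_distrib)
    finally show ?thesis .
  qed
  show ?thesis
  proof (rule measure_eqI_generator_eq[where \<Omega>=UNIV])
    fix X assume "X \<in> range (\<lambda>(a, b). {a<..b::real})"
    then obtain a b where "X = {a<..b}" by auto
    then show "emeasure (distr unif_circle borel ?R) X = emeasure (density lborel (cauchy_density 0 1)) X"
      by (cases "a \<le> b") (simp_all add: Ioc emeasure_cauchy_Ioc)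
  next
    show "(\<Union>i. {- real (i::nat)<..real i}) = UNIV" by (rule UN_Ioc_eq_UNIV)
    show "emeasure (distr unif_circle borel ?R) {- real i<..real i} \<noteq> \<infinity>" for i :: nat
      by (simp add: Ioc)
  qed (auto simp: borel_sigma_sets_Ioc Int_stable_def)
qed

lemma cauchy_tail:
  assumes "0 \<le> y"
  shows "measure (density lborel (cauchy_density 0 1)) {t. y < \<bar>t\<bar>} = 1 - 2 / pi * arctan y"
proof -
  let ?C = "density lborel (cauchy_density 0 1)"
  interpret R: singular_circle_measure "return borel 1" by (rule singular_circle_measure_return)
  interpret C: prob_space ?C
    unfolding distr_radial_limit_return[symmetric] by (rule unif_circle.prob_space_distr) simp
  have "AE t in ?C. t \<noteq> - y"
    using AE_lborel_singleton[of "- y"] by (subst AE_density) (auto elim!: eventually_mono)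
  then have "measure ?C {t. y < \<bar>t\<bar>} = measure ?C (space ?C - {- y<..y})"
    by (intro measure_eq_AE) (auto elim!: eventually_mono)
  also have "\<dots> = 1 - measure ?C {- y<..y}"
    by (subst C.prob_compl) auto
  also have "measure ?C {- y<..y} = (arctan y - arctan (- y)) / pi"
    using emeasure_cauchy_Ioc[of "- y" y] assms by (simp add: measure_def arctan_minus)
  finally show ?thesis by (simp add: arctan_minus)
qed

context singular_circle_measure
begin

text \<open>
  Both sides have the characteristic function \<open>exp (- |t| m)\<close>, where \<open>m\<close> is the mass.
\<close>

lemma distr_radial_limit:
  "distr unif_circle borel (radial_limit M)
     = distr unif_circle borel (\<lambda>\<zeta>. measure M UNIV * radial_limit (return borel 1) \<zeta>)" (is "?L = ?R")
proof (rule Levy_uniqueness)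
  interpret R: singular_circle_measure "return borel 1" by (rule singular_circle_measure_return)
  show "real_distribution ?L" "real_distribution ?R"
    by (intro real_distribution.intro real_distribution_axioms.intro unif_circle.prob_space_distr; simp)+
  have "char ?R t = exp (of_real (- \<bar>t\<bar> * measure M UNIV))" for t
  proof -
    have "char ?R t = char (distr unif_circle borel (radial_limit (return borel 1))) (t * measure M UNIV)"
      unfolding char_def by (simp add: integral_distr mult.assoc)
    also have "\<dots> = exp (of_real (- \<bar>t\<bar> * measure M UNIV))"
      unfolding R.char_radial_limit by (simp add: abs_mult measure_return)
    finally show ?thesis .
  qed
  then show "char ?L = char ?R"
    by (auto simp: char_radial_limit)
qed

lemma distr_radial_limit_cauchy:
  assumes "measure M UNIV = 1"
  shows "distr unif_circle borel (radial_limit M) = density lborel (cauchy_density 0 1)"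
  using distr_radial_limit distr_radial_limit_return assms by simp

theorem radial_limit_tail:
  assumes x: "0 < x"
  shows "measure unif_circle {\<zeta>. x < \<bar>radial_limit M \<zeta>\<bar>} = 2 / pi * arctan (measure M UNIV / x)"
proof -
  interpret R: singular_circle_measure "return borel 1" by (rule singular_circle_measure_return)
  let ?R = "radial_limit (return borel 1)" and ?m = "measure M UNIV"
  have vimage: "measure (distr unif_circle borel f) {t. y < \<bar>t\<bar>} = measure unif_circle {\<zeta>. y < \<bar>f \<zeta>\<bar>}"
    if [measurable]: "f \<in> borel_measurable borel" for f :: "complex \<Rightarrow> real" and y
    by (subst measure_distr) (auto simp: vimage_def)
  have "measure unif_circle {\<zeta>. x < \<bar>radial_limit M \<zeta>\<bar>} = measure unif_circle {\<zeta>. x < \<bar>?m * ?R \<zeta>\<bar>}"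
    using distr_radial_limit by (subst (1 2) vimage[symmetric]) auto
  also have "\<dots> = 2 / pi * arctan (?m / x)"
  proof (cases "?m = 0")
    case False
    then have m: "0 < ?m" by (simp add: zero_less_measure_iff)
    then have "{\<zeta>. x < \<bar>?m * ?R \<zeta>\<bar>} = {\<zeta>. x / ?m < \<bar>?R \<zeta>\<bar>}"
      by (auto simp: abs_mult field_simps)
    then have "measure unif_circle {\<zeta>. x < \<bar>?m * ?R \<zeta>\<bar>} = 1 - 2 / pi * arctan (x / ?m)"
      using m x by (simp add: cauchy_tail distr_radial_limit_return flip: vimage)
    also have "arctan (x / ?m) = pi / 2 - arctan (?m / x)"
      using arctan_inverse[of "?m / x"] m x by (simp add: sgn_if)
    finally show ?thesis by (simp add: field_simps)
  qed (use x in simp)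
  finally show ?thesis .
qed

end

section \<open>Tails for a mutually singular pair\<close>

lemma arctan_tail_limit:
  fixes m k b :: real
  assumes "0 \<le> m" "0 < k"
  shows "((\<lambda>x. x * (2 / pi * arctan (m / (k * x + b)))) \<longlongrightarrow> 2 / pi * (m / k)) at_top"
proof (cases "m = 0")
  case False
  then have "0 < m" using assms by simp
  then have "((\<lambda>x. x * (2 / pi * arctan (m / (k * x + b)))) \<longlongrightarrow> 2 * (m * inverse k) / pi) at_top"
    using assms(2) by real_asymp
  then show ?thesis by (simp add: field_simps)
qed simp

definition tail :: "(complex \<Rightarrow> real) \<Rightarrow> real \<Rightarrow> real" where
  "tail f x = measure unif_circle {\<zeta>. x < \<bar>f \<zeta>\<bar>}"

text \<open>
  At distance \<open>d\<close> from the support the kernel is bounded by \<open>4 / d\<close> on the part of the unit disc within \<open>d / 2\<close>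
  of \<open>\<zeta>\<close>.
\<close>

lemma (in circle_measure) radial_limit_le_gap:
  assumes "has_nontangential_limit (herglotz M) \<zeta> (of_real (radial_limit M \<zeta>))" and \<zeta>: "norm \<zeta> = 1"
    and gap: "AE \<omega> in M. d \<le> norm (\<omega> - \<zeta>)" and d: "0 < d"
  shows "\<bar>radial_limit M \<zeta>\<bar> \<le> 4 / d * measure M UNIV"
proof -
  have lim: "(\<lambda>n. norm (herglotz M (of_real (radius n) * \<zeta>))) \<longlonglongrightarrow> norm (complex_of_real (radial_limit M \<zeta>))"
    by (intro tendsto_norm nontangential_limit_imp_radial assms)
  have "eventually (\<lambda>n. of_real (radius n) * \<zeta> \<in> ball \<zeta> (d / 2)) sequentially"
    using d by (intro topological_tendstoD[OF radius_mult_tendsto]) auto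
  then have "eventually (\<lambda>n. norm (herglotz M (of_real (radius n) * \<zeta>)) \<le> 4 / d * measure M UNIV) sequentially"
  proof eventually_elim
    fix n assume near: "of_real (radius n) * \<zeta> \<in> ball \<zeta> (d / 2)"
    have "AE \<omega> in M. d / 2 \<le> norm (\<omega> - of_real (radius n) * \<zeta>)"
      using gap
    proof eventually_elim
      fix \<omega> assume "d \<le> norm (\<omega> - \<zeta>)"
      then show "d / 2 \<le> norm (\<omega> - of_real (radius n) * \<zeta>)"
        using near dist_triangle[of \<omega> \<zeta> "of_real (radius n) * \<zeta>"] by (simp add: dist_norm norm_minus_commute)
    qed
    then have "norm (herglotz M (of_real (radius n) * \<zeta>)) \<le> 2 / (d / 2) * measure M UNIV"
      using d \<zeta> radius[of n] by (intro norm_herglotz_le) (auto simp: norm_mult)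
    then show "norm (herglotz M (of_real (radius n) * \<zeta>)) \<le> 4 / d * measure M UNIV" by simp
  qed
  from tendsto_upperbound[OF lim this] show ?thesis by simp
qed

context singular_circle_measure
begin

lemma singular_circle_measure_restr:
  assumes "B \<in> sets borel"
  shows "singular_circle_measure (restr M B)"
proof (intro singular_circle_measure.intro singular_circle_measure_axioms.intro circle_measure_restr assms)
  show "\<exists>A\<in>null_sets unif_circle. AE \<omega> in restr M B. \<omega> \<in> A"
    using singular unfolding AE_restr[OF assms] by (auto elim!: eventually_mono)
qed

lemma AE_radial_limit_split:
  assumes B: "B \<in> sets borel"
  shows "AE \<zeta> in unif_circle. radial_limit M \<zeta> = radial_limit (restr M B) \<zeta> + radial_limit (restr M (- B)) \<zeta>"
proof -
  interpret B: singular_circle_measure "restr M B" by (intro singular_circle_measure_restr B)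
  interpret C: singular_circle_measure "restr M (- B)" by (intro singular_circle_measure_restr borel_comp B)
  show ?thesis
    using AE_nontangential_limit B.AE_nontangential_limit C.AE_nontangential_limit AE_unif_circle_norm
  proof eventually_elim
    fix \<zeta> :: complex
    assume lims: "has_nontangential_limit (herglotz M) \<zeta> (of_real (radial_limit M \<zeta>))"
      "has_nontangential_limit (herglotz (restr M B)) \<zeta> (of_real (radial_limit (restr M B) \<zeta>))"
      "has_nontangential_limit (herglotz (restr M (- B))) \<zeta> (of_real (radial_limit (restr M (- B)) \<zeta>))"
      and \<zeta>: "norm \<zeta> = 1"
    have "herglotz M (of_real (radius n) * \<zeta>)
        = herglotz (restr M B) (of_real (radius n) * \<zeta>) + herglotz (restr M (- B)) (of_real (radius n) * \<zeta>)" for n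
      using radius[of n] \<zeta> by (intro herglotz_restr_split B) (simp add: norm_mult)
    then have "(\<lambda>n. herglotz M (of_real (radius n) * \<zeta>)) \<longlonglongrightarrow>
        of_real (radial_limit (restr M B) \<zeta>) + of_real (radial_limit (restr M (- B)) \<zeta>)"
      using tendsto_add[OF nontangential_limit_imp_radial[OF lims(2) \<zeta>] nontangential_limit_imp_radial[OF lims(3) \<zeta>]]
      by simp
    from LIMSEQ_unique[OF nontangential_limit_imp_radial[OF lims(1) \<zeta>] this]
    show "radial_limit M \<zeta> = radial_limit (restr M B) \<zeta> + radial_limit (restr M (- B)) \<zeta>"
      by (simp flip: of_real_add)
  qed
qed

lemma radial_limit_tail_le:
  assumes "0 < x"
  shows "measure unif_circle {\<zeta>. x < \<bar>radial_limit M \<zeta>\<bar>} \<le> measure M UNIV / x"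
proof -
  have "2 / pi * arctan (measure M UNIV / x) \<le> 1 * (measure M UNIV / x)"
    using assms pi_ge_two arctan_le_self[of "measure M UNIV / x"]
    by (intro mult_mono) (auto simp: field_simps)
  then show ?thesis using radial_limit_tail[OF assms] by simp
qed

end

text \<open>
  The Jordan parts of the signed measure after transport to the unit circle.
\<close>

locale singular_circle_pair = p: singular_circle_measure p + n: singular_circle_measure n
  for p n :: "complex measure" +
  assumes mutually_singular: "\<exists>A\<in>sets borel. (AE \<omega> in p. \<omega> \<in> A) \<and> (AE \<omega> in n. \<omega> \<notin> A)"
begin

definition limit :: "complex \<Rightarrow> real" where
  "limit \<zeta> = radial_limit p \<zeta> - radial_limit n \<zeta>"

lemma borel_measurable_limit [measurable]: "limit \<in> borel_measurable borel"
  unfolding limit_def by measurable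

definition mass :: "complex set \<Rightarrow> real" where
  "mass G = measure p G + measure n G"

text \<open>
  Up to a bounded term and a small one, the boundary function \<open>limit\<close> is \<open>X\<close> or \<open>Y\<close> wherever the latter
  is large. These come from disjoint parts of the positive and the negative mass in \<open>G\<close> and have exact
  Cauchy tails of scales \<open>s\<close> and \<open>t\<close>. Their exceedance sets are disjoint and contained in \<open>G\<close> above the
  level \<open>b\<close>.
\<close>

definition localized :: "complex set \<Rightarrow> real \<Rightarrow> (complex \<Rightarrow> real) \<Rightarrow> (complex \<Rightarrow> real) \<Rightarrow>
    (complex \<Rightarrow> real) \<Rightarrow> real \<Rightarrow> real \<Rightarrow> real \<Rightarrow> bool" where
  "localized G \<epsilon> X Y Z s t b \<longleftrightarrow>
     X \<in> borel_measurable borel \<and> Y \<in> borel_measurable borel \<and> Z \<in> borel_measurable borel \<and>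
     0 \<le> s \<and> 0 \<le> t \<and> mass G - \<epsilon> \<le> s + t \<and> s + t \<le> mass G \<and> 0 \<le> b \<and>
     (\<forall>x>0. tail X x = 2 / pi * arctan (s / x)) \<and> (\<forall>x>0. tail Y x = 2 / pi * arctan (t / x)) \<and>
     (\<forall>x>0. tail Z x \<le> \<epsilon> / x) \<and>
     (AE \<zeta> in unif_circle. b < \<bar>X \<zeta>\<bar> \<longrightarrow> \<zeta> \<in> G \<and> \<bar>Y \<zeta>\<bar> \<le> b \<and> \<bar>limit \<zeta> - X \<zeta>\<bar> \<le> b + \<bar>Z \<zeta>\<bar>) \<and>
     (AE \<zeta> in unif_circle. b < \<bar>Y \<zeta>\<bar> \<longrightarrow> \<zeta> \<in> G \<and> \<bar>X \<zeta>\<bar> \<le> b \<and> \<bar>limit \<zeta> - Y \<zeta>\<bar> \<le> b + \<bar>Z \<zeta>\<bar>) \<and>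
     (G = UNIV \<longrightarrow> (AE \<zeta> in unif_circle. \<bar>limit \<zeta>\<bar> \<le> \<bar>X \<zeta>\<bar> + \<bar>Y \<zeta>\<bar> + b + \<bar>Z \<zeta>\<bar>))"

text \<open>
  The measures \<open>p1\<close> and \<open>n1\<close> are the restrictions of \<open>p\<close> and \<open>n\<close> to disjoint compact subsets of \<open>G\<close>,
  \<open>p2\<close> and \<open>n2\<close> are what these miss inside \<open>G\<close>, and the remaining parts \<open>p3\<close> and \<open>n3\<close> live outside
  \<open>G\<close>. With \<open>d\<close> a lower bound for the distances between the two compact sets and from them to the
  complement of \<open>G\<close>, no point has distance less than \<open>d / 2\<close> from two of these three
  sets. So wherever one main piece
  is large, the other one and the outer parts are bounded by the constant of \<open>radial_limit_le_gap\<close>.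
  For \<open>G = UNIV\<close> there are no outer parts, and the decomposition bounds the total.
\<close>

lemma ex_localized:
  assumes G: "open G" and \<epsilon>0: "0 < \<epsilon>0"
  shows "\<exists>X Y Z s t b. localized G \<epsilon>0 X Y Z s t b"
proof -
  define \<epsilon> where "\<epsilon> = \<epsilon>0 / 4"
  have \<epsilon>: "0 < \<epsilon>" using \<epsilon>0 by (simp add: \<epsilon>_def)
  obtain A where A: "A \<in> sets borel" "AE \<omega> in p. \<omega> \<in> A" "AE \<omega> in n. \<omega> \<notin> A"
    using mutually_singular by blast
  have Gb: "G \<in> sets borel" "- G \<in> sets borel" using G by auto
  have GA: "G \<inter> A \<in> sets borel" "G - A \<in> sets borel" using Gb A(1) by auto
  obtain Kp where Kp: "compact Kp" "Kp \<subseteq> G \<inter> A" "measure p (G \<inter> A - Kp) < \<epsilon>"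
    using compact_inner_approx[OF p.finite_measure_axioms p.sets_M GA(1) \<epsilon>] by blast
  obtain Kn where Kn: "compact Kn" "Kn \<subseteq> G - A" "measure n (G - A - Kn) < \<epsilon>"
    using compact_inner_approx[OF n.finite_measure_axioms n.sets_M GA(2) \<epsilon>] by blast
  have Kb: "Kp \<in> sets borel" "Kn \<in> sets borel" "- Kp \<in> sets borel" "- Kn \<in> sets borel"
    using Kp(1) Kn(1) by (auto simp: borel_compact borel_comp)
  define p1 n1 where "p1 = restr p Kp" and "n1 = restr n Kn"
  define p2 n2 where "p2 = restr (restr p (- Kp)) G" and "n2 = restr (restr n (- Kn)) G"
  define p3 n3 where "p3 = restr (restr p (- Kp)) (- G)" and "n3 = restr (restr n (- Kn)) (- G)"
  interpret p': singular_circle_measure "restr p (- Kp)" by (intro p.singular_circle_measure_restr Kb)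
  interpret n': singular_circle_measure "restr n (- Kn)" by (intro n.singular_circle_measure_restr Kb)
  interpret p1: singular_circle_measure p1 unfolding p1_def by (intro p.singular_circle_measure_restr Kb)
  interpret n1: singular_circle_measure n1 unfolding n1_def by (intro n.singular_circle_measure_restr Kb)
  interpret p2: singular_circle_measure p2 unfolding p2_def by (intro p'.singular_circle_measure_restr Gb)
  interpret n2: singular_circle_measure n2 unfolding n2_def by (intro n'.singular_circle_measure_restr Gb)
  interpret p3: singular_circle_measure p3 unfolding p3_def by (intro p'.singular_circle_measure_restr Gb)
  interpret n3: singular_circle_measure n3 unfolding n3_def by (intro n'.singular_circle_measure_restr Gb)
  have m1: "measure p1 UNIV = measure p Kp" "measure n1 UNIV = measure n Kn"
    using Kb by (simp_all add: p1_def n1_def p.measure_restr n.measure_restr)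
  have m2: "measure p2 UNIV = measure p (G - Kp)" "measure n2 UNIV = measure n (G - Kn)"
    using Kb Gb by (simp_all add: p2_def n2_def p'.measure_restr n'.measure_restr p.measure_restr n.measure_restr Diff_eq Int_commute)
  have "measure p (G - Kp) = measure p (G \<inter> A - Kp)" "measure n (G - Kn) = measure n (G - A - Kn)"
    using A Gb Kb by (auto intro!: measure_eq_AE elim!: eventually_mono)
  then have small: "measure p (G - Kp) \<le> \<epsilon>" "measure n (G - Kn) \<le> \<epsilon>" using Kp(3) Kn(3) by auto
  have KG: "Kp \<subseteq> G" "Kn \<subseteq> G" using Kp(2) Kn(2) by auto
  have diff: "measure p (G - Kp) = measure p G - measure p Kp" "measure n (G - Kn) = measure n G - measure n Kn"
    using Kb Gb KG by (auto intro!: p.finite_measure_Diff n.finite_measure_Diff)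
  obtain d1 where d1: "0 < d1" "\<And>x y. x \<in> Kp \<Longrightarrow> y \<in> Kn \<Longrightarrow> d1 \<le> dist x y"
    using separate_compact_closed[OF Kp(1) compact_imp_closed[OF Kn(1)]] Kp(2) Kn(2) by blast
  have cG: "closed (- G)" using G by auto
  obtain d2 where d2: "0 < d2" "\<And>x y. x \<in> Kp \<Longrightarrow> y \<in> - G \<Longrightarrow> d2 \<le> dist x y"
    using separate_compact_closed[OF Kp(1) cG] KG by blast
  obtain d3 where d3: "0 < d3" "\<And>x y. x \<in> Kn \<Longrightarrow> y \<in> - G \<Longrightarrow> d3 \<le> dist x y"
    using separate_compact_closed[OF Kn(1) cG] KG by blast
  define d where "d = min d1 (min d2 d3)"
  have d: "0 < d" "\<And>x y. x \<in> Kp \<Longrightarrow> y \<in> Kn \<Longrightarrow> d \<le> dist x y"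
    "\<And>x y. x \<in> Kp \<Longrightarrow> y \<in> - G \<Longrightarrow> d \<le> dist x y" "\<And>x y. x \<in> Kn \<Longrightarrow> y \<in> - G \<Longrightarrow> d \<le> dist x y"
    using d1 d2 d3 by (auto simp: d_def min_le_iff_disj)
  define c where "c = 8 / d * (measure p UNIV + measure n UNIV)"
  have c0: "0 \<le> c" using d by (simp add: c_def)
  have cbound: "4 / (d / 2) * measure M UNIV \<le> c"
    if "measure M UNIV \<le> measure p UNIV \<or> measure M UNIV \<le> measure n UNIV" for M :: "complex measure"
  proof -
    have "measure M UNIV \<le> measure p UNIV + measure n UNIV"
      using that measure_nonneg[of p UNIV] measure_nonneg[of n UNIV] by linarith
    then have "8 / d * measure M UNIV \<le> c" unfolding c_def using d(1) by (intro mult_left_mono) auto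
    then show ?thesis by simp
  qed
  have sub: "measure p1 UNIV \<le> measure p UNIV" "measure n1 UNIV \<le> measure n UNIV"
    "measure p3 UNIV \<le> measure p UNIV" "measure n3 UNIV \<le> measure n UNIV"
    using Kb Gb
    by (auto simp: p1_def n1_def p3_def n3_def p.measure_restr n.measure_restr p'.measure_restr n'.measure_restr
        intro!: p.finite_measure_mono n.finite_measure_mono)
  define far where "far S \<zeta> \<longleftrightarrow> (\<forall>\<omega>\<in>S. d / 2 \<le> norm (\<omega> - \<zeta>))" for S and \<zeta> :: complex
  have supp: "AE \<omega> in p1. \<omega> \<in> Kp" "AE \<omega> in n1. \<omega> \<in> Kn" "AE \<omega> in p3. \<omega> \<in> - G" "AE \<omega> in n3. \<omega> \<in> - G"
    unfolding p1_def n1_def p3_def n3_def p.AE_restr[OF Kb(1)] n.AE_restr[OF Kb(2)]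
      p'.AE_restr[OF Gb(2)] n'.AE_restr[OF Gb(2)] by simp_all
  have gap: "AE \<omega> in M. d / 2 \<le> norm (\<omega> - \<zeta>)" if "AE \<omega> in M. \<omega> \<in> S" "far S \<zeta>" for M S \<zeta>
    using that(1) by eventually_elim (use that(2) in \<open>auto simp: far_def\<close>)
  have dich: "\<not> far Kp \<zeta> \<Longrightarrow> \<zeta> \<in> G \<and> far Kn \<zeta> \<and> far (- G) \<zeta>"
    "\<not> far Kn \<zeta> \<Longrightarrow> \<zeta> \<in> G \<and> far Kp \<zeta> \<and> far (- G) \<zeta>" for \<zeta>
  proof -
    have aux: "\<zeta> \<in> G \<and> far T \<zeta> \<and> far (- G) \<zeta>" if not_far: "\<not> far S \<zeta>" and sep: "\<And>x y. x \<in> S \<Longrightarrow> y \<in> T \<Longrightarrow> d \<le> dist x y"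
      "\<And>x y. x \<in> S \<Longrightarrow> y \<in> - G \<Longrightarrow> d \<le> dist x y" for S T
    proof -
      obtain x where x: "x \<in> S" "dist x \<zeta> < d / 2" using not_far unfolding far_def dist_norm not_le[symmetric] by blast
      have tri: "d / 2 \<le> norm (y - \<zeta>)" if "d \<le> dist x y" for y
        using x(2) that dist_triangle[of x y \<zeta>] by (simp add: dist_norm norm_minus_commute)
      have "\<zeta> \<in> G"
      proof (rule ccontr)
        assume "\<zeta> \<notin> G"
        then have "d \<le> dist x \<zeta>" using sep(2)[OF x(1)] by simp
        then show False using x(2) d(1) by simp
      qed
      then show ?thesis using tri sep(1,2)[OF x(1)] by (auto simp: far_def)
    qed
    show "\<not> far Kp \<zeta> \<Longrightarrow> \<zeta> \<in> G \<and> far Kn \<zeta> \<and> far (- G) \<zeta>" by (rule aux) (use d in auto)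
    have "\<And>x y. x \<in> Kn \<Longrightarrow> y \<in> Kp \<Longrightarrow> d \<le> dist x y"
      using d(2) by (subst dist_commute)
    then show "\<not> far Kn \<zeta> \<Longrightarrow> \<zeta> \<in> G \<and> far Kp \<zeta> \<and> far (- G) \<zeta>"
      using d(4) by (intro aux) auto
  qed
  have facts: "AE \<zeta> in unif_circle. (far Kp \<zeta> \<longrightarrow> \<bar>radial_limit p1 \<zeta>\<bar> \<le> c) \<and> (far Kn \<zeta> \<longrightarrow> \<bar>radial_limit n1 \<zeta>\<bar> \<le> c)
     \<and> (far (- G) \<zeta> \<longrightarrow> \<bar>radial_limit p3 \<zeta>\<bar> \<le> c \<and> \<bar>radial_limit n3 \<zeta>\<bar> \<le> c) \<and>
     limit \<zeta> = radial_limit p1 \<zeta> + (radial_limit p2 \<zeta> + radial_limit p3 \<zeta>)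
         - (radial_limit n1 \<zeta> + (radial_limit n2 \<zeta> + radial_limit n3 \<zeta>))"
    using p1.AE_nontangential_limit n1.AE_nontangential_limit p3.AE_nontangential_limit n3.AE_nontangential_limit
      AE_unif_circle_norm p.AE_radial_limit_split[OF Kb(1)] n.AE_radial_limit_split[OF Kb(2)]
      p'.AE_radial_limit_split[OF Gb(1)] n'.AE_radial_limit_split[OF Gb(1)]
  proof eventually_elim
    case (elim \<zeta>)
    have "\<bar>radial_limit p1 \<zeta>\<bar> \<le> c" if "far Kp \<zeta>"
      using p1.radial_limit_le_gap[OF elim(1,5) gap[OF supp(1) that]] d(1) cbound[of p1] sub by simp
    moreover have "\<bar>radial_limit n1 \<zeta>\<bar> \<le> c" if "far Kn \<zeta>"
      using n1.radial_limit_le_gap[OF elim(2,5) gap[OF supp(2) that]] d(1) cbound[of n1] sub by simp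
    moreover have "\<bar>radial_limit p3 \<zeta>\<bar> \<le> c" if "far (- G) \<zeta>"
      using p3.radial_limit_le_gap[OF elim(3,5) gap[OF supp(3) that]] d(1) cbound[of p3] sub by simp
    moreover have "\<bar>radial_limit n3 \<zeta>\<bar> \<le> c" if "far (- G) \<zeta>"
      using n3.radial_limit_le_gap[OF elim(4,5) gap[OF supp(4) that]] d(1) cbound[of n3] sub by simp
    ultimately show ?case
      using elim(6-9) by (simp add: limit_def p1_def n1_def p2_def n2_def p3_def n3_def)
  qed
  define X Y Z where "X = radial_limit p1" and "Y \<zeta> = - radial_limit n1 \<zeta>"
    and "Z \<zeta> = \<bar>radial_limit p2 \<zeta>\<bar> + \<bar>radial_limit n2 \<zeta>\<bar>" for \<zeta>
  have X: "\<bar>X \<zeta>\<bar> = \<bar>radial_limit p1 \<zeta>\<bar>" and Y: "\<bar>Y \<zeta>\<bar> = \<bar>radial_limit n1 \<zeta>\<bar>" for \<zeta>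
    by (simp_all add: X_def Y_def)
  have XYZ: "AE \<zeta> in unif_circle. (far Kp \<zeta> \<longrightarrow> \<bar>X \<zeta>\<bar> \<le> c) \<and> (far Kn \<zeta> \<longrightarrow> \<bar>Y \<zeta>\<bar> \<le> c) \<and>
      (far (- G) \<zeta> \<longrightarrow> \<bar>limit \<zeta> - X \<zeta> - Y \<zeta>\<bar> \<le> 2 * c + \<bar>Z \<zeta>\<bar>)"
    using facts
  proof eventually_elim
    case (elim \<zeta>)
    define r where "r = radial_limit p2 \<zeta> - radial_limit n2 \<zeta>"
    define q where "q = radial_limit p3 \<zeta> - radial_limit n3 \<zeta>"
    have "limit \<zeta> - X \<zeta> - Y \<zeta> = r + q" using elim by (simp add: X_def Y_def r_def q_def)
    moreover have "\<bar>r\<bar> \<le> \<bar>Z \<zeta>\<bar>" by (simp add: r_def Z_def)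
    moreover have "\<bar>q\<bar> \<le> 2 * c" if "far (- G) \<zeta>" using elim that by (auto simp: q_def)
    ultimately show ?case using elim by (auto simp: X Y)
  qed
  have "localized G \<epsilon>0 X Y Z (measure p1 UNIV) (measure n1 UNIV) (3 * c)"
    unfolding localized_def
  proof (intro conjI allI impI)
    show "X \<in> borel_measurable borel" "Y \<in> borel_measurable borel" "Z \<in> borel_measurable borel"
      unfolding X_def Y_def Z_def by measurable
    show "mass G - \<epsilon>0 \<le> measure p1 UNIV + measure n1 UNIV" "measure p1 UNIV + measure n1 UNIV \<le> mass G"
      using m1 small diff measure_nonneg[of p "G - Kp"] measure_nonneg[of n "G - Kn"] \<epsilon>0
      by (auto simp: mass_def \<epsilon>_def)
    \<comment> \<open>At most three pieces are bounded by \<open>c\<close> at the same time: one main piece and the two outer parts.\<close>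
    show "0 \<le> 3 * c" using c0 by simp
    show "tail X x = 2 / pi * arctan (measure p1 UNIV / x)" "tail Y x = 2 / pi * arctan (measure n1 UNIV / x)"
      if x: "0 < x" for x
      using p1.radial_limit_tail[OF x] n1.radial_limit_tail[OF x] by (simp_all add: tail_def X Y)
    show "tail Z x \<le> \<epsilon>0 / x" if x: "0 < x" for x
    proof -
      have "tail Z x \<le> tail (radial_limit p2) (x / 2) + tail (radial_limit n2) (x / 2)"
        unfolding tail_def by (rule order_trans[OF unif_circle.finite_measure_mono measure_Un_le]) (auto simp: Z_def)
      also have "\<dots> \<le> \<epsilon> / (x / 2) + \<epsilon> / (x / 2)"
      proof (rule add_mono)
        have div: "m / (x / 2) \<le> \<epsilon> / (x / 2)" if "m \<le> \<epsilon>" for m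
          using that x by (intro divide_right_mono) auto
        show "tail (radial_limit p2) (x / 2) \<le> \<epsilon> / (x / 2)" "tail (radial_limit n2) (x / 2) \<le> \<epsilon> / (x / 2)"
          using x m2 small p2.radial_limit_tail_le[of "x / 2"] n2.radial_limit_tail_le[of "x / 2"]
            div[of "measure p2 UNIV"] div[of "measure n2 UNIV"] by (simp_all add: tail_def)
      qed
      also have "\<dots> = \<epsilon>0 / x" by (simp add: \<epsilon>_def)
      finally show ?thesis .
    qed
    show "AE \<zeta> in unif_circle. 3 * c < \<bar>X \<zeta>\<bar> \<longrightarrow> \<zeta> \<in> G \<and> \<bar>Y \<zeta>\<bar> \<le> 3 * c \<and> \<bar>limit \<zeta> - X \<zeta>\<bar> \<le> 3 * c + \<bar>Z \<zeta>\<bar>"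
      using XYZ
    proof eventually_elim
      case (elim \<zeta>)
      then show ?case using dich(1)[of \<zeta>] c0 by (cases "far Kp \<zeta>") auto
    qed
    show "AE \<zeta> in unif_circle. 3 * c < \<bar>Y \<zeta>\<bar> \<longrightarrow> \<zeta> \<in> G \<and> \<bar>X \<zeta>\<bar> \<le> 3 * c \<and> \<bar>limit \<zeta> - Y \<zeta>\<bar> \<le> 3 * c + \<bar>Z \<zeta>\<bar>"
      using XYZ
    proof eventually_elim
      case (elim \<zeta>)
      then show ?case using dich(2)[of \<zeta>] c0 by (cases "far Kn \<zeta>") auto
    qed
    show "AE \<zeta> in unif_circle. \<bar>limit \<zeta>\<bar> \<le> \<bar>X \<zeta>\<bar> + \<bar>Y \<zeta>\<bar> + 3 * c + \<bar>Z \<zeta>\<bar>" if UNIV: "G = UNIV"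
      using XYZ
    proof eventually_elim
      case (elim \<zeta>)
      have "far (- G) \<zeta>" using UNIV by (simp add: far_def)
      then show ?case using elim c0 by auto
    qed
  qed (rule measure_nonneg)+
  then show ?thesis by blast
qed

text \<open>
  In absolute value, if \<open>X\<close> or \<open>Y\<close> exceeds \<open>y = (1 + \<delta>) x + b\<close> and \<open>Z\<close> is at most \<open>\<delta> x\<close>, then the point
  lies in \<open>G\<close> and \<open>limit\<close> exceeds \<open>x\<close>. The tails of \<open>X\<close> and \<open>Y\<close> are exact and their exceedance sets disjoint; the exceptional
  set has measure at most \<open>\<epsilon> / (\<delta> x)\<close>.
\<close>

lemma eventually_tail_lower:
  assumes G: "open G" and \<eta>: "0 < \<eta>"
  shows "eventually (\<lambda>x. 2 / pi * mass G - \<eta> < x * measure unif_circle {\<zeta> \<in> G. x < \<bar>limit \<zeta>\<bar>}) at_top"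
proof -
  have [measurable]: "G \<in> sets borel" using G by simp
  define S where "S = mass G"
  have S: "0 \<le> S" by (simp add: S_def mass_def)
  define \<delta> where "\<delta> = \<eta> / (4 * (S + 1))"
  \<comment> \<open>The three losses, \<open>\<delta> S\<close> from the dilated threshold, \<open>\<epsilon>\<close> from the mass left out and \<open>\<epsilon> / \<delta>\<close> from \<open>Z\<close>,
    are then at most \<open>\<eta> / 4\<close> each.\<close>
  define \<epsilon> where "\<epsilon> = min 1 \<delta> * (\<eta> / 4)"
  have \<delta>: "0 < \<delta>" and \<epsilon>: "0 < \<epsilon>" using \<eta> S by (auto simp: \<delta>_def \<epsilon>_def)
  have \<delta>S: "\<delta> * S \<le> \<eta> / 4" using \<eta> S by (simp add: \<delta>_def field_simps)
  have "\<epsilon> \<le> 1 * (\<eta> / 4)" "\<epsilon> \<le> \<delta> * (\<eta> / 4)" unfolding \<epsilon>_def using \<eta> by (intro mult_right_mono; simp)+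
  then have \<epsilon>_le: "\<epsilon> \<le> \<eta> / 4" "\<epsilon> / \<delta> \<le> \<eta> / 4"
    using \<delta> by (simp_all only: mult_1_left pos_divide_le_eq mult.commute)
  obtain X Y Z s t b where L: "localized G \<epsilon> X Y Z s t b"
    using ex_localized[OF G \<epsilon>] by blast
  then have meas [measurable]: "X \<in> borel_measurable borel" "Y \<in> borel_measurable borel" "Z \<in> borel_measurable borel"
    and st: "0 \<le> s" "0 \<le> t" "S - \<epsilon> \<le> s + t" "s + t \<le> S" and b: "0 \<le> b"
    and tails: "\<And>x. 0 < x \<Longrightarrow> tail X x = 2 / pi * arctan (s / x)"
      "\<And>x. 0 < x \<Longrightarrow> tail Y x = 2 / pi * arctan (t / x)" "\<And>x. 0 < x \<Longrightarrow> tail Z x \<le> \<epsilon> / x"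
    unfolding localized_def S_def by blast+
  have AEX: "AE \<zeta> in unif_circle. b < \<bar>X \<zeta>\<bar> \<longrightarrow> \<zeta> \<in> G \<and> \<bar>Y \<zeta>\<bar> \<le> b \<and> \<bar>limit \<zeta> - X \<zeta>\<bar> \<le> b + \<bar>Z \<zeta>\<bar>"
    and AEY: "AE \<zeta> in unif_circle. b < \<bar>Y \<zeta>\<bar> \<longrightarrow> \<zeta> \<in> G \<and> \<bar>X \<zeta>\<bar> \<le> b \<and> \<bar>limit \<zeta> - Y \<zeta>\<bar> \<le> b + \<bar>Z \<zeta>\<bar>"
    using L unfolding localized_def by blast+
  let ?P = "measure unif_circle" and ?T = "\<lambda>m x. x * (2 / pi * arctan (m / ((1 + \<delta>) * x + b)))"
  have main: "?T s x + ?T t x - \<epsilon> / \<delta> \<le> x * ?P {\<zeta> \<in> G. x < \<bar>limit \<zeta>\<bar>}" if x: "0 < x" for x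
  proof -
    define y where "y = (1 + \<delta>) * x + b"
    have "0 < (1 + \<delta>) * x" using x \<delta> by simp
    then have y: "0 < y" "b < y" "y = x + \<delta> * x + b" using b by (auto simp: y_def algebra_simps)
    let ?A = "{\<zeta>. y < \<bar>X \<zeta>\<bar>}" and ?B = "{\<zeta>. y < \<bar>Y \<zeta>\<bar>}" and ?C = "{\<zeta>. \<delta> * x < \<bar>Z \<zeta>\<bar>}"
    let ?E = "{\<zeta> \<in> G. x < \<bar>limit \<zeta>\<bar>}"
    have [measurable]: "?A \<in> sets borel" "?B \<in> sets borel" "?C \<in> sets borel" "?E \<in> sets borel"
      by measurable
    have "AE \<zeta> in unif_circle. \<zeta> \<in> ?B \<longleftrightarrow> \<zeta> \<in> ?B - ?A"
      using AEX by eventually_elim (use y in auto)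
    then have "?P ?B = ?P (?B - ?A)" by (intro measure_eq_AE) auto
    then have "tail X y + tail Y y = ?P (?A \<union> (?B - ?A))"
      unfolding tail_def by (subst unif_circle.finite_measure_Union) auto
    also have "\<dots> \<le> ?P (?E \<union> ?C)"
    proof (rule unif_circle.finite_measure_mono_AE)
      show "AE \<zeta> in unif_circle. \<zeta> \<in> ?A \<union> (?B - ?A) \<longrightarrow> \<zeta> \<in> ?E \<union> ?C"
        using AEX AEY by eventually_elim (use y in \<open>auto simp: not_less\<close>)
    qed simp
    also have "\<dots> \<le> ?P ?E + tail Z (\<delta> * x)" unfolding tail_def by (intro measure_Un_le) simp_all
    also have "tail Z (\<delta> * x) \<le> \<epsilon> / (\<delta> * x)" using \<delta> x by (intro tails) simp
    finally have "x * (tail X y + tail Y y) \<le> x * (?P ?E + \<epsilon> / (\<delta> * x))"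
      using x by (intro mult_left_mono) auto
    also have "\<dots> = x * ?P ?E + \<epsilon> / \<delta>" using x by (simp add: algebra_simps)
    finally show ?thesis unfolding tails(1,2)[OF y(1)] by (simp add: y_def distrib_left)
  qed
  have "((\<lambda>x. ?T s x + ?T t x - \<epsilon> / \<delta>) \<longlongrightarrow> 2 / pi * (s / (1 + \<delta>)) + 2 / pi * (t / (1 + \<delta>)) - \<epsilon> / \<delta>) at_top"
    using \<delta> st by (intro tendsto_intros arctan_tail_limit) auto
  moreover have "2 / pi * S - \<eta> < 2 / pi * (s / (1 + \<delta>)) + 2 / pi * (t / (1 + \<delta>)) - \<epsilon> / \<delta>"
  proof -
    have "(S - \<delta> * S - \<epsilon>) * (1 + \<delta>) = S - \<epsilon> - \<delta>\<^sup>2 * S - \<delta> * \<epsilon>"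
      by (simp add: algebra_simps power2_eq_square)
    also have "\<dots> \<le> s + t" using st \<delta> \<epsilon> S by (smt (verit) mult_nonneg_nonneg zero_le_power2)
    finally have "S - \<delta> * S - \<epsilon> \<le> (s + t) / (1 + \<delta>)" using \<delta> by (simp add: pos_le_divide_eq)
    then have "S - (s + t) / (1 + \<delta>) \<le> \<eta> / 2" using \<delta>S \<epsilon>_le by linarith
    then have "2 / pi * (S - (s + t) / (1 + \<delta>)) \<le> 2 / pi * (\<eta> / 2)" by (intro mult_left_mono) auto
    also have "\<dots> \<le> 1 * (\<eta> / 2)" using pi_ge_two \<eta> by (intro mult_right_mono) auto
    finally have "2 / pi * S - 2 / pi * ((s + t) / (1 + \<delta>)) \<le> \<eta> / 2" by (simp add: right_diff_distrib)
    moreover have "2 / pi * (s / (1 + \<delta>)) + 2 / pi * (t / (1 + \<delta>)) = 2 / pi * ((s + t) / (1 + \<delta>))"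
      by (simp add: add_divide_distrib distrib_left)
    ultimately show ?thesis using \<epsilon>_le \<eta> by linarith
  qed
  ultimately have "eventually (\<lambda>x. 2 / pi * S - \<eta> < ?T s x + ?T t x - \<epsilon> / \<delta>) at_top"
    by (rule order_tendstoD)
  with eventually_gt_at_top[of 0] show ?thesis
    unfolding S_def[symmetric] by eventually_elim (use main in fastforce)
qed

text \<open>
  In absolute value, if \<open>limit\<close> exceeds \<open>x\<close> and \<open>Z\<close> is at most \<open>\<delta> x\<close>, then \<open>X\<close> or \<open>Y\<close> exceeds \<open>(1 - \<delta>) x - 2 b\<close>, since one
  of the two is at most \<open>b\<close>.
\<close>

lemma eventually_tail_upper:
  assumes \<eta>: "0 < \<eta>"
  shows "eventually (\<lambda>x. x * tail limit x < 2 / pi * mass UNIV + \<eta>) at_top"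
proof -
  define S where "S = mass UNIV"
  have S: "0 \<le> S" by (simp add: S_def mass_def)
  define \<delta> where "\<delta> = min (1/2) (\<eta> / (8 * (S + 1)))"
  define \<epsilon> where "\<epsilon> = \<delta> * \<eta> / 4"
  have "\<delta> \<le> 1/2" unfolding \<delta>_def by (rule min.cobounded1)
  moreover have "0 < \<delta>" using \<eta> S by (simp add: \<delta>_def)
  ultimately have \<delta>: "0 < \<delta>" "\<delta> \<le> 1/2" and \<epsilon>: "0 < \<epsilon>" using \<eta> by (auto simp: \<epsilon>_def)
  have "\<delta> * (S + 1) \<le> \<eta> / 8"
    using S min.cobounded2[of "1/2" "\<eta> / (8 * (S + 1))"] unfolding \<delta>_def[symmetric] by (simp add: field_simps)
  then have \<delta>S: "2 * \<delta> * S \<le> \<eta> / 4" using \<delta> by (simp add: algebra_simps)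
  obtain X Y Z s t b where L: "localized UNIV \<epsilon> X Y Z s t b"
    using ex_localized[OF open_UNIV \<epsilon>] by blast
  then have meas [measurable]: "X \<in> borel_measurable borel" "Y \<in> borel_measurable borel" "Z \<in> borel_measurable borel"
    and st: "0 \<le> s" "0 \<le> t" "S - \<epsilon> \<le> s + t" "s + t \<le> S" and b: "0 \<le> b"
    and tails: "\<And>x. 0 < x \<Longrightarrow> tail X x = 2 / pi * arctan (s / x)"
      "\<And>x. 0 < x \<Longrightarrow> tail Y x = 2 / pi * arctan (t / x)" "\<And>x. 0 < x \<Longrightarrow> tail Z x \<le> \<epsilon> / x"
    unfolding localized_def S_def by blast+
  have AEX: "AE \<zeta> in unif_circle. b < \<bar>X \<zeta>\<bar> \<longrightarrow> \<zeta> \<in> UNIV \<and> \<bar>Y \<zeta>\<bar> \<le> b \<and> \<bar>limit \<zeta> - X \<zeta>\<bar> \<le> b + \<bar>Z \<zeta>\<bar>"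
    and AEu: "AE \<zeta> in unif_circle. \<bar>limit \<zeta>\<bar> \<le> \<bar>X \<zeta>\<bar> + \<bar>Y \<zeta>\<bar> + b + \<bar>Z \<zeta>\<bar>"
    using L unfolding localized_def by blast+
  let ?P = "measure unif_circle" and ?T = "\<lambda>m x. x * (2 / pi * arctan (m / ((1 - \<delta>) * x + - (2 * b))))"
  have main: "x * tail limit x \<le> ?T s x + ?T t x + \<epsilon> / \<delta>"
    if x: "0 < x" and big: "0 < (1 - \<delta>) * x + - (2 * b)" for x
  proof -
    define y where "y = (1 - \<delta>) * x + - (2 * b)"
    have y: "0 < y" "y = x - \<delta> * x - 2 * b" using big by (auto simp: y_def algebra_simps)
    let ?A = "{\<zeta>. y < \<bar>X \<zeta>\<bar>}" and ?B = "{\<zeta>. y < \<bar>Y \<zeta>\<bar>}" and ?C = "{\<zeta>. \<delta> * x < \<bar>Z \<zeta>\<bar>}"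
    have [measurable]: "?A \<in> sets borel" "?B \<in> sets borel" "?C \<in> sets borel" by measurable
    have "tail limit x \<le> ?P ((?A \<union> ?B) \<union> ?C)"
      unfolding tail_def
    proof (rule unif_circle.finite_measure_mono_AE)
      show "AE \<zeta> in unif_circle. \<zeta> \<in> {\<zeta>. x < \<bar>limit \<zeta>\<bar>} \<longrightarrow> \<zeta> \<in> (?A \<union> ?B) \<union> ?C"
        using AEX AEu by eventually_elim (use y b in \<open>auto simp: not_less\<close>)
    qed simp
    also have "\<dots> \<le> (tail X y + tail Y y) + tail Z (\<delta> * x)"
      unfolding tail_def by (intro order_trans[OF measure_Un_le] add_mono measure_Un_le order_refl) simp_all
    also have "tail Z (\<delta> * x) \<le> \<epsilon> / (\<delta> * x)" using \<delta> x by (intro tails) simp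
    finally have "x * tail limit x \<le> x * (tail X y + tail Y y + \<epsilon> / (\<delta> * x))"
      using x by (intro mult_left_mono) auto
    also have "\<dots> = x * tail X y + x * tail Y y + \<epsilon> / \<delta>" using x by (simp add: algebra_simps)
    finally show ?thesis unfolding tails(1,2)[OF y(1)] by (simp add: y_def)
  qed
  have "((\<lambda>x. ?T s x + ?T t x + \<epsilon> / \<delta>) \<longlongrightarrow> 2 / pi * (s / (1 - \<delta>)) + 2 / pi * (t / (1 - \<delta>)) + \<epsilon> / \<delta>) at_top"
    using \<delta> st by (intro tendsto_intros arctan_tail_limit) auto
  moreover have "2 / pi * (s / (1 - \<delta>)) + 2 / pi * (t / (1 - \<delta>)) + \<epsilon> / \<delta> < 2 / pi * S + \<eta>"
  proof -
    have "(S + 2 * \<delta> * S) * (1 - \<delta>) = S + \<delta> * S * (1 - 2 * \<delta>)" by (simp add: algebra_simps)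
    moreover have "0 \<le> \<delta> * S * (1 - 2 * \<delta>)" using \<delta> S by (intro mult_nonneg_nonneg) auto
    ultimately have "s + t \<le> (S + 2 * \<delta> * S) * (1 - \<delta>)" using st by linarith
    then have "(s + t) / (1 - \<delta>) \<le> S + 2 * \<delta> * S" using \<delta> by (simp add: pos_divide_le_eq)
    then have "(s + t) / (1 - \<delta>) - S \<le> \<eta> / 4" using \<delta>S by linarith
    then have "2 / pi * ((s + t) / (1 - \<delta>) - S) \<le> 2 / pi * (\<eta> / 4)" by (intro mult_left_mono) auto
    also have "\<dots> \<le> 1 * (\<eta> / 4)" using pi_ge_two \<eta> by (intro mult_right_mono) auto
    finally have "2 / pi * ((s + t) / (1 - \<delta>)) - 2 / pi * S \<le> \<eta> / 4" by (simp add: right_diff_distrib)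
    moreover have "2 / pi * (s / (1 - \<delta>)) + 2 / pi * (t / (1 - \<delta>)) = 2 / pi * ((s + t) / (1 - \<delta>))"
      by (simp add: add_divide_distrib distrib_left)
    moreover have "\<epsilon> / \<delta> = \<eta> / 4" using \<delta> by (simp add: \<epsilon>_def)
    ultimately show ?thesis using \<eta> by linarith
  qed
  ultimately have lim: "eventually (\<lambda>x. ?T s x + ?T t x + \<epsilon> / \<delta> < 2 / pi * S + \<eta>) at_top"
    by (rule order_tendstoD)
  have "filterlim (\<lambda>x. (1 - \<delta>) * x + - (2 * b)) at_top at_top"
    using \<delta> by real_asymp
  then have "eventually (\<lambda>x. 0 < (1 - \<delta>) * x + - (2 * b)) at_top"
    unfolding filterlim_at_top_dense by (rule spec)
  with lim eventually_gt_at_top[of 0] show ?thesis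
    unfolding S_def[symmetric] by eventually_elim (use main in fastforce)
qed

end

section \<open>Weak convergence from lower bounds on open sets\<close>

text \<open>
  For \<open>v > 0\<close> the number of \<open>k\<close> with \<open>k + 1 < N v\<close> is \<open>N v\<close> rounded up, minus one.
\<close>

lemma superlevel_count:
  fixes v :: real and N :: nat
  assumes v: "0 \<le> v" "v \<le> 1" and N: "0 < N"
  defines "s \<equiv> (\<Sum>k<N. indicator {k. real (Suc k) / real N < v} k) / real N"
  shows "s \<le> v" "v \<le> s + 1 / real N"
proof -
  define m where "m = nat (\<lceil>real N * v\<rceil> - 1)"
  have iff: "real (Suc k) / real N < v \<longleftrightarrow> k < m" for k
  proof -
    have "real (Suc k) / real N < v \<longleftrightarrow> real_of_int (int k + 1) < real N * v"
      using N by (simp add: field_simps)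
    also have "\<dots> \<longleftrightarrow> int k + 1 < \<lceil>real N * v\<rceil>" by (rule less_ceiling_iff[symmetric])
    also have "\<dots> \<longleftrightarrow> k < m" unfolding m_def by linarith
    finally show ?thesis .
  qed
  have "real N * v \<le> real N" using v by (simp add: mult_left_le)
  then have "\<lceil>real N * v\<rceil> \<le> int N" by (simp add: ceiling_le_iff)
  then have "m \<le> N" by (simp add: m_def)
  have "(\<Sum>k<N. indicator {k. real (Suc k) / real N < v} k :: real) = (\<Sum>k<N. indicator {..<m} k)"
    by (intro sum.cong refl) (simp only: indicator_def mem_Collect_eq iff lessThan_iff)
  also have "\<dots> = real (card ({..<N} \<inter> {..<m}))"
    by (simp add: indicator_def sum.If_cases Int_def)
  also have "{..<N} \<inter> {..<m} = {..<m}" using \<open>m \<le> N\<close> by auto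
  finally have s: "s = real m / real N" by (simp add: s_def)
  have Nv: "0 \<le> real N * v" using v by simp
  have "real m \<le> real N * v"
  proof (cases "m = 0")
    case False
    then have "real m < real N * v" unfolding m_def using Nv by linarith
    then show ?thesis by simp
  qed (use Nv in simp)
  moreover have "real N * v \<le> real m + 1" unfolding m_def by linarith
  ultimately show "s \<le> v" "v \<le> s + 1 / real N"
    unfolding s using N by (auto simp: field_simps)
qed

text \<open>
  A discrete layer-cake formula, reducing integrals of continuous functions to measures of open sets.
\<close>

lemma (in finite_measure) integral_superlevel_bounds:
  fixes g :: "'a \<Rightarrow> real"
  assumes g [measurable]: "g \<in> borel_measurable M" and g01: "\<And>x. 0 \<le> g x" "\<And>x. g x \<le> 1" and N: "0 < N"
  defines "S \<equiv> (\<Sum>k<N. measure M {x \<in> space M. real (Suc k) / real N < g x}) / real N"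
  shows "S \<le> integral\<^sup>L M g" "integral\<^sup>L M g \<le> S + measure M (space M) / real N"
proof -
  define s where "s x = (\<Sum>k<N. indicator {x \<in> space M. real (Suc k) / real N < g x} x) / real N" for x
  have ind: "integrable M (indicator {x \<in> space M. real (Suc k) / real N < g x} :: 'a \<Rightarrow> real)" for k
  proof (rule integrable_const_bound[of _ 1])
    have [measurable]: "{x \<in> space M. real (Suc k) / real N < g x} \<in> sets M" by measurable
    show "(indicator {x \<in> space M. real (Suc k) / real N < g x} :: 'a \<Rightarrow> real) \<in> borel_measurable M"
      by measurable
  qed (simp add: indicator_def)
  have s_int: "integrable M s"
    unfolding s_def by (intro integrable_divide Bochner_Integration.integrable_sum ind)
  have S: "integral\<^sup>L M s = S"
    unfolding s_def S_def using ind by (simp add: Bochner_Integration.integral_sum)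
  have gi: "integrable M g"
    using g01 by (intro integrable_const_bound[of _ 1]) auto
  have bounds: "s x \<le> g x" "g x \<le> s x + 1 / real N" if "x \<in> space M" for x
  proof -
    have "s x = (\<Sum>k<N. indicator {k. real (Suc k) / real N < g x} k) / real N"
      unfolding s_def using that by (simp add: indicator_def)
    then show "s x \<le> g x" "g x \<le> s x + 1 / real N"
      using superlevel_count[OF g01(1)[of x] g01(2)[of x] N] by auto
  qed
  show "S \<le> integral\<^sup>L M g"
    unfolding S[symmetric] by (intro integral_mono s_int gi bounds)
  have "integral\<^sup>L M g \<le> (\<integral>x. s x + 1 / real N \<partial>M)"
    by (intro integral_mono gi bounds Bochner_Integration.integrable_add s_int) auto
  also have "\<dots> = S + measure M (space M) / real N"
    using s_int by (simp add: S[symmetric])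
  finally show "integral\<^sup>L M g \<le> S + measure M (space M) / real N" .
qed

text \<open>
  One direction of the portmanteau theorem, for measures of varying mass. For \<open>0 \<le> g \<le> 1\<close> the
  superlevel sets are open, so the hypothesis bounds the limit of the integrals from below. The same
  bound for \<open>1 - g\<close>, together with convergence of the masses, gives the upper bound, and a general \<open>f\<close>
  is rescaled.
\<close>

lemma integral_tendsto_of_open_liminf:
  fixes \<kappa> :: "'i \<Rightarrow> 'a::topological_space measure" and f :: "'a \<Rightarrow> real"
  assumes fin: "\<And>i. finite_measure (\<kappa> i)" "finite_measure \<kappa>0"
    and sets: "\<And>i. sets (\<kappa> i) = sets borel" "sets \<kappa>0 = sets borel"
    and lower: "\<And>G \<epsilon>. open G \<Longrightarrow> 0 < \<epsilon> \<Longrightarrow> eventually (\<lambda>i. measure \<kappa>0 G - \<epsilon> < measure (\<kappa> i) G) F"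
    and upper: "\<And>\<epsilon>. 0 < \<epsilon> \<Longrightarrow> eventually (\<lambda>i. measure (\<kappa> i) UNIV < measure \<kappa>0 UNIV + \<epsilon>) F"
    and f: "continuous_on UNIV f" and B: "\<And>x. \<bar>f x\<bar> \<le> B"
  shows "((\<lambda>i. integral\<^sup>L (\<kappa> i) f) \<longlongrightarrow> integral\<^sup>L \<kappa>0 f) F"
proof -
  have sp: "space (\<kappa> i) = UNIV" "space \<kappa>0 = UNIV" for i
    using sets_eq_imp_space_eq[OF sets(1)] sets_eq_imp_space_eq[OF sets(2)] by auto
  have low: "eventually (\<lambda>i. integral\<^sup>L \<kappa>0 g - \<epsilon> < integral\<^sup>L (\<kappa> i) g) F"
    if g: "continuous_on UNIV g" and g01: "\<And>x. 0 \<le> g x" "\<And>x. g x \<le> 1" and \<epsilon>: "0 < \<epsilon>" for g :: "'a \<Rightarrow> real" and \<epsilon>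
  proof -
    have gm: "g \<in> borel_measurable borel" using g by (rule borel_measurable_continuous_onI)
    define G where "G N k = {x. real (Suc k) / real N < g x}" for N k :: nat
    have Go: "open (G N k)" for N k
      unfolding G_def by (intro open_Collect_less continuous_on_const g)
    obtain N :: nat where N: "2 * measure \<kappa>0 UNIV / \<epsilon> < real N" "0 < N"
      by (metis gr0I less_trans of_nat_0 of_nat_0_less_iff reals_Archimedean2 zero_less_one of_nat_1 max_less_iff_conj)
    have "eventually (\<lambda>i. \<forall>k\<in>{..<N}. measure \<kappa>0 (G N k) - \<epsilon> / 2 < measure (\<kappa> i) (G N k)) F"
      using \<epsilon> by (intro eventually_ball_finite ballI lower Go) auto
    then show ?thesis
    proof eventually_elim
      case (elim i)
      interpret i: finite_measure "\<kappa> i" by (rule fin)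
      interpret z: finite_measure \<kappa>0 by (rule fin)
      have "integral\<^sup>L \<kappa>0 g \<le> (\<Sum>k<N. measure \<kappa>0 (G N k)) / real N + measure \<kappa>0 UNIV / real N"
        using z.integral_superlevel_bounds(2)[of g N] gm g01 N(2) sets(2) sp by (simp add: G_def cong: measurable_cong_sets)
      also have "measure \<kappa>0 UNIV / real N < \<epsilon> / 2"
        using N \<epsilon> by (simp add: field_simps)
      also have "(\<Sum>k<N. measure \<kappa>0 (G N k)) \<le> (\<Sum>k<N. measure (\<kappa> i) (G N k) + \<epsilon> / 2)"
        using elim by (intro sum_mono) (auto simp: less_imp_le algebra_simps)
      then have "(\<Sum>k<N. measure \<kappa>0 (G N k)) / real N \<le> (\<Sum>k<N. measure (\<kappa> i) (G N k) + \<epsilon> / 2) / real N"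
        by (intro divide_right_mono) auto
      also have "\<dots> = (\<Sum>k<N. measure (\<kappa> i) (G N k)) / real N + \<epsilon> / 2"
        using N(2) by (simp add: sum.distrib add_divide_distrib)
      also have "(\<Sum>k<N. measure (\<kappa> i) (G N k)) / real N \<le> integral\<^sup>L (\<kappa> i) g"
        using i.integral_superlevel_bounds(1)[of g N] gm g01 N(2) sets(1) sp by (simp add: G_def cong: measurable_cong_sets)
      finally show ?case by simp
    qed
  qed
  have mass: "((\<lambda>i. measure (\<kappa> i) UNIV) \<longlongrightarrow> measure \<kappa>0 UNIV) F"
  proof (rule tendstoI)
    fix e :: real assume "0 < e"
    from lower[OF open_UNIV this] upper[OF this]
    show "eventually (\<lambda>i. dist (measure (\<kappa> i) UNIV) (measure \<kappa>0 UNIV) < e) F"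
      by eventually_elim (auto simp: dist_real_def)
  qed
  define C where "C = B + 1"
  have "0 \<le> B" using B[of undefined] by linarith
  then have C: "0 < C" by (simp add: C_def)
  have fC: "\<bar>f x\<bar> \<le> C" for x using B[of x] by (simp add: C_def)
  define g where "g x = (f x + C) / (2 * C)" for x
  have g: "continuous_on UNIV g" unfolding g_def by (intro continuous_intros f) (use C in auto)
  have g01: "0 \<le> g x" "g x \<le> 1" for x
    using C fC[of x] by (auto simp: g_def field_simps abs_le_iff)
  have gm: "g \<in> borel_measurable borel" using g by (rule borel_measurable_continuous_onI)
  have gi: "integrable (\<kappa> i) g" "integrable \<kappa>0 g" for i
    using gm g01 fin sets by (auto intro!: finite_measure.integrable_const_bound[of _ _ 1] cong: measurable_cong_sets)
  have const: "integrable (\<kappa> i) (\<lambda>_. c)" "integrable \<kappa>0 (\<lambda>_. c)" for i and c :: real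
    using fin by (auto intro!: finite_measure.integrable_const)
  have "((\<lambda>i. integral\<^sup>L (\<kappa> i) g) \<longlongrightarrow> integral\<^sup>L \<kappa>0 g) F"
  proof (rule tendstoI)
    fix e :: real assume "0 < e"
    then have e: "0 < e / 2" "e / 2 < e" by auto
    have "continuous_on UNIV (\<lambda>x. 1 - g x)" by (intro continuous_intros g)
    from low[OF g g01 e(1)] low[OF this _ _ e(1)] upper[OF e(1)]
    have "eventually (\<lambda>i. integral\<^sup>L \<kappa>0 g - e / 2 < integral\<^sup>L (\<kappa> i) g \<and>
        (\<integral>x. 1 - g x \<partial>\<kappa>0) - e / 2 < (\<integral>x. 1 - g x \<partial>\<kappa> i) \<and> measure (\<kappa> i) UNIV < measure \<kappa>0 UNIV + e / 2) F"
      using g01 by (simp add: eventually_conj_iff)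
    then show "eventually (\<lambda>i. dist (integral\<^sup>L (\<kappa> i) g) (integral\<^sup>L \<kappa>0 g) < e) F"
    proof eventually_elim
      case (elim i)
      have "(\<integral>x. 1 - g x \<partial>\<kappa>0) = measure \<kappa>0 UNIV - integral\<^sup>L \<kappa>0 g"
        "(\<integral>x. 1 - g x \<partial>\<kappa> i) = measure (\<kappa> i) UNIV - integral\<^sup>L (\<kappa> i) g"
        using gi const sp by simp_all
      then show ?case using elim e by (auto simp: dist_real_def abs_less_iff)
    qed
  qed
  then have "((\<lambda>i. 2 * C * integral\<^sup>L (\<kappa> i) g - C * measure (\<kappa> i) UNIV) \<longlongrightarrow>
      2 * C * integral\<^sup>L \<kappa>0 g - C * measure \<kappa>0 UNIV) F"
    by (intro tendsto_intros mass)
  moreover have "f = (\<lambda>x. 2 * C * g x - C)" using C by (auto simp: g_def fun_eq_iff field_simps)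
  then have "integral\<^sup>L (\<kappa> i) f = 2 * C * integral\<^sup>L (\<kappa> i) g - C * measure (\<kappa> i) UNIV"
    "integral\<^sup>L \<kappa>0 f = 2 * C * integral\<^sup>L \<kappa>0 g - C * measure \<kappa>0 UNIV" for i
    using gi const sp by (simp_all add: mult.commute)
  ultimately show ?thesis by simp
qed

section \<open>The circle of length \<open>\<pi>\<close> inside the complex plane\<close>

lemma sets_m_pi [simp, measurable_cong]: "sets m_pi = sets borel"
  and space_m_pi [simp]: "space m_pi = UNIV"
  by (simp_all add: m_pi_def)

lemma continuous_tpi_of_real: "continuous_on UNIV tpi_of_real"
proof -
  have "open (tpi_of_real -` V)" if "open V" for V
    using that by (simp add: open_tpi_def)
  then show ?thesis by (simp add: continuous_on_open_vimage)
qed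

lemma borel_measurable_tpi_of_real [measurable]: "tpi_of_real \<in> borel_measurable borel"
  by (rule borel_measurable_continuous_onI[OF continuous_tpi_of_real])

lemma circle_point_tpi_of_real: "circle_point (tpi_of_real \<phi>) = exp (2 * \<i> * of_real \<phi>)"
  by (rule circle_point.abs_eq)

lemma tpi_of_real_cases:
  obtains \<phi> where "0 \<le> \<phi>" "\<phi> < pi" "\<alpha> = tpi_of_real \<phi>"
proof -
  obtain x where x: "\<alpha> = tpi_of_real x" by (induction \<alpha> rule: tpi.abs_induct) blast
  define k where "k = \<lfloor>x / pi\<rfloor>"
  define \<phi> where "\<phi> = x - of_int k * pi"
  have "of_int k \<le> x / pi" "x / pi < of_int k + 1" unfolding k_def by linarith+
  then have "0 \<le> \<phi>" "\<phi> < pi" using pi_gt_zero by (auto simp: \<phi>_def field_simps)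
  moreover have "\<alpha> = tpi_of_real \<phi>"
    unfolding x tpi.abs_eq_iff by (auto simp: \<phi>_def)
  ultimately show ?thesis by (rule that)
qed

lemma norm_circle_point [simp]: "norm (circle_point \<alpha>) = 1"
  by (transfer) (simp add: norm_exp_eq_Re)

lemma circle_point_shift_half: "circle_point (shift_half \<alpha>) = - circle_point \<alpha>"
proof (transfer)
  fix \<phi> :: real
  have "2 * \<i> * complex_of_real (\<phi> + pi / 2) = 2 * \<i> * of_real \<phi> + of_real pi * \<i>"
    by (simp add: algebra_simps)
  then show "exp (2 * \<i> * complex_of_real (\<phi> + pi / 2)) = - exp (2 * \<i> * of_real \<phi>)"
    by (simp only: exp_add exp_pi_i') simp
qed

lemma inj_circle_point: "inj circle_point"
proof (rule injI)
  fix \<alpha> \<beta> assume "circle_point \<alpha> = circle_point \<beta>"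
  then show "\<alpha> = \<beta>"
  proof transfer
    fix x y :: real
    assume "exp (2 * \<i> * complex_of_real x) = exp (2 * \<i> * complex_of_real y)"
    then obtain n :: int where "2 * \<i> * complex_of_real x = 2 * \<i> * of_real y + of_int (2 * n) * pi * \<i>"
      by (auto simp: exp_eq)
    then have "Im (2 * \<i> * complex_of_real x) = Im (2 * \<i> * of_real y + of_int (2 * n) * pi * \<i>)" by simp
    then show "\<exists>k::int. x - y = of_int k * pi" by (intro exI[of _ n]) simp
  qed
qed

lemma continuous_circle_point: "continuous_on UNIV circle_point"
proof -
  have "open (circle_point -` V)" if "open V" for V
  proof -
    have "tpi_of_real -` circle_point -` V = (\<lambda>\<phi>. exp (2 * \<i> * of_real \<phi>)) -` V"
      by (auto simp: circle_point_tpi_of_real)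
    moreover have "open \<dots>"
      using that by (intro open_vimage continuous_intros)
    ultimately show ?thesis by (simp add: open_tpi_def)
  qed
  then show ?thesis by (simp add: continuous_on_open_vimage)
qed

lemma borel_measurable_circle_point [measurable]: "circle_point \<in> borel_measurable borel"
  by (rule borel_measurable_continuous_onI[OF continuous_circle_point])

text \<open>
  The complement of \<open>V\<close> is the image of a compact set of parameters, hence closed.
\<close>

lemma open_tpi_eq_vimage:
  assumes "open U"
  obtains V where "open V" "U = circle_point -` V"
proof -
  define V where "V = - circle_point ` (- U)"
  have "circle_point ` (- U) = (\<lambda>\<phi>. exp (2 * \<i> * of_real \<phi>)) ` ({0..pi} \<inter> (- (tpi_of_real -` U)))"
  proof (intro set_eqI iffI)
    fix z assume "z \<in> circle_point ` (- U)"
    then obtain \<alpha> where \<alpha>: "\<alpha> \<notin> U" "z = circle_point \<alpha>" by auto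
    obtain \<phi> where "0 \<le> \<phi>" "\<phi> < pi" "\<alpha> = tpi_of_real \<phi>" by (rule tpi_of_real_cases)
    then show "z \<in> (\<lambda>\<phi>. exp (2 * \<i> * of_real \<phi>)) ` ({0..pi} \<inter> (- (tpi_of_real -` U)))"
      using \<alpha> by (intro image_eqI[of _ _ \<phi>]) (auto simp: circle_point_tpi_of_real)
  next
    fix z assume "z \<in> (\<lambda>\<phi>. exp (2 * \<i> * of_real \<phi>)) ` ({0..pi} \<inter> (- (tpi_of_real -` U)))"
    then obtain \<phi> where "tpi_of_real \<phi> \<notin> U" "z = exp (2 * \<i> * of_real \<phi>)" by auto
    then show "z \<in> circle_point ` (- U)"
      by (intro image_eqI[of _ _ "tpi_of_real \<phi>"]) (auto simp: circle_point_tpi_of_real)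
  qed
  moreover have "compact ({0..pi} \<inter> (- (tpi_of_real -` U)))"
    using assms by (intro compact_Int_closed) (auto simp: open_tpi_def closed_def)
  then have "compact ((\<lambda>\<phi>. exp (2 * \<i> * complex_of_real \<phi>)) ` ({0..pi} \<inter> (- (tpi_of_real -` U))))"
    by (intro compact_continuous_image continuous_intros)
  ultimately have "open V" by (simp add: V_def compact_imp_closed open_Compl)
  moreover have "U = circle_point -` V"
    using inj_circle_point by (auto simp: V_def inj_def)
  ultimately show ?thesis by (rule that)
qed

text \<open>
  Every Borel set of the quotient circle is cut out by a Borel set of the plane; this transports null
  sets and Hahn sets to the unit circle.
\<close>

lemma sets_tpi_eq_vimage:
  assumes "A \<in> sets (borel :: tpi measure)"
  obtains B where "B \<in> sets borel" "A = circle_point -` B"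
proof -
  have "A \<in> sigma_sets UNIV {S. open S}" using assms by (simp add: borel_def)
  then have "\<exists>B\<in>sets borel. A = circle_point -` B"
  proof induction
    case (Basic a)
    then show ?case using open_tpi_eq_vimage[of a] by (metis borel_open mem_Collect_eq)
  next
    case Empty
    show ?case by (intro bexI[of _ "{}"]) auto
  next
    case (Compl a)
    then obtain B where "B \<in> sets borel" "a = circle_point -` B" by blast
    then show ?case by (intro bexI[of _ "- B"]) (auto simp: borel_comp)
  next
    case (Union a)
    then obtain B where "\<And>i. B i \<in> sets borel" "\<And>i. a i = circle_point -` B i" by metis
    then show ?case by (intro bexI[of _ "\<Union>i. B i"]) auto
  qed
  then show ?thesis using that by blast
qed

lemma bounded_continuous_tpi:
  fixes f :: "tpi \<Rightarrow> real"
  assumes "continuous_on UNIV f"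
  obtains B where "\<And>\<alpha>. \<bar>f \<alpha>\<bar> \<le> B"
proof -
  have "continuous_on {0..pi} (\<lambda>\<phi>. f (tpi_of_real \<phi>))"
    by (rule continuous_on_compose2[OF assms continuous_on_subset[OF continuous_tpi_of_real]]) auto
  then have "bounded ((\<lambda>\<phi>. f (tpi_of_real \<phi>)) ` {0..pi})"
    by (intro compact_imp_bounded compact_continuous_image) auto
  then obtain B where B: "\<And>\<phi>. \<phi> \<in> {0..pi} \<Longrightarrow> \<bar>f (tpi_of_real \<phi>)\<bar> \<le> B"
    unfolding bounded_iff by fastforce
  have "\<bar>f \<alpha>\<bar> \<le> B" for \<alpha>
  proof -
    obtain \<phi> where "0 \<le> \<phi>" "\<phi> < pi" "\<alpha> = tpi_of_real \<phi>" by (rule tpi_of_real_cases)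
    then show ?thesis using B[of \<phi>] by simp
  qed
  then show ?thesis by (rule that)
qed

lemma distr_m_pi_circle_point: "distr m_pi borel circle_point = unif_circle"
proof (rule measure_eqI)
  fix B assume "B \<in> sets (distr m_pi borel circle_point)"
  then have B [measurable]: "B \<in> sets borel" by simp
  define X where "X = {\<phi> \<in> {0..<pi}. exp (2 * \<i> * complex_of_real \<phi>) \<in> B}"
  have X [measurable]: "X \<in> sets borel" unfolding X_def by measurable
  have "emeasure (distr m_pi borel circle_point) B = emeasure (uniform_measure lborel {0..<pi}) {\<phi>. exp (2 * \<i> * complex_of_real \<phi>) \<in> B}"
    unfolding m_pi_def by (simp add: distr_distr emeasure_distr vimage_def comp_def circle_point_tpi_of_real)
  also have "\<dots> = emeasure lborel X / ennreal pi"
  proof -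
    have "{0..<pi} \<inter> {\<phi>. exp (2 * \<i> * complex_of_real \<phi>) \<in> B} = X" by (auto simp: X_def)
    then show ?thesis by (subst emeasure_uniform_measure) auto
  qed
  also have "emeasure lborel X = ennreal pi * emeasure lborel {t. pi * t \<in> X}"
  proof -
    have "emeasure lborel X = (\<integral>\<^sup>+\<phi>. indicator X \<phi> \<partial>lborel)" by simp
    also have "\<dots> = ennreal pi * (\<integral>\<^sup>+t. indicator X (0 + pi * t) \<partial>lborel)"
      by (subst nn_integral_real_affine[where c = pi and t = 0]) auto
    also have "(\<integral>\<^sup>+t. indicator X (0 + pi * t) \<partial>lborel) = (\<integral>\<^sup>+t. indicator {t. pi * t \<in> X} t \<partial>lborel)"
      by (intro nn_integral_cong) (auto simp: indicator_def)
    also have "\<dots> = emeasure lborel {t. pi * t \<in> X}" by (rule nn_integral_indicator) measurable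
    finally show ?thesis .
  qed
  also have "ennreal pi * emeasure lborel {t. pi * t \<in> X} / ennreal pi = emeasure lborel {t. pi * t \<in> X}"
    by (simp add: ennreal_divide_times[symmetric] mult.commute[of "ennreal pi"] ennreal_mult_divide_eq)
  also have "\<dots> = emeasure lborel {t \<in> {0..1}. circlepath 0 1 t \<in> B}"
  proof (rule emeasure_eq_AE)
    show "AE t in lborel. t \<in> {t. pi * t \<in> X} \<longleftrightarrow> t \<in> {t \<in> {0..1}. circlepath 0 1 t \<in> B}"
      using AE_lborel_singleton[of 1]
    proof eventually_elim
      fix t :: real assume "t \<noteq> 1"
      then have "pi * t \<in> {0..<pi} \<longleftrightarrow> t \<in> {0..1}"
        using pi_gt_zero by (auto simp: zero_le_mult_iff simp del: pi_gt_zero)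
      moreover have "exp (2 * \<i> * complex_of_real (pi * t)) = circlepath 0 1 t"
        by (simp add: circlepath mult_ac)
      ultimately show "t \<in> {t. pi * t \<in> X} \<longleftrightarrow> t \<in> {t \<in> {0..1}. circlepath 0 1 t \<in> B}"
        by (auto simp: X_def)
    qed
    show "{t. pi * t \<in> X} \<in> sets lborel" "{t \<in> {0..1}. circlepath 0 1 t \<in> B} \<in> sets lborel" by measurable
  qed
  also have "\<dots> = emeasure unif_circle B" by (rule emeasure_unif_circle[symmetric]) simp
  finally show "emeasure (distr m_pi borel circle_point) B = emeasure unif_circle B" .
qed simp

lemma prob_space_m_pi: "prob_space m_pi"
  unfolding m_pi_def
  by (intro prob_space.prob_space_distr prob_space_uniform_measure) auto

lemma kernel_eq_herglotz_kernel: "kernel \<alpha> z = herglotz_kernel (- circle_point \<alpha>) z"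
proof transfer
  fix \<alpha> :: real and z
  let ?e = "exp (2 * \<i> * complex_of_real \<alpha>)" and ?d = "exp (- 2 * \<i> * complex_of_real \<alpha>)"
  have "?e * ?d = 1" by (simp flip: exp_add)
  then have "- ?e + z = - ?e * (1 - ?d * z)" "- ?e - z = - ?e * (1 + ?d * z)"
    by (simp_all add: algebra_simps)
  moreover have "?e \<noteq> 0" by simp
  then have "- ?e * (1 - ?d * z) / (- ?e * (1 + ?d * z)) = (1 - ?d * z) / (1 + ?d * z)"
    by (intro mult_divide_mult_cancel_left) simp
  ultimately have "(- ?e + z) / (- ?e - z) = (1 - ?d * z) / (1 + ?d * z)"
    by (simp only:)
  then show "\<i> * ((1 - ?d * z) / (1 + ?d * z)) = herglotz_kernel (- ?e) z"
    by (simp only: herglotz_kernel_def)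
qed

section \<open>Boundary values of the signed transform\<close>

text \<open>
  The sign makes the pole of the kernel coincide with the point at which the mass sits, and corresponds
  to the half turn \<open>shift_half\<close>.
\<close>

definition boundary_part :: "tpi measure \<Rightarrow> complex measure" where
  "boundary_part \<mu> = distr \<mu> borel (\<lambda>\<alpha>. - circle_point \<alpha>)"

lemma signed_transform_pair:
  fixes \<nu> :: "tpi set \<Rightarrow> real"
  assumes \<nu>: "finite_signed_measure borel \<nu>" and sing: "singular_to m_pi \<nu>"
  defines "p \<equiv> boundary_part (pos_part borel \<nu>)" and "n \<equiv> boundary_part (neg_part borel \<nu>)"
  shows "singular_circle_pair p n"
    and "herglotz_transform \<nu> z = herglotz p z - herglotz n z"
    and "B \<in> sets borel \<Longrightarrow> emeasure (total_variation borel \<nu>) ((\<lambda>\<alpha>. - circle_point \<alpha>) -` B) = ennreal (measure p B + measure n B)"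
    and "B \<in> sets borel \<Longrightarrow> \<nu> ((\<lambda>\<alpha>. - circle_point \<alpha>) -` B) = measure p B - measure n B"
    and "sets (total_variation borel \<nu>) = sets borel"
proof -
  let ?S = "\<lambda>\<alpha>. - circle_point \<alpha>"
  let ?pos = "pos_part borel \<nu>" and ?neg = "neg_part borel \<nu>" and ?tv = "total_variation borel \<nu>"
  obtain P where P: "P \<in> sets borel"
    and fin: "finite_measure ?pos" "finite_measure ?neg"
    and sets [simp, measurable_cong]: "sets ?pos = sets borel" "sets ?neg = sets borel" "sets ?tv = sets borel"
    and null: "emeasure ?pos (space borel - P) = 0" "emeasure ?neg P = 0"
    and \<nu>_eq: "\<And>A. A \<in> sets borel \<Longrightarrow> \<nu> A = measure ?pos A - measure ?neg A"
    and tv_eq: "\<And>A. A \<in> sets borel \<Longrightarrow> emeasure ?tv A = emeasure ?pos A + emeasure ?neg A"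
    by (rule Jordan_decomposition[OF \<nu>]) (rule that)
  have space [simp]: "space ?pos = UNIV" "space ?neg = UNIV" "space ?tv = UNIV"
    using sets[THEN sets_eq_imp_space_eq] by auto
  interpret pos: finite_measure ?pos by fact
  interpret neg: finite_measure ?neg by fact
  have S [measurable]: "?S \<in> borel_measurable borel" by measurable
  have Sp: "?S \<in> borel_measurable ?pos" and Sn: "?S \<in> borel_measurable ?neg" by measurable
  obtain P' where P': "P' \<in> sets borel" "P = circle_point -` P'" by (rule sets_tpi_eq_vimage[OF P])
  have tv_m_pi: "total_variation m_pi \<nu> = ?tv" by (simp add: total_variation_def)
  obtain N where N: "N \<in> sets borel" "emeasure m_pi N = 0" "emeasure ?tv (- N) = 0"
    using sing tv_m_pi unfolding singular_to_def by (auto simp: Compl_eq_Diff_UNIV)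
  obtain N' where N': "N' \<in> sets borel" "N = circle_point -` N'" by (rule sets_tpi_eq_vimage[OF N(1)])
  have minus [measurable]: "uminus -` B \<in> sets borel" if "B \<in> sets borel" for B :: "complex set"
    using measurable_sets[of uminus borel borel B] that by simp
  have "emeasure unif_circle N' = 0"
    using N(2) N' by (simp add: distr_m_pi_circle_point[symmetric] emeasure_distr)
  then have Nnull: "uminus -` N' \<in> null_sets unif_circle"
    using null_unif_circle_uminus[OF N'(1)] N'(1) by (intro null_setsI) auto
  have "emeasure ?pos (- N) + emeasure ?neg (- N) = 0"
    using tv_eq[of "- N"] N by (simp add: borel_comp)
  then have zero: "emeasure ?pos (- N) = 0" "emeasure ?neg (- N) = 0" by auto
  have AEN: "AE \<alpha> in ?pos. \<alpha> \<in> N" "AE \<alpha> in ?neg. \<alpha> \<in> N"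
    using N(1) zero by (auto intro!: AE_I[where N = "- N"] simp: borel_comp)
  have AEP: "AE \<alpha> in ?pos. \<alpha> \<in> P"
    using P null(1) by (intro AE_I[where N = "- P"]) (auto simp: borel_comp Compl_eq_Diff_UNIV)
  have AEP': "AE \<alpha> in ?neg. \<alpha> \<notin> P"
    using P null(2) by (intro AE_I[where N = P]) auto
  have AEd: "(AE \<omega> in boundary_part \<mu>. Q \<omega>) \<longleftrightarrow> (AE \<alpha> in \<mu>. Q (?S \<alpha>))"
    if [measurable_cong]: "sets \<mu> = sets borel" and Q: "{\<omega>. Q \<omega>} \<in> sets borel" for \<mu> Q
    unfolding boundary_part_def using Q by (subst AE_distr_iff) auto
  have scm: "singular_circle_measure (boundary_part \<mu>)"
    if fin: "finite_measure \<mu>" and sb [measurable_cong]: "sets \<mu> = sets borel" and AE: "AE \<alpha> in \<mu>. \<alpha> \<in> N" for \<mu>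
  proof (intro singular_circle_measure.intro circle_measure.intro circle_measure_axioms.intro singular_circle_measure_axioms.intro)
    show "finite_measure (boundary_part \<mu>)"
      unfolding boundary_part_def by (rule finite_measure.finite_measure_distr[OF fin]) measurable
    show "sets (boundary_part \<mu>) = sets borel" by (simp add: boundary_part_def)
    have "{\<omega> :: complex. norm \<omega> = 1} \<in> sets borel" by measurable
    then show "AE \<omega> in boundary_part \<mu>. norm \<omega> = 1"
      by (subst AEd[OF sb]) auto
    have "AE \<omega> in boundary_part \<mu>. \<omega> \<in> uminus -` N'"
      using AE N' minus[OF N'(1)] by (subst AEd[OF sb]) (auto elim!: eventually_mono)
    then show "\<exists>A\<in>null_sets unif_circle. AE \<omega> in boundary_part \<mu>. \<omega> \<in> A"
      using Nnull by blast
  qed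
  have scp: "singular_circle_measure p" and scn: "singular_circle_measure n"
    unfolding p_def n_def by (intro scm fin sets AEN)+
  show "singular_circle_pair p n"
  proof (intro singular_circle_pair.intro scp scn singular_circle_pair_axioms.intro bexI conjI)
    show "uminus -` P' \<in> sets borel" by (rule minus[OF P'(1)])
    show "AE \<omega> in p. \<omega> \<in> uminus -` P'"
      unfolding p_def using AEP P' minus[OF P'(1)] by (subst AEd[OF sets(1)]) (auto elim!: eventually_mono)
    show "AE \<omega> in n. \<omega> \<notin> uminus -` P'"
      unfolding n_def using AEP' P' borel_comp[OF minus[OF P'(1)]]
      by (subst AEd[OF sets(2)]) (auto elim!: eventually_mono simp: Compl_eq)
  qed
  show "herglotz_transform \<nu> z = herglotz p z - herglotz n z"
    unfolding herglotz_transform_def signed_integral_def herglotz_def p_def n_def boundary_part_def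
      kernel_eq_herglotz_kernel
    by (simp add: integral_distr[OF Sp] integral_distr[OF Sn])
  have mp: "measure p B = measure ?pos (?S -` B)" and mn: "measure n B = measure ?neg (?S -` B)" if "B \<in> sets borel" for B
    unfolding p_def n_def boundary_part_def using that by (simp_all add: measure_distr[OF Sp] measure_distr[OF Sn])
  have SB: "?S -` B \<in> sets borel" if "B \<in> sets borel" for B
    using measurable_sets[OF S that] by simp
  show "emeasure ?tv (?S -` B) = ennreal (measure p B + measure n B)" if "B \<in> sets borel" for B
    using that by (simp add: tv_eq SB mp mn pos.emeasure_eq_measure neg.emeasure_eq_measure)
  show "\<nu> (?S -` B) = measure p B - measure n B" if "B \<in> sets borel" for B
    using that by (simp add: \<nu>_eq SB mp mn)
  show "sets ?tv = sets borel" by simp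
qed

lemma (in singular_circle_pair) AE_nontangential_limit_diff:
  "AE \<zeta> in unif_circle. has_nontangential_limit (\<lambda>z. herglotz p z - herglotz n z) \<zeta> (of_real (limit \<zeta>))"
  using p.AE_nontangential_limit n.AE_nontangential_limit
proof eventually_elim
  case (elim \<zeta>)
  then show ?case
    unfolding has_nontangential_limit_def limit_def of_real_diff by (blast intro: tendsto_diff)
qed

text \<open>
  On the Borel set where the nontangential limit exists it is a limit along the radius; elsewhere
  \<open>boundary_value\<close> is zero.
\<close>

lemma borel_measurable_boundary_value:
  assumes F: "F \<in> borel_measurable borel"
  shows "(\<lambda>\<phi>. boundary_value F (circle_point \<phi>)) \<in> borel_measurable borel"
proof -
  have rad: "(\<lambda>\<zeta>::complex. F (of_real (radius j) * \<zeta>)) \<in> borel_measurable borel" for j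
    using F by measurable
  have [measurable]: "(\<lambda>\<zeta>::complex. lim (\<lambda>j. F (of_real (radius j) * \<zeta>))) \<in> borel_measurable borel"
    by (intro borel_measurable_lim_metric rad)
  have "boundary_value F (circle_point \<phi>) =
      (if circle_point \<phi> \<in> nontangential_set F then lim (\<lambda>j. F (of_real (radius j) * circle_point \<phi>)) else 0)" for \<phi>
  proof (cases "circle_point \<phi> \<in> nontangential_set F")
    case True
    then obtain L where L: "has_nontangential_limit F (circle_point \<phi>) L"
      by (auto simp: nontangential_set_def)
    then show ?thesis
      using True boundary_value_eq[OF L] limI[OF nontangential_limit_imp_radial[OF L]] by simp
  next
    case False
    then have "\<not> (\<exists>L. has_nontangential_limit F (circle_point \<phi>) L)"
      by (auto simp: nontangential_set_def)
    then have "boundary_value F (circle_point \<phi>) = 0"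
      unfolding boundary_value_def by (rule if_not_P)
    then show ?thesis using False by simp
  qed
  then have "(\<lambda>\<phi>. boundary_value F (circle_point \<phi>)) =
      (\<lambda>\<phi>. if circle_point \<phi> \<in> nontangential_set F then lim (\<lambda>j. F (of_real (radius j) * circle_point \<phi>)) else 0)"
    by blast
  moreover have "\<dots> \<in> borel_measurable borel" by measurable
  ultimately show ?thesis by simp
qed

lemma (in circle_measure) radial_limit_zero:
  assumes "measure M UNIV = 0" "norm \<zeta> = 1"
  shows "radial_limit M \<zeta> = 0"
proof -
  have "herglotz M (of_real (radius j) * \<zeta>) = 0" for j
    using norm_herglotz_le[OF AE_norm_diff_ge, of "of_real (radius j) * \<zeta>"] assms radius[of j]
    by (simp add: norm_mult)
  then show ?thesis by (simp add: radial_limit_def)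
qed

lemma (in singular_circle_pair) tail_limit:
  "((\<lambda>x. x * tail limit x) \<longlongrightarrow> 2 / pi * mass UNIV) at_top"
proof (rule tendstoI)
  fix e :: real assume "0 < e"
  from eventually_tail_lower[OF open_UNIV this] eventually_tail_upper[OF this]
  show "eventually (\<lambda>x. dist (x * tail limit x) (2 / pi * mass UNIV) < e) at_top"
    by eventually_elim (auto simp: dist_real_def abs_less_iff tail_def)
qed

text \<open>
  The Cauchy law has tail constant \<open>2 / \<pi>\<close>, while the tail constant of the boundary function is
  \<open>(2 / \<pi>) (p + n)(1)\<close>. Comparing with \<open>(p - n)(1) = 1\<close> leaves no room for \<open>n\<close>.
  Conversely, if \<open>n\<close> vanishes, the boundary function is that of the probability measure \<open>p\<close>.
\<close>

lemma (in singular_circle_pair) limit_cauchy_iff: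
  assumes mass1: "measure p UNIV - measure n UNIV = 1"
  shows "distr unif_circle borel limit = density lborel (cauchy_density 0 1) \<longleftrightarrow> measure n UNIV = 0"
proof
  assume n0: "measure n UNIV = 0"
  have "distr unif_circle borel limit = distr unif_circle borel (radial_limit p)"
  proof (rule distr_cong_AE)
    show "AE \<zeta> in unif_circle. limit \<zeta> = radial_limit p \<zeta>"
      using AE_unif_circle_norm by eventually_elim (simp add: limit_def n.radial_limit_zero[OF n0])
  qed auto
  then show "distr unif_circle borel limit = density lborel (cauchy_density 0 1)"
    using p.distr_radial_limit_cauchy mass1 n0 by simp
next
  assume law: "distr unif_circle borel limit = density lborel (cauchy_density 0 1)"
  have tail: "tail limit x = 1 - 2 / pi * arctan x" if "0 \<le> x" for x
    using cauchy_tail[OF that] unfolding law[symmetric]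
    by (subst (asm) measure_distr) (auto simp: vimage_def tail_def)
  have "((\<lambda>x. x * (1 - 2 / pi * arctan x)) \<longlongrightarrow> 2 / pi) at_top"
    by real_asymp
  moreover have "eventually (\<lambda>x. x * (1 - 2 / pi * arctan x) = x * tail limit x) at_top"
    using eventually_ge_at_top[of 0] by eventually_elim (simp add: tail)
  ultimately have "((\<lambda>x. x * tail limit x) \<longlongrightarrow> 2 / pi) at_top"
    by (rule Lim_transform_eventually)
  moreover have "((\<lambda>x. x * tail limit x) \<longlongrightarrow> 2 / pi * mass UNIV) at_top"
    by (rule tail_limit)
  ultimately have "2 / pi * mass UNIV = 2 / pi"
    by (intro tendsto_unique[of at_top]) auto
  then have "mass UNIV = 1" by simp
  then show "measure n UNIV = 0" using mass1 by (simp add: mass_def)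
qed

theorem theorem3p5:
  fixes \<nu> :: "tpi set \<Rightarrow> real"
  assumes "finite_signed_measure borel \<nu>"
    and "singular_to m_pi \<nu>"
    and "\<nu> UNIV = 1"
  defines "Fstar \<equiv> boundary_value (herglotz_transform \<nu>)"
  shows "(AE \<phi> in m_pi. (\<exists>L. has_nontangential_limit (herglotz_transform \<nu>) (circle_point \<phi>) L) \<and>
            Fstar (circle_point \<phi>) \<in> \<real>)
    \<and> weak_star_tendsto
        (\<lambda>x::real. density m_pi
           (\<lambda>\<phi>. ennreal (pi * x) * indicator {\<phi>. cmod (Fstar (circle_point \<phi>)) > x} \<phi>))
        (scale_measure 2 (distr (total_variation borel \<nu>) borel shift_half)) at_top
    \<and> ((\<lambda>x::real. x * measure m_pi {\<phi>. cmod (Fstar (circle_point \<phi>)) > x})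
         \<longlongrightarrow> 2 / pi * tv_norm borel \<nu>) at_top
    \<and> (\<forall>(\<Omega> :: 'w measure) \<Phi>. prob_space \<Omega> \<longrightarrow> \<Phi> \<in> measurable \<Omega> borel \<longrightarrow>
         distr \<Omega> borel \<Phi> = m_pi \<longrightarrow>
         (distributed \<Omega> lborel (\<lambda>\<omega>. Re (Fstar (circle_point (\<Phi> \<omega>)))) (cauchy_density 0 1)
            \<longleftrightarrow> is_positive_probability borel \<nu>))"
proof -
  define p n where "p = boundary_part (pos_part borel \<nu>)" and "n = boundary_part (neg_part borel \<nu>)"
  note pair = signed_transform_pair[OF assms(1,2), folded p_def n_def]
  interpret singular_circle_pair p n by (rule pair(1))
  let ?F = "herglotz_transform \<nu>" and ?tv = "total_variation borel \<nu>" and ?S = "\<lambda>\<alpha>. - circle_point \<alpha>"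
  interpret m: prob_space m_pi by (rule prob_space_m_pi)
  have F_eq: "?F = (\<lambda>z. herglotz p z - herglotz n z)" using pair(2) by blast
  have Fm: "?F \<in> borel_measurable borel" unfolding F_eq by measurable
  have bvm [measurable]: "(\<lambda>\<phi>. Fstar (circle_point \<phi>)) \<in> borel_measurable borel"
    unfolding Fstar_def by (rule borel_measurable_boundary_value[OF Fm])
  have AElim: "AE \<phi> in m_pi. has_nontangential_limit ?F (circle_point \<phi>) (of_real (limit (circle_point \<phi>)))"
    using AE_nontangential_limit_diff unfolding F_eq distr_m_pi_circle_point[symmetric]
    by (rule AE_distrD[rotated]) measurable
  then have AEbv: "AE \<phi> in m_pi. Fstar (circle_point \<phi>) = of_real (limit (circle_point \<phi>))"
    unfolding Fstar_def by eventually_elim (auto intro: boundary_value_eq)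
  have first: "AE \<phi> in m_pi. (\<exists>L. has_nontangential_limit ?F (circle_point \<phi>) L) \<and> Fstar (circle_point \<phi>) \<in> \<real>"
    using AElim AEbv by eventually_elim auto
  have tail_eq: "measure m_pi (circle_point -` V \<inter> {\<phi>. cmod (Fstar (circle_point \<phi>)) > x})
      = measure unif_circle {\<zeta> \<in> V. x < \<bar>limit \<zeta>\<bar>}" if [measurable]: "V \<in> sets borel" for V x
  proof -
    have Vm: "circle_point -` V \<in> sets borel"
      using measurable_sets[OF borel_measurable_circle_point that] by simp
    have E: "{\<zeta> \<in> V. x < \<bar>limit \<zeta>\<bar>} \<in> sets borel" by measurable
    have "measure m_pi (circle_point -` V \<inter> {\<phi>. cmod (Fstar (circle_point \<phi>)) > x})
        = measure m_pi (circle_point -` {\<zeta> \<in> V. x < \<bar>limit \<zeta>\<bar>})"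
    proof (rule measure_eq_AE)
      show "AE \<phi> in m_pi. \<phi> \<in> circle_point -` V \<inter> {\<phi>. cmod (Fstar (circle_point \<phi>)) > x} \<longleftrightarrow>
          \<phi> \<in> circle_point -` {\<zeta> \<in> V. x < \<bar>limit \<zeta>\<bar>}"
        using AEbv by eventually_elim auto
      have "{\<phi>. cmod (Fstar (circle_point \<phi>)) > x} \<in> sets borel" by measurable
      then show "circle_point -` V \<inter> {\<phi>. cmod (Fstar (circle_point \<phi>)) > x} \<in> sets m_pi"
        using Vm by simp
      show "circle_point -` {\<zeta> \<in> V. x < \<bar>limit \<zeta>\<bar>} \<in> sets m_pi"
        using measurable_sets[OF borel_measurable_circle_point E] by simp
    qed
    also have "\<dots> = measure unif_circle {\<zeta> \<in> V. x < \<bar>limit \<zeta>\<bar>}"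
      unfolding distr_m_pi_circle_point[symmetric] using E by (subst measure_distr) auto
    finally show ?thesis .
  qed
  have tv_norm: "tv_norm borel \<nu> = mass UNIV"
    using pair(3)[of UNIV] by (auto simp: tv_norm_def mass_def intro!: measure_eq_emeasure_eq_ennreal)
  have third: "((\<lambda>x::real. x * measure m_pi {\<phi>. cmod (Fstar (circle_point \<phi>)) > x}) \<longlongrightarrow> 2 / pi * tv_norm borel \<nu>) at_top"
    using tail_limit tail_eq[of UNIV] by (simp add: tv_norm tail_def)
  define \<kappa> where "\<kappa> x = density m_pi (\<lambda>\<phi>. ennreal (pi * x) * indicator {\<phi>. cmod (Fstar (circle_point \<phi>)) > x} \<phi>)" for x
  define \<kappa>0 where "\<kappa>0 = scale_measure 2 (distr ?tv borel shift_half)"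
  have \<kappa>_sets: "sets (\<kappa> x) = sets borel" "sets \<kappa>0 = sets borel" for x
    by (simp_all add: \<kappa>_def \<kappa>0_def)
  \<comment> \<open>By \<open>open_tpi_eq_vimage\<close>, preimages under \<open>circle_point\<close> account for all open sets.\<close>
  have \<kappa>_em: "emeasure (\<kappa> x) (circle_point -` V) = ennreal (pi * x) * ennreal (measure unif_circle {\<zeta> \<in> V. x < \<bar>limit \<zeta>\<bar>})"
    if V: "V \<in> sets borel" for V x
  proof -
    let ?E = "{\<phi>. cmod (Fstar (circle_point \<phi>)) > x}"
    have E: "?E \<in> sets borel" by measurable
    have Vm: "circle_point -` V \<in> sets borel"
      using measurable_sets[OF borel_measurable_circle_point V] by simp
    have "emeasure (\<kappa> x) (circle_point -` V) = (\<integral>\<^sup>+\<phi>. ennreal (pi * x) * indicator (circle_point -` V \<inter> ?E) \<phi> \<partial>m_pi)"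
      unfolding \<kappa>_def using E Vm
      by (subst emeasure_density) (auto intro!: nn_integral_cong simp: indicator_def)
    also have "\<dots> = ennreal (pi * x) * emeasure m_pi (circle_point -` V \<inter> ?E)"
      using E Vm by (intro nn_integral_cmult_indicator) simp
    finally show ?thesis using tail_eq[OF V] by (simp add: m.emeasure_eq_measure)
  qed
  have \<kappa>_measure: "measure (\<kappa> x) (circle_point -` V) = pi * (x * measure unif_circle {\<zeta> \<in> V. x < \<bar>limit \<zeta>\<bar>})"
    if "V \<in> sets borel" "0 \<le> x" for V x
    using \<kappa>_em[OF that(1), of x] that(2) by (simp add: measure_def flip: ennreal_mult)
  have shift_vimage: "shift_half -` circle_point -` V = ?S -` V" for V
    by (auto simp: circle_point_shift_half)
  have shift_m: "shift_half \<in> borel_measurable borel"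
  proof (rule borel_measurableI)
    fix U :: "tpi set" assume "open U"
    then obtain V where V: "open V" "U = circle_point -` V" by (rule open_tpi_eq_vimage)
    have "?S \<in> borel_measurable borel" by measurable
    then show "shift_half -` U \<inter> space borel \<in> sets borel"
      unfolding V(2) shift_vimage using V(1) measurable_sets[of ?S borel borel V] by simp
  qed
  then have shift_tv: "shift_half \<in> borel_measurable ?tv"
    using pair(5) by (simp cong: measurable_cong_sets)
  have tv_space: "space ?tv = UNIV" using sets_eq_imp_space_eq[OF pair(5)] by simp
  have \<kappa>0_em: "emeasure \<kappa>0 (circle_point -` V) = ennreal (2 * mass V)" if V: "V \<in> sets borel" for V
  proof -
    have Vm: "circle_point -` V \<in> sets borel"
      using measurable_sets[OF borel_measurable_circle_point V] by simp
    have "emeasure \<kappa>0 (circle_point -` V) = 2 * emeasure ?tv (?S -` V)"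
      using Vm by (simp add: \<kappa>0_def emeasure_distr[OF shift_tv] tv_space shift_vimage)
    also have "\<dots> = ennreal (2 * mass V)"
      unfolding pair(3)[OF V] mass_def using ennreal_mult[of 2 "measure p V + measure n V"]
      by (simp del: ennreal_plus)
    finally show ?thesis .
  qed
  have mass0: "0 \<le> mass V" for V by (simp add: mass_def)
  have \<kappa>0_measure: "measure \<kappa>0 (circle_point -` V) = 2 * mass V" if "V \<in> sets borel" for V
    using \<kappa>0_em[OF that] mass0[of V] by (simp add: measure_def)
  have UNIV_v: "(UNIV :: tpi set) = circle_point -` UNIV" by simp
  have second: "weak_star_tendsto \<kappa> \<kappa>0 at_top"
    unfolding weak_star_tendsto_def
  proof (intro allI impI)
    fix f :: "tpi \<Rightarrow> real" assume f: "continuous_on UNIV f"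
    obtain B where B: "\<And>\<alpha>. \<bar>f \<alpha>\<bar> \<le> B" using bounded_continuous_tpi[OF f] by blast
    show "((\<lambda>x. integral\<^sup>L (\<kappa> x) f) \<longlongrightarrow> integral\<^sup>L \<kappa>0 f) at_top"
    proof (rule integral_tendsto_of_open_liminf[OF _ _ \<kappa>_sets _ _ f B])
      show "finite_measure (\<kappa> x)" for x
        using \<kappa>_em[of UNIV x] sets_eq_imp_space_eq[OF \<kappa>_sets(1)[of x]]
        by (intro finite_measureI) (simp add: ennreal_mult_eq_top_iff)
      show "finite_measure \<kappa>0"
        using \<kappa>0_em[of UNIV] sets_eq_imp_space_eq[OF \<kappa>_sets(2)] by (intro finite_measureI) simp
    next
      fix G :: "tpi set" and \<epsilon> :: real assume "open G" and \<epsilon>: "0 < \<epsilon>"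
      then obtain V where V: "open V" "G = circle_point -` V" using open_tpi_eq_vimage by blast
      have "0 < \<epsilon> / pi" using \<epsilon> by simp
      from eventually_tail_lower[OF V(1) this] eventually_ge_at_top[of 0]
      show "eventually (\<lambda>x. measure \<kappa>0 G - \<epsilon> < measure (\<kappa> x) G) at_top"
      proof eventually_elim
        case (elim x)
        have "pi * (2 / pi * mass V - \<epsilon> / pi) < pi * (x * measure unif_circle {\<zeta> \<in> V. x < \<bar>limit \<zeta>\<bar>})"
          using elim(1) by (intro mult_strict_left_mono) auto
        then show ?case
          using V elim(2) by (simp add: \<kappa>_measure \<kappa>0_measure right_diff_distrib)
      qed
    next
      fix \<epsilon> :: real assume \<epsilon>: "0 < \<epsilon>"
      then have "0 < \<epsilon> / pi" by simp
      from eventually_tail_upper[OF this] eventually_ge_at_top[of 0]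
      show "eventually (\<lambda>x. measure (\<kappa> x) UNIV < measure \<kappa>0 UNIV + \<epsilon>) at_top"
      proof eventually_elim
        case (elim x)
        have "pi * (x * tail limit x) < pi * (2 / pi * mass UNIV + \<epsilon> / pi)"
          using elim(1) by (intro mult_strict_left_mono) auto
        then show ?case
          using elim(2) \<kappa>_measure[of UNIV x] \<kappa>0_measure[of UNIV] by (simp add: distrib_left tail_def)
      qed
    qed
  qed
  have mass1: "measure p UNIV - measure n UNIV = 1"
    using pair(4)[of UNIV] assms(3) by simp
  \<comment> \<open>The measure \<open>n\<close> lives on the complement of a set \<open>A\<close> that carries \<open>p\<close>; a positive \<open>\<nu>\<close> has no room for it there.\<close>
  have positive_iff: "is_positive_probability borel \<nu> \<longleftrightarrow> measure n UNIV = 0"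
  proof
    assume "is_positive_probability borel \<nu>"
    then have \<nu>0: "0 \<le> \<nu> A" if "A \<in> sets borel" for A
      using that by (auto simp: is_positive_probability_def)
    obtain A where A: "A \<in> sets borel" "AE \<omega> in p. \<omega> \<in> A" "AE \<omega> in n. \<omega> \<notin> A"
      using mutually_singular by blast
    have Ac: "- A \<in> sets borel" using A(1) by (rule borel_comp)
    have "?S \<in> borel_measurable borel" by measurable
    then have "?S -` (- A) \<in> sets borel"
      using measurable_sets[of ?S borel borel "- A"] Ac by simp
    then have "measure n (- A) \<le> measure p (- A)"
      using \<nu>0 pair(4)[OF Ac] by fastforce
    also have "measure p (- A) = measure p {}"
      using A(2) Ac by (intro measure_eq_AE) (auto elim!: eventually_mono)
    finally have "measure n (- A) \<le> 0" by simp
    moreover have "measure n UNIV = measure n (- A)"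
      using A(3) Ac by (intro measure_eq_AE) (auto elim!: eventually_mono)
    ultimately show "measure n UNIV = 0" using measure_nonneg[of n UNIV] by linarith
  next
    assume n0: "measure n UNIV = 0"
    show "is_positive_probability borel \<nu>"
    proof (rule Jordan_decomposition[OF assms(1)])
      let ?pos = "pos_part borel \<nu>" and ?neg = "neg_part borel \<nu>"
      assume fin: "finite_measure ?pos" "finite_measure ?neg"
        and sets: "sets ?pos = sets borel" "sets ?neg = sets borel"
        and \<nu>_eq: "\<And>A. A \<in> sets borel \<Longrightarrow> \<nu> A = measure ?pos A - measure ?neg A"
      have space: "space ?pos = UNIV" "space ?neg = UNIV"
        using sets[THEN sets_eq_imp_space_eq] by auto
      interpret neg: finite_measure ?neg by fact
      interpret pos: finite_measure ?pos by fact
      have Sn: "?S \<in> borel_measurable ?neg"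
        using sets(2) by (simp cong: measurable_cong_sets)
      have "measure ?neg UNIV = 0"
        using n0 unfolding n_def boundary_part_def by (simp add: measure_distr[OF Sn] space)
      then have "measure ?neg A = 0" for A
        using neg.bounded_measure[of A] space by (simp add: measure_le_0_iff)
      then have eq: "\<nu> A = measure ?pos A" if "A \<in> sets borel" for A
        using \<nu>_eq[OF that] by simp
      have "prob_space ?pos"
        using eq[of UNIV] assms(3) space pos.emeasure_eq_measure[of UNIV] by (intro prob_spaceI) simp
      then show ?thesis
        unfolding is_positive_probability_def using eq sets(1) by blast
    qed
  qed
  have fourth: "distributed \<Omega> lborel (\<lambda>\<omega>. Re (Fstar (circle_point (\<Phi> \<omega>)))) (cauchy_density 0 1)
      \<longleftrightarrow> is_positive_probability borel \<nu>"
    if \<Phi>: "\<Phi> \<in> measurable \<Omega> borel" and law: "distr \<Omega> borel \<Phi> = m_pi" for \<Omega> :: "'w measure" and \<Phi>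
  proof -
    note [measurable] = \<Phi>
    let ?Y = "\<lambda>\<phi>. Re (Fstar (circle_point \<phi>))"
    have Y [measurable]: "?Y \<in> borel_measurable borel" by measurable
    have "distr \<Omega> lborel (\<lambda>\<omega>. ?Y (\<Phi> \<omega>)) = distr \<Omega> borel (\<lambda>\<omega>. ?Y (\<Phi> \<omega>))"
      by (intro distr_cong) auto
    also have "\<dots> = distr m_pi borel ?Y"
      unfolding law[symmetric] by (subst distr_distr) (auto simp: comp_def)
    also have "\<dots> = distr m_pi borel (\<lambda>\<phi>. limit (circle_point \<phi>))"
    proof (rule distr_cong_AE)
      show "AE \<phi> in m_pi. ?Y \<phi> = limit (circle_point \<phi>)"
        using AEbv by eventually_elim simp
    qed auto
    also have "\<dots> = distr unif_circle borel limit"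
      unfolding distr_m_pi_circle_point[symmetric] by (subst distr_distr) (auto simp: comp_def)
    finally have "distr \<Omega> lborel (\<lambda>\<omega>. ?Y (\<Phi> \<omega>)) = distr unif_circle borel limit" .
    then have "distributed \<Omega> lborel (\<lambda>\<omega>. ?Y (\<Phi> \<omega>)) (cauchy_density 0 1) \<longleftrightarrow>
        distr unif_circle borel limit = density lborel (cauchy_density 0 1)"
      unfolding distributed_def by simp
    then show ?thesis using limit_cauchy_iff[OF mass1] positive_iff by simp
  qed
  show ?thesis
    using first second third fourth unfolding \<kappa>_def \<kappa>0_def by blast
qed

end
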